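(* In the combinatorial Marker-Cutter game with initial counter $g_0$, played against restricted Cutter, Marker has a strategy ensuring that the value of every game state is at most $\frac43 g_0+\frac{10}{3}$.
   Context: A set of boundary cycles is a pair $(D,\chi)$: $D$ a finite directed graph each of whose components is a directed cycle (loops allowed, no isolated vertices), $\chi:E(D)\to L$ an edge labelling; proper if each label is used on at most two edges. A game state is $\gamma=(D,\chi,g)$ with $(D,\chi)$ proper, $g\in\mathbb N_0$; its value $v(\gamma)$ is the number of distinct labels used. Combinatorial Marker-Cutter game: start with $D_0$ empty, $\chi_0$ empty and counter $g_0\in\mathbb N$. At turn $k$ with state $(D_k,\chi_k,g_k)$, Marker chooses $v,w$ (not necessarily distinct) from $V(D_k)\sqcup\{v_\gamma,w_\gamma\}$ (dummy vertices; each chosen dummy vertex, without multiplicity, is added as a new vertex). Let $C,C'$ be the components containing $v,w$. Splitting a vertex $u$ replaces it by a source $u_1$ (incident to the out-edge) and a sink $u_2$ (incident to the in-edge). If $C=C'$: splitting turns $C$ into a directed path $P$ from $v_1$ to $w_2$ and a directed path $P'$ from $w_1$ to $v_2$ (trivial paths with $v_1=w_2$, $v_2=w_1$ if $v=w$ is dummy); new edges $f=\overrightarrow{w_2v_1}$, $f'=\overrightarrow{v_2w_1}$; $\hat C_1=P\cup\{f\}$, $\hat C_2=P'\cup\{f'\}$. Cutter chooses (a) $D_{k+1}=\bar D\cup\hat C_1\cup\hat C_2$, $g_{k+1}=g_k-1$ (only if $g_k\ge1$); (b) $D_{k+1}=\bar D\cup\hat C_1$, $g_{k+1}=\bar g$;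 (c) $D_{k+1}=\bar D\cup\hat C_2$, $g_{k+1}=\bar g$; with $\bar D$ a union of components of $D_k\setminus C$, $0\le\bar g\le g_k$. If $C\ne C'$: splitting turns $C$ into a path $P$ from $v_1$ to $v_2$ (trivial if $v$ dummy) and $C'$ into $P'$ from $w_1$ to $w_2$; the only move (d) is $D_{k+1}=(D_k\cup\hat C)\setminus(C\cup C')$ with $\hat C=P\cup P'\cup\{\overrightarrow{w_2v_1},\overrightarrow{v_2w_1}\}$, $g_{k+1}=g_k$. In all cases old labels are kept and the new edges receive one common new label not previously used. A contraction contracts one edge (deleting resulting isolated vertices). $(D',\chi',g')$ is a reduction of $(D,\chi,g)$ if $g'\le g$, $D'$ is obtained from $D$ by contractions and $\chi'=\chi$ on $E(D')$. Game states are equivalent if they are isomorphic as labelled digraphs up to a bijective relabelling and have equal counters. Restricted Cutter may never make a move producing a game state equivalent to a reduction of an earlier game state (including the current one), and in moves (a), (b), (c) must take $\bar D=D_k\setminus C$ and $\bar g=g_k$; if restricted Cutter has no legal move, the game ends. *)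

theory Defs
  imports "Graph_Theory.Graph_Theory"
begin

text \<open>
  Vertices and edges are named by natural numbers; labels are elements of an arbitrary type.
  Edge labellings are total functions of which only the values on the edges of the graph matter.
\<close>

type_synonym dgraph = "(nat, nat) pre_digraph"

type_synonym 'l state = "dgraph \<times> (nat \<Rightarrow> 'l) \<times> nat"

text \<open>Components are taken in the underlying undirected graph.\<close>

definition component :: "dgraph \<Rightarrow> nat \<Rightarrow> dgraph" where
  "component D u = D \<restriction> {x. u \<rightarrow>\<^sup>*\<^bsub>with_proj (mk_symmetric D)\<^esub> x}"

definition directed_cycle :: "dgraph \<Rightarrow> bool" where
  "directed_cycle C \<longleftrightarrow>
     (\<exists>p. pre_digraph.cycle C p \<and> set p = arcs C \<and> verts C = tail C ` set p)"

definition boundary_cycles :: "dgraph \<Rightarrow> bool" where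
  "boundary_cycles D \<longleftrightarrow>
     fin_digraph D \<and> (\<forall>u \<in> verts D. directed_cycle (component D u))"

definition proper_labelling :: "dgraph \<Rightarrow> (nat \<Rightarrow> 'l) \<Rightarrow> bool" where
  "proper_labelling D \<chi> \<longleftrightarrow> (\<forall>l. card {e \<in> arcs D. \<chi> e = l} \<le> 2)"

fun game_state :: "'l state \<Rightarrow> bool" where
  "game_state (D, \<chi>, g) \<longleftrightarrow> boundary_cycles D \<and> proper_labelling D \<chi>"

fun labels :: "'l state \<Rightarrow> 'l set" where
  "labels (D, \<chi>, g) = \<chi> ` arcs D"

definition state_value :: "'l state \<Rightarrow> nat" where
  "state_value \<gamma> = card (labels \<gamma>)"

definition initial_state :: "nat \<Rightarrow> 'l state" where
  "initial_state g0 =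
     (\<lparr>verts = {}, arcs = {}, tail = undefined, head = undefined\<rparr>, undefined, g0)"

datatype choice = Vertex nat | Dummy_v | Dummy_w

definition legal_choice :: "dgraph \<Rightarrow> choice \<Rightarrow> bool" where
  "legal_choice D c \<longleftrightarrow> (case c of Vertex u \<Rightarrow> u \<in> verts D | Dummy_v \<Rightarrow> True | Dummy_w \<Rightarrow> True)"

fun locate :: "nat \<Rightarrow> nat \<Rightarrow> choice \<Rightarrow> nat" where
  "locate d d' (Vertex u) = u"
| "locate d d' Dummy_v = d"
| "locate d d' Dummy_w = d'"

text \<open>\<open>x\<close> and \<open>y\<close> are the chosen vertices once the two dummies have been given
  distinct names outside \<open>D\<close>.\<close>

definition placed :: "dgraph \<Rightarrow> choice \<Rightarrow> choice \<Rightarrow> nat \<Rightarrow> nat \<Rightarrow> bool" where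
  "placed D v w x y \<longleftrightarrow>
     (\<exists>d d'. d \<noteq> d' \<and> d \<notin> verts D \<and> d' \<notin> verts D \<and> x = locate d d' v \<and> y = locate d d' w)"

definition with_dummies :: "dgraph \<Rightarrow> nat \<Rightarrow> nat \<Rightarrow> dgraph" where
  "with_dummies D x y = D\<lparr>verts := verts D \<union> {x, y}\<rparr>"

text \<open>Replace \<open>u\<close> by a source \<open>a\<close> and a sink \<open>b\<close>. For an isolated vertex \<open>u\<close>, taking
  \<open>a = b\<close> yields the trivial path.\<close>

definition split_vertex :: "dgraph \<Rightarrow> nat \<Rightarrow> nat \<Rightarrow> nat \<Rightarrow> dgraph" where
  "split_vertex G u a b =
     \<lparr>verts = (verts G - {u}) \<union> {a, b}, arcs = arcs G,
      tail = (\<lambda>e. if tail G e = u then a else tail G e),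
      head = (\<lambda>e. if head G e = u then b else head G e)\<rparr>"

definition insert_edge :: "dgraph \<Rightarrow> nat \<Rightarrow> nat \<Rightarrow> nat \<Rightarrow> dgraph" where
  "insert_edge G e a b =
     \<lparr>verts = verts G \<union> {a, b}, arcs = insert e (arcs G),
      tail = (tail G)(e := a), head = (head G)(e := b)\<rparr>"

text \<open>Unlike \<^const>\<open>union\<close>, this takes the end points of each edge from the graph it comes from.\<close>

definition graph_union :: "dgraph \<Rightarrow> dgraph \<Rightarrow> dgraph" where
  "graph_union G H =
     \<lparr>verts = verts G \<union> verts H, arcs = arcs G \<union> arcs H,
      tail = (\<lambda>e. if e \<in> arcs G then tail G e else tail H e),
      head = (\<lambda>e. if e \<in> arcs G then head G e else head H e)\<rparr>"

definition delete_part :: "dgraph \<Rightarrow> dgraph \<Rightarrow> dgraph" where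
  "delete_part D C = D \<restriction> (verts D - verts C)"

definition union_of_components :: "dgraph \<Rightarrow> dgraph \<Rightarrow> bool" where
  "union_of_components K H \<longleftrightarrow>
     (\<exists>U \<subseteq> verts H. K = H \<restriction> (\<Union>u\<in>U. verts (component H u)))"

text \<open>
  Splitting \<open>C\<close> at \<open>x\<close> (into \<open>v1\<close>, \<open>v2\<close>) and \<open>y\<close> (into \<open>w1\<close>, \<open>w2\<close>).
  If \<open>x = y\<close>, the path from \<open>w1\<close> to \<open>v2\<close> is trivial, and the path from \<open>v1\<close> to \<open>w2\<close> is
  the cycle opened at \<open>x\<close>; the latter is trivial as well exactly if \<open>x\<close> is a dummy.
  Exchanging the two paths for \<open>x = y\<close> only exchanges Cutter's options (b) and (c).
\<close>

definition split_same ::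
  "dgraph \<Rightarrow> dgraph \<Rightarrow> nat \<Rightarrow> nat \<Rightarrow> nat \<Rightarrow> nat \<Rightarrow> nat \<Rightarrow> nat \<Rightarrow> dgraph \<Rightarrow> bool" where
  "split_same D C x y v1 v2 w1 w2 S \<longleftrightarrow>
     {v1, v2, w1, w2} \<inter> (verts D \<union> {x, y}) = {} \<and>
     (if x \<noteq> y
      then distinct [v1, v2, w1, w2] \<and> S = split_vertex (split_vertex C x v1 v2) y w1 w2
      else w1 = v2 \<and> v2 \<notin> {v1, w2} \<and> (v1 = w2 \<longleftrightarrow> x \<notin> verts D) \<and>
           S = pre_digraph.add_vert (split_vertex C x v1 w2) v2)"

definition cut_cycle ::
  "dgraph \<Rightarrow> nat \<Rightarrow> nat \<Rightarrow> nat \<Rightarrow> nat \<Rightarrow> dgraph \<Rightarrow> dgraph \<Rightarrow> bool" where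
  "cut_cycle D x y f f' C1 C2 \<longleftrightarrow>
     (\<exists>v1 v2 w1 w2 S.
        split_same D (component (with_dummies D x y) x) x y v1 v2 w1 w2 S \<and>
        C1 = insert_edge (component S v1) f w2 v1 \<and>
        C2 = insert_edge (component S w1) f' v2 w1)"

definition join_cycles ::
  "dgraph \<Rightarrow> nat \<Rightarrow> nat \<Rightarrow> nat \<Rightarrow> nat \<Rightarrow> dgraph \<Rightarrow> bool" where
  "join_cycles D x y f f' C \<longleftrightarrow>
     (\<exists>v1 v2 w1 w2 P P'.
        {v1, v2, w1, w2} \<inter> (verts D \<union> {x, y}) = {} \<and> {v1, v2} \<inter> {w1, w2} = {} \<and>
        (v1 = v2 \<longleftrightarrow> x \<notin> verts D) \<and> (w1 = w2 \<longleftrightarrow> y \<notin> verts D) \<and>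
        P = split_vertex (component (with_dummies D x y) x) x v1 v2 \<and>
        P' = split_vertex (component (with_dummies D x y) y) y w1 w2 \<and>
        C = insert_edge (insert_edge (graph_union P P') f w2 v1) f' v2 w1)"

text \<open>
  \<open>U\<close> is the set of labels used so far, \<open>x\<close> and \<open>y\<close> are the vertices chosen by Marker,
  and \<open>Db\<close>, \<open>gb\<close> are Cutter's choices of \<open>\<bar>D\<close>, \<open>\<bar>g\<close>, where these play a role.
\<close>

definition new_edges :: "'l set \<Rightarrow> dgraph \<Rightarrow> nat \<Rightarrow> nat \<Rightarrow> 'l \<Rightarrow> bool" where
  "new_edges U D f f' l \<longleftrightarrow> f \<noteq> f' \<and> f \<notin> arcs D \<and> f' \<notin> arcs D \<and> l \<notin> U"

definition same_component :: "dgraph \<Rightarrow> nat \<Rightarrow> nat \<Rightarrow> bool" where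
  "same_component D x y \<longleftrightarrow>
     component (with_dummies D x y) x = component (with_dummies D x y) y"

definition other_components :: "dgraph \<Rightarrow> nat \<Rightarrow> nat \<Rightarrow> dgraph" where
  "other_components D x y = delete_part D (component (with_dummies D x y) x)"

inductive cutter_move ::
  "'l set \<Rightarrow> 'l state \<Rightarrow> nat \<Rightarrow> nat \<Rightarrow> dgraph \<Rightarrow> nat \<Rightarrow> 'l state \<Rightarrow> bool"
  for U :: "'l set" where
  move_a:
    "\<lbrakk>same_component D x y; new_edges U D f f' l; cut_cycle D x y f f' C1 C2;
      union_of_components Db (other_components D x y); g \<ge> 1\<rbrakk>
     \<Longrightarrow> cutter_move U (D, \<chi>, g) x y Db gb
           (graph_union Db (graph_union C1 C2), \<chi>(f := l, f' := l), g - 1)"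
| move_b:
    "\<lbrakk>same_component D x y; new_edges U D f f' l; cut_cycle D x y f f' C1 C2;
      union_of_components Db (other_components D x y); gb \<le> g\<rbrakk>
     \<Longrightarrow> cutter_move U (D, \<chi>, g) x y Db gb
           (graph_union Db C1, \<chi>(f := l, f' := l), gb)"
| move_c:
    "\<lbrakk>same_component D x y; new_edges U D f f' l; cut_cycle D x y f f' C1 C2;
      union_of_components Db (other_components D x y); gb \<le> g\<rbrakk>
     \<Longrightarrow> cutter_move U (D, \<chi>, g) x y Db gb
           (graph_union Db C2, \<chi>(f := l, f' := l), gb)"
| move_d:
    "\<lbrakk>\<not> same_component D x y; new_edges U D f f' l; join_cycles D x y f f' C\<rbrakk>
     \<Longrightarrow> cutter_move U (D, \<chi>, g) x y Db gb
           (graph_union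
              (delete_part (other_components D x y) (component (with_dummies D x y) y)) C,
            \<chi>(f := l, f' := l), g)"

definition contract :: "dgraph \<Rightarrow> nat \<Rightarrow> dgraph" where
  "contract D e =
     (let m = (\<lambda>x. if x = head D e then tail D e else x);
          A = arcs D - {e}
      in \<lparr>verts = {x \<in> m ` verts D. \<exists>a\<in>A. x = m (tail D a) \<or> x = m (head D a)},
          arcs = A, tail = m \<circ> tail D, head = m \<circ> head D\<rparr>)"

definition contraction :: "dgraph \<Rightarrow> dgraph \<Rightarrow> bool" where
  "contraction D D' \<longleftrightarrow> (\<exists>e \<in> arcs D. D' = contract D e)"

text \<open>The number of contractions may be zero.\<close>

fun reduction :: "'l state \<Rightarrow> 'l state \<Rightarrow> bool" where
  "reduction (D', \<chi>', g') (D, \<chi>, g) \<longleftrightarrow>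
     g' \<le> g \<and> contraction\<^sup>*\<^sup>* D D' \<and> (\<forall>e \<in> arcs D'. \<chi>' e = \<chi> e)"

fun equivalent :: "'l state \<Rightarrow> 'l state \<Rightarrow> bool" where
  "equivalent (D, \<chi>, g) (D', \<chi>', g') \<longleftrightarrow>
     g = g' \<and>
     (\<exists>h \<pi>. pre_digraph.digraph_isomorphism D h \<and> D' = app_iso h D \<and>
        bij_betw \<pi> (\<chi> ` arcs D) (\<chi>' ` arcs D') \<and>
        (\<forall>e \<in> arcs D. \<chi>' (iso_arcs h e) = \<pi> (\<chi> e)))"

text \<open>A history is the list of all game states so far, the current one being the last.\<close>

definition restricted_cutter_move ::
  "'l state list \<Rightarrow> choice \<Rightarrow> choice \<Rightarrow> 'l state \<Rightarrow> bool" where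
  "restricted_cutter_move H v w \<gamma>' \<longleftrightarrow>
     (case last H of (D, \<chi>, g) \<Rightarrow>
        (\<exists>x y. placed D v w x y \<and>
           cutter_move (\<Union>\<gamma>\<in>set H. labels \<gamma>) (D, \<chi>, g) x y (other_components D x y) g \<gamma>')) \<and>
     \<not> (\<exists>\<gamma> \<in> set H. \<exists>\<rho>. reduction \<rho> \<gamma> \<and> equivalent \<gamma>' \<rho>)"

type_synonym 'l strategy = "'l state list \<Rightarrow> choice \<times> choice"

definition marker_strategy :: "'l strategy \<Rightarrow> bool" where
  "marker_strategy \<sigma> \<longleftrightarrow>
     (\<forall>H. H \<noteq> [] \<and> (\<forall>\<gamma>\<in>set H. game_state \<gamma>) \<longrightarrow>
        legal_choice (fst (last H)) (fst (\<sigma> H)) \<and> legal_choice (fst (last H)) (snd (\<sigma> H)))"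

text \<open>The histories that can arise when Marker follows \<open>\<sigma>\<close>; the game ends at a history
  that has no extension.\<close>

inductive play :: "'l strategy \<Rightarrow> nat \<Rightarrow> 'l state list \<Rightarrow> bool"
  for \<sigma> :: "'l strategy" and g0 :: nat where
  start: "play \<sigma> g0 [initial_state g0]"
| step: "\<lbrakk>play \<sigma> g0 H; restricted_cutter_move H (fst (\<sigma> H)) (snd (\<sigma> H)) \<gamma>'\<rbrakk>
         \<Longrightarrow> play \<sigma> g0 (H @ [\<gamma>'])"

end

theory Submission
  imports Defs "HOL-Library.Multiset" "HOL-Combinatorics.Transposition"
begin

text \<open>
A state is recorded as the multiset of the cyclic label words of its components. Every legal Cutter
move raises the value by exactly one, because dropping a part that contains all occurrences of some
label yields a reduction of the current state up to renaming the new label. If \<open>N\<close> moves other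
than (a) and \<open>A\<close> moves (a) have been made, then the value is \<open>N + A\<close> with \<open>A \<le> g\<^sub>0\<close>, so it suffices that
Marker keeps the potential \<open>E = 3 N - A\<close> at most \<open>10\<close>.

When both sides of a cut contain all occurrences of some label, Cutter is forced to play (a), which
lowers \<open>E\<close> by one. After a drop, the labels with one occurrence left are credits: cutting such a
label \<open>y\<close> off its cycle is forced and, up to renaming, only adds a cycle with word \<open>[m, y]\<close>. Marker
spends credits to return to a state with \<open>E \<le> 5\<close> of one of two shapes: two cycles that share a
label and each have an internal label, or a chain of 4-gons whose remaining labels lead to cycles with an
internal label.
\<close>

section \<open>The game on cyclic words\<close>

text \<open>A round of Marker's strategy leads from a base state to a base state: a join raises the
  potential by \<open>3\<close>, three cuts follow, and if Cutter answers all of them with (a) the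
  round is neutral. The obstacle is a cut with a side that contains no label completely. Cutter may
  drop that side, which costs \<open>3\<close>, and the labels that lose an occurrence must supply
  the credits. A credit can be spent only on a cycle with an anchor that is not itself a credit, so
  the base states keep the labels that may be lost in contact with such cycles.

  One label per 4-gon escapes this: when Cutter keeps both halves of a hexagon, the label linking
  the two new 4-gons need not lie in any cycle with an anchor. Repetition produces chains of
  unbounded length, and these are consumed by induction, one 4-gon at a time.

  The constants \<open>5\<close> and \<open>10\<close> belong together: a join, a forced cut and a
  drop lead from \<open>E\<close> to \<open>E + 3 - 1 + 3 = E + 5\<close>, and five credits then
  lead back to \<open>E\<close>.\<close>

definition tot :: "nat list multiset \<Rightarrow> nat \<Rightarrow> nat" where
  "tot W a = (\<Sum>w\<in>#W. count_list w a)"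

definition labs :: "nat list multiset \<Rightarrow> nat set" where
  "labs W = (\<Union>w\<in>set_mset W. set w)"

definition anchor :: "nat list multiset \<Rightarrow> nat list \<Rightarrow> nat \<Rightarrow> bool" where
  "anchor W B a \<longleftrightarrow> a \<in> set B \<and> count_list B a = tot W a"

definition active :: "nat list multiset \<Rightarrow> nat list \<Rightarrow> bool" where
  "active W B \<longleftrightarrow> (\<exists>a. anchor W B a)"

definition proper :: "nat list multiset \<Rightarrow> bool" where
  "proper W \<longleftrightarrow> (\<forall>a. tot W a \<le> 2)"

text \<open>For a label of the part of \<open>W\<close> outside \<open>R\<close>, being hot means
  being a prospective credit. If its occurrence there is dropped from a proper state, the occurrence
  in \<open>w\<close> is the only one left, and the anchor of \<open>w\<close> makes cutting it off
  a forced move.\<close>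

definition hot :: "nat list multiset \<Rightarrow> nat list multiset \<Rightarrow> nat \<Rightarrow> bool" where
  "hot W R y \<longleftrightarrow> (\<exists>w\<in>#R. y \<in> set w \<and> active W w)"

text \<open>A chain of 4-gons in which the last label of each is the first label of the next, ending
  in a label with property \<open>h\<close>. The two inner labels of every link have this property
  as well. When a link is lost, the first label of the next one is left with a single occurrence,
  which drives the induction along the chain.\<close>

fun warm :: "(nat \<Rightarrow> bool) \<Rightarrow> nat list list \<Rightarrow> nat \<Rightarrow> bool" where
  "warm h [] c \<longleftrightarrow> h c"
| "warm h (q # qs) c \<longleftrightarrow> (\<exists>a b d. q = [c, a, b, d] \<and> h a \<and> h b \<and> warm h qs d)"

text \<open>Rotation puts the shared label \<open>x\<close> at the two ends that a join places on
  either side of the new label.\<close>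

definition pair_state :: "nat list multiset \<Rightarrow> bool" where
  "pair_state W \<longleftrightarrow> (\<exists>\<alpha> x \<beta> M. W = add_mset (\<alpha> @ [x]) (add_mset (x # \<beta>) M) \<and>
     active W \<alpha> \<and> active W \<beta>)"

text \<open>The next join takes place at \<open>p\<close>, which is hot through
  \<open>p # \<alpha>\<close>. In the distinguished 4-gon only \<open>z\<close> may have to be
  traced along \<open>qs\<close> before a hot label is reached.\<close>

definition chain_state :: "nat list multiset \<Rightarrow> bool" where
  "chain_state W \<longleftrightarrow> (\<exists>z s s' p \<alpha> qs R R'.
     W = add_mset [z, s, s', p] (mset qs + R) \<and> R = add_mset (p # \<alpha>) R' \<and> active W \<alpha> \<and>
     hot W R s \<and> hot W R s' \<and> warm (hot W R) qs z)"

definition base_state :: "nat list multiset \<Rightarrow> int \<Rightarrow> bool" where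
  "base_state W E \<longleftrightarrow> proper W \<and> E \<le> 5 \<and> (pair_state W \<or> chain_state W)"

text \<open>
The last two premises of \<open>split_move\<close> are the drops of \<open>B\<close> and of \<open>A\<close>, which restricted Cutter cannot
make when the dropped part contains all occurrences of one of its labels.
\<close>

inductive one_move :: "(nat list multiset \<Rightarrow> int \<Rightarrow> bool) \<Rightarrow> nat list multiset \<Rightarrow> int \<Rightarrow> bool"
  for S where
  split_move: "one_move S (add_mset (A @ B) M) E"
    if "E \<le> 10" "A \<noteq> []" "B \<noteq> []" "l \<notin> labs (add_mset (A @ B) M)"
      "S (add_mset (A @ [l]) (add_mset (B @ [l]) M)) (E - 1)"
      "active (add_mset (A @ B) M) B \<or> S (add_mset (A @ [l]) M) (E + 3)"
      "active (add_mset (A @ B) M) A \<or> S (add_mset (B @ [l]) M) (E + 3)"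
| join_move: "one_move S (add_mset u (add_mset v M)) E"
    if "E \<le> 10" "l \<notin> labs (add_mset u (add_mset v M))"
      "S (add_mset (u @ [l] @ v @ [l]) M) (E + 3)"
| join_dummy_move: "one_move S (add_mset u M) E"
    if "E \<le> 10" "l \<notin> labs (add_mset u M)" "S (add_mset (u @ [l, l]) M) (E + 3)"
| dummies_move: "one_move S W E"
    if "E \<le> 10" "l \<notin> labs W" "S (add_mset [l, l] W) (E + 3)"

lemma one_move_mono [mono]:
  assumes "S \<le> S'"
  shows "one_move S \<le> one_move S'"
proof (intro le_funI le_boolI)
  fix W E
  have S: "S W E \<Longrightarrow> S' W E" for W E using assms by (auto simp: le_fun_def)
  assume "one_move S W E"
  then show "one_move S' W E"
  proof cases
    case (split_move A B l M)
    then show ?thesis using S one_move.split_move[of E A B l M S'] by blast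
  next
    case (join_move l u v M)
    then show ?thesis using S one_move.join_move[of E l u v M S'] by blast
  next
    case (join_dummy_move l u M)
    then show ?thesis using S one_move.join_dummy_move[of E l u M S'] by blast
  next
    case (dummies_move l)
    then show ?thesis using S one_move.dummies_move[of E l W S'] by blast
  qed
qed

text \<open>A derivation is a finite game tree whose leaves are base states. Play need not stop at a
  leaf: \<open>base_move\<close> shows that each leaf has a move back into \<open>safe\<close>.
  Rotation and renaming are rules because a list of numbers only presents a cyclic word, and the
  names of its labels are arbitrary.\<close>

inductive safe :: "nat list multiset \<Rightarrow> int \<Rightarrow> bool" where
  safe_base: "base_state W E \<Longrightarrow> safe W E"
| safe_rot: "safe (add_mset (v @ u) M) E \<Longrightarrow> safe (add_mset (u @ v) M) E"
| safe_relabel: "safe W E \<Longrightarrow> inj_on \<pi> (labs W) \<Longrightarrow> safe (image_mset (map \<pi>) W) E"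
| safe_move: "one_move safe W E \<Longrightarrow> safe W E"

text \<open>The library's rule duplicates the recursive call, so that goals about explicit words blow up.\<close>

lemma count_list_Cons: "count_list (x # xs) y = of_bool (x = y) + count_list xs y"
  by simp

declare count_list.simps(2) [simp del] count_list_Cons [simp]

section \<open>Counting occurrences of labels\<close>

lemma tot_simps [simp]:
  "tot {#} a = 0" "tot (add_mset w M) a = count_list w a + tot M a"
  "tot (M + N) a = tot M a + tot N a"
  by (auto simp: tot_def)

lemma labs_simps [simp]:
  "labs {#} = {}" "labs (add_mset w M) = set w \<union> labs M" "labs (M + N) = labs M \<union> labs N"
  by (auto simp: labs_def)

lemma tot_eq_0_iff: "tot W a = 0 \<longleftrightarrow> a \<notin> labs W"
  by (induction W) (auto simp: count_list_0_iff)

lemma tot_notin [simp]: "a \<notin> labs W \<Longrightarrow> tot W a = 0"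
  by (simp add: tot_eq_0_iff)

lemma count_le_tot: "w \<in># M \<Longrightarrow> count_list w a \<le> tot M a"
  by (metis le_add1 multi_member_split tot_simps(2))

lemma in_labs: "w \<in># M \<Longrightarrow> a \<in> set w \<Longrightarrow> a \<in> labs M"
  by (auto simp: labs_def)

lemma finite_labs [simp]: "finite (labs W)"
  by (auto simp: labs_def)

lemma fresh: obtains l where "l \<notin> labs W"
  using ex_new_if_finite[OF infinite_UNIV_nat finite_labs] by blast

lemma count_list_pos: "a \<in> set w \<Longrightarrow> 1 \<le> count_list w a"
  by (metis One_nat_def Suc_leI count_list_0_iff neq0_conv)

lemma tot_pos: "a \<in> labs W \<Longrightarrow> 1 \<le> tot W a"
  using tot_eq_0_iff[of W a] by (cases "tot W a") auto

text \<open>All occurrences of the anchor lie in one word of \<open>R\<close>, so none is left for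
  \<open>X\<close>. Hence \<open>X\<close> may be exchanged for any \<open>X'\<close> that contains
  no label of \<open>R\<close> beyond those already in \<open>X\<close>. Most changes of state below
  are viewed as such an exchange, with \<open>R\<close> untouched.\<close>

lemma anchor_replace:
  assumes "w \<in># R" "anchor (X + R) w e"
  shows "e \<notin> labs X" "labs X' \<inter> labs R \<subseteq> labs X \<Longrightarrow> anchor (X' + R) w e"
proof -
  have "tot X e = 0" using assms count_le_tot[of w R e] by (auto simp: anchor_def)
  then show 1: "e \<notin> labs X" by (simp add: tot_eq_0_iff)
  assume "labs X' \<inter> labs R \<subseteq> labs X"
  then have "e \<notin> labs X'" using 1 assms in_labs[of w R e] by (auto simp: anchor_def)
  then show "anchor (X' + R) w e" using 1 assms by (auto simp: anchor_def)
qed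

lemma hot_replace:
  assumes "hot (X + R) R y" "labs X' \<inter> labs R \<subseteq> labs X" "W' = X' + R" "R \<subseteq># R'"
  shows "hot W' R' y"
  using assms unfolding hot_def active_def by (metis anchor_replace(2) mset_subset_eqD)

lemma warm_mono: "warm h qs c \<Longrightarrow> (\<And>y. h y \<Longrightarrow> h' y) \<Longrightarrow> warm h' qs c"
  by (induction qs arbitrary: c) auto

text \<open>A pair state up to rotation, confined to a part \<open>R\<close> of the state so that it
  survives changes outside \<open>R\<close>.\<close>

definition pair_in :: "nat list multiset \<Rightarrow> nat list multiset \<Rightarrow> bool" where
  "pair_in W R \<longleftrightarrow> (\<exists>u v y. {#u, v#} \<subseteq># R \<and> y \<in> set u \<and> y \<in> set v \<and> active W u \<and> active W v)"

lemma pair_in_replace: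
  assumes "pair_in (X + R) R" "labs X' \<inter> labs R \<subseteq> labs X" "W' = X' + R" "R \<subseteq># R'"
  shows "pair_in W' R'"
proof -
  obtain u v y where *: "{#u, v#} \<subseteq># R" "y \<in> set u" "y \<in> set v" "active (X + R) u" "active (X + R) v"
    using assms(1) unfolding pair_in_def by blast
  then have "u \<in># R" "v \<in># R" by (auto dest: mset_subset_eqD)
  then have "active W' u" "active W' v"
    using * assms(2,3) unfolding active_def by (metis anchor_replace(2))+
  then show ?thesis unfolding pair_in_def using * assms(4) subset_mset.order_trans by blast
qed

lemma properD: "proper W \<Longrightarrow> tot W a \<le> 2"
  by (simp add: proper_def)

lemma proper_fresh: "proper W \<Longrightarrow> (\<And>a. a \<noteq> r \<Longrightarrow> tot W' a \<le> tot W a) \<Longrightarrow> tot W' r \<le> 2 \<Longrightarrow> proper W'"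
  unfolding proper_def by (metis le_trans)

lemma safe_rotate: "safe (add_mset w' M) E \<Longrightarrow> w = u @ v \<Longrightarrow> w' = v @ u \<Longrightarrow> safe (add_mset w M) E"
  using safe_rot by blast

lemma anchor_other:
  assumes "anchor (add_mset u (add_mset v M)) u a" "y \<in> set v"
  shows "a \<noteq> y" "anchor (add_mset u (add_mset v M)) v b \<Longrightarrow> y \<in> set u \<Longrightarrow> b \<noteq> y"
  using assms count_list_pos[of y v] count_list_pos[of y u] by (auto simp: anchor_def)

text \<open>The label \<open>y\<close> occurs in both words and is therefore an anchor of neither.
  Rotating it to the border leaves the anchors inside the remainders.\<close>

lemma safe_pair:
  assumes "proper W" "E \<le> 5" "pair_in W R" "R \<subseteq># W"
  shows "safe W E"
proof -
  obtain u v y where *: "{#u, v#} \<subseteq># R" "y \<in> set u" "y \<in> set v" "active W u" "active W v"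
    using assms(3) unfolding pair_in_def by blast
  then obtain M where W: "W = add_mset u (add_mset v M)"
    using assms(4) by (metis add_mset_add_single mset_subset_eq_exists_conv subset_mset.order_trans
        union_mset_add_mset_left add_mset_commute empty_neutral(1))
  obtain a b where ab: "anchor W u a" "anchor W v b" using * by (auto simp: active_def)
  obtain u1 u2 where u: "u = u1 @ y # u2" using *(2) by (meson split_list)
  obtain v1 v2 where v: "v = v1 @ y # v2" using *(3) by (meson split_list)
  have ne: "a \<noteq> y" "b \<noteq> y" using ab *(2,3) W anchor_other by metis+
  define W' where "W' = add_mset (u2 @ u1 @ [y]) (add_mset (y # v2 @ v1) M)"
  have t: "tot W' = tot W" by (auto simp: W'_def W u v fun_eq_iff)
  have "anchor W' (u2 @ u1) a" "anchor W' (v2 @ v1) b"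
    using ab ne unfolding anchor_def t by (auto simp: u v)
  then have "active W' (u2 @ u1)" "active W' (v2 @ v1)" unfolding active_def by blast+
  then have "pair_state W'" unfolding pair_state_def W'_def
    by (metis append.assoc)
  then have "base_state W' E" using assms by (auto simp: base_state_def proper_def t)
  then have "safe W' E" by (rule safe_base)
  then have "safe (add_mset u (add_mset (y # v2 @ v1) M)) E"
    unfolding W'_def by (rule safe_rotate[where u = "u1 @ [y]" and v = u2]) (auto simp: u)
  then have "safe (add_mset (y # v2 @ v1) (add_mset u M)) E" by (simp add: add_mset_commute)
  then have "safe (add_mset v (add_mset u M)) E"
    by (rule safe_rotate[where u = "v1" and v = "y # v2"]) (auto simp: v)
  then show ?thesis by (simp add: W add_mset_commute)
qed

text \<open>The active cycle through \<open>p\<close> is rotated so that \<open>p\<close> comes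
  first. Its anchor is not \<open>p\<close>, which also lies in the 4-gon, so the rest of the cycle
  stays active.\<close>

lemma safe_chain:
  assumes W: "W = add_mset [z, s, s', p] (mset qs + R)" and "proper W" "E \<le> 5"
    and "hot W R s" "hot W R s'" "hot W R p" "warm (hot W R) qs z"
  shows "safe W E"
proof -
  obtain w a where w: "w \<in># R" "p \<in> set w" "anchor W w a"
    using \<open>hot W R p\<close> by (auto simp: hot_def active_def)
  obtain R' where R: "R = add_mset w R'" using w by (meson multi_member_split)
  obtain u v where uv: "w = u @ p # v" using w by (meson split_list)
  have ap: "a \<noteq> p" using anchor_replace(1)[of w R "add_mset [z, s, s', p] (mset qs)" a] w W by auto
  let ?A = "p # v @ u"
  let ?R = "add_mset ?A R'"
  let ?W = "add_mset [z, s, s', p] (mset qs + ?R)"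
  have t: "tot ?W = tot W" by (auto simp: W R uv fun_eq_iff)
  have an: "anchor ?W x = anchor W x" for x by (intro ext) (simp only: anchor_def t)
  have ac: "active ?W = active W" by (intro ext) (simp only: active_def an)
  have hot: "hot ?W ?R y" if "hot W R y" for y
  proof -
    obtain x b where x: "x \<in># R" "y \<in> set x" "anchor W x b" using \<open>hot W R y\<close> by (auto simp: hot_def active_def)
    show ?thesis
    proof (cases "x = w")
      case True
      then have "anchor W ?A b" "y \<in> set ?A" using x by (auto simp: anchor_def uv)
      then have "anchor ?W ?A b" "y \<in> set ?A" by (simp_all only: an)
      then show ?thesis unfolding hot_def active_def by auto
    next
      case False
      then show ?thesis using x unfolding hot_def active_def an by (intro bexI[of _ x]) (auto simp: R)
    qed
  qed
  have "anchor W (v @ u) a" using w ap by (auto simp: anchor_def uv)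
  then have "active ?W (v @ u)" unfolding ac active_def by blast
  moreover have "warm (hot ?W ?R) qs z" using assms(7) hot by (rule warm_mono)
  ultimately have "chain_state ?W" unfolding chain_state_def using assms hot by blast
  moreover have "proper ?W" using \<open>proper W\<close> unfolding proper_def t .
  ultimately have "base_state ?W E" using \<open>E \<le> 5\<close> unfolding base_state_def by blast
  then have "safe ?W E" by (rule safe_base)
  then have "safe (add_mset ?A (add_mset [z, s, s', p] (mset qs + R'))) E" by (simp add: add_mset_commute)
  then have "safe (add_mset w (add_mset [z, s, s', p] (mset qs + R'))) E"
    by (rule safe_rotate[where u = u and v = "p # v"]) (auto simp: uv)
  then show ?thesis by (simp add: W R add_mset_commute)
qed

section \<open>Forced cuts and the spending of credits\<close>

lemma safe_split:
  assumes "E \<le> 10" "A \<noteq> []" "B \<noteq> []" "l \<notin> labs (add_mset (A @ B) M)"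
    "safe (add_mset (A @ [l]) (add_mset (B @ [l]) M)) (E - 1)"
    "active (add_mset (A @ B) M) B \<or> safe (add_mset (A @ [l]) M) (E + 3)"
    "active (add_mset (A @ B) M) A \<or> safe (add_mset (B @ [l]) M) (E + 3)"
  shows "safe (add_mset (A @ B) M) E"
  by (rule safe_move, rule split_move) (use assms in auto)

lemma active_nonempty: "active W B \<Longrightarrow> B \<noteq> []"
  by (auto simp: active_def anchor_def)

lemma safe_forced:
  assumes "E \<le> 10" "active (add_mset (A @ B) M) A" "active (add_mset (A @ B) M) B"
    "l \<notin> labs (add_mset (A @ B) M)"
    "safe (add_mset (A @ [l]) (add_mset (B @ [l]) M)) (E - 1)"
  shows "safe (add_mset (A @ B) M) E"
  by (rule safe_split) (use assms active_nonempty in auto)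

lemma image_swap_id:
  assumes "x \<notin> labs M" "y \<notin> labs M"
  shows "image_mset (map (transpose x y)) M = M"
proof -
  have "map (transpose x y) w = w" if "w \<in># M" for w
    using that assms by (intro map_idI) (metis in_labs transpose_apply_other)
  then have "image_mset (map (transpose x y)) M = image_mset id M"
    by (intro image_mset_cong) auto
  then show ?thesis by simp
qed

lemma map_swap_id: "x \<notin> set w \<Longrightarrow> y \<notin> set w \<Longrightarrow> map (transpose x y) w = w"
  by (intro map_idI) (metis transpose_apply_other)

text \<open>A transposition is its own inverse, so the renaming rule can be applied backwards. After
  a cut this gives a cycle its former word back: the label of the cut and an old label exchange
  their names.\<close>

lemma safe_swap:
  assumes "safe (image_mset (map (transpose x y)) W) E"
  shows "safe W E"
proof -
  have "image_mset (map (transpose x y)) (image_mset (map (transpose x y)) W) = W"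
    by (simp add: multiset.map_comp comp_def)
  moreover have "inj_on (transpose x y) A" for A by (meson inj_on_subset inj_transpose subset_UNIV)
  ultimately show ?thesis using safe_relabel[OF assms] by metis
qed

text \<open>The cut separates \<open>y\<close> from the rest of \<open>w\<close>. One side is active
  through \<open>y\<close>, which has no other occurrence, the other through \<open>a\<close>, so
  (a) is forced. Of the results \<open>[y, m]\<close> and the rest followed by \<open>m\<close>, the
  second becomes a rotation of \<open>w\<close> once \<open>y\<close> and \<open>m\<close> exchange
  names. The state has only gained a cycle.\<close>

lemma safe_resolve:
  assumes W: "W = add_mset w M" and "y \<in> set w" "tot W y = 1" "anchor W w a" "a \<noteq> y"
    "m \<notin> labs W" "E \<le> 10" "safe (add_mset [m, y] W) (E - 1)"
  shows "safe W E"
proof -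
  obtain u v where w: "w = u @ y # v" using assms by (meson split_list)
  have y: "y \<notin> set u" "y \<notin> set v" "y \<notin> labs M"
    using assms(3) by (auto simp: W w tot_eq_0_iff count_list_0_iff)
  have m: "m \<notin> set u" "m \<notin> set v" "m \<notin> labs M" "m \<noteq> y" using assms(6) by (auto simp: W w)
  let ?W = "add_mset ([y] @ (v @ u)) M"
  have "safe ?W E"
  proof (rule safe_forced[OF \<open>E \<le> 10\<close>])
    have t: "tot ?W = tot W" by (auto simp: W w fun_eq_iff)
    show "active ?W [y]" unfolding active_def anchor_def t using assms(3) by auto
    show "active ?W (v @ u)" unfolding active_def anchor_def t
      using assms(4,5) by (intro exI[of _ a]) (auto simp: anchor_def w)
    show "m \<notin> labs ?W" using m by auto
    have "safe (add_mset (u @ y # v) (add_mset [m, y] M)) (E - 1)"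
      using assms(8) by (simp add: W w add_mset_commute)
    then have "safe (add_mset ((v @ u) @ [y]) (add_mset [m, y] M)) (E - 1)"
      by (rule safe_rotate[where u = "v" and v = "u @ [y]"]) auto
    then have "safe (image_mset (map (transpose y m)) (add_mset ([y] @ [m]) (add_mset ((v @ u) @ [m]) M))) (E - 1)"
      using y m by (simp add: image_swap_id map_swap_id add_mset_commute)
    then show "safe (add_mset ([y] @ [m]) (add_mset ((v @ u) @ [m]) M)) (E - 1)"
      by (rule safe_swap)
  qed
  then show ?thesis unfolding W by (rule safe_rotate[where u = u and v = "y # v"]) (auto simp: w)
qed

text \<open>The multiset \<open>L\<close> collects the cycles \<open>[m, y]\<close> that are split off when the credits are spent.\<close>

lemma safe_credits:
  assumes "finite Y" "proper W" "E \<le> 10"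
    and "\<And>y. y \<in> Y \<Longrightarrow> tot W y = 1 \<and> (\<exists>w\<in>#W. y \<in> set w \<and> (\<exists>a. a \<notin> Y \<and> anchor W w a))"
    and "\<And>L. proper (W + L) \<Longrightarrow> labs L \<inter> labs W \<subseteq> Y \<Longrightarrow>
           (\<And>y. y \<in> Y \<Longrightarrow> \<exists>m. m \<noteq> y \<and> [m, y] \<in># L \<and> tot (W + L) m = 1) \<Longrightarrow> safe (W + L) (E - int (card Y))"
  shows "safe W E"
  using assms
proof (induction Y arbitrary: W E rule: finite_induct)
  case empty
  then show ?case using empty(4)[of "{#}"] by simp
next
  case (insert y Y)
  obtain w a where w: "w \<in># W" "y \<in> set w" "a \<notin> insert y Y" "anchor W w a" and y1: "tot W y = 1"
    using insert.prems(3)[of y] by blast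
  obtain M where M: "W = add_mset w M" using w by (meson multi_member_split)
  obtain m where m: "m \<notin> labs W" by (rule fresh)
  have Ylab: "insert y Y \<subseteq> labs W"
    using insert.prems(3) by (metis One_nat_def tot_notin subsetI zero_neq_one)
  let ?W = "add_mset [m, y] W"
  have "safe ?W (E - 1)"
  proof (rule insert.IH)
    show "proper ?W" using insert.prems(1) y1 m by (auto simp: proper_def)
    show "E - 1 \<le> 10" using insert.prems by simp
  next
    fix y' assume y': "y' \<in> Y"
    then obtain w' a' where w': "tot W y' = 1" "w' \<in># W" "y' \<in> set w'" "a' \<notin> insert y Y" "anchor W w' a'"
      using insert.prems(3)[of y'] by blast
    have "y' \<noteq> y" "y' \<noteq> m" using y' insert.hyps Ylab m by auto
    \<comment> \<open>The new cycle \<open>[m, y]\<close> would destroy the anchor property of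
      \<open>y\<close> only, and \<open>m\<close> is fresh. Demanding anchors outside the whole
      credit set thus keeps the later credits spendable.\<close>
    moreover have "a' \<noteq> y" "a' \<noteq> m" using w' m in_labs[of w' W a'] by (auto simp: anchor_def)
    ultimately show "tot ?W y' = 1 \<and> (\<exists>w\<in>#?W. y' \<in> set w \<and> (\<exists>a. a \<notin> Y \<and> anchor ?W w a))"
      using w' by (auto simp: anchor_def intro!: bexI[of _ w'] exI[of _ a'])
  next
    fix L assume L: "proper (?W + L)" "labs L \<inter> labs ?W \<subseteq> Y"
      "\<And>y. y \<in> Y \<Longrightarrow> \<exists>m. m \<noteq> y \<and> [m, y] \<in># L \<and> tot (?W + L) m = 1"
    have m': "m \<notin> labs L" using L(2) Ylab m by auto
    have y': "y \<notin> labs L" using L(2) insert.hyps by auto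
    let ?L = "add_mset [m, y] L"
    have "safe (W + ?L) (E - int (card (insert y Y)))"
    proof (rule insert.prems(4))
      show "proper (W + ?L)" using L(1) by simp
      show "labs ?L \<inter> labs W \<subseteq> insert y Y" using L(2) m by auto
      fix y' assume "y' \<in> insert y Y"
      then show "\<exists>m. m \<noteq> y' \<and> [m, y'] \<in># ?L \<and> tot (W + ?L) m = 1"
      proof
        assume "y' = y"
        moreover have "y \<noteq> m" using m Ylab by auto
        ultimately show ?thesis using m m' by (intro exI[of _ m]) auto
      next
        assume "y' \<in> Y"
        then obtain m2 where "m2 \<noteq> y'" "[m2, y'] \<in># L" "tot (?W + L) m2 = 1" using L(3) by blast
        then show ?thesis by (intro exI[of _ m2]) auto
      qed
    qed
    then show "safe (?W + L) (E - 1 - int (card Y))" using insert.hyps by (simp add: algebra_simps)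
  qed
  then show ?case using safe_resolve[OF M w(2) y1 w(4)] w(3) m insert.prems(2) by blast
qed

text \<open>Properness allows \<open>y\<close> one occurrence in \<open>X\<close> and one in its hot
  word, so only the latter is left when \<open>X'\<close> avoids \<open>y\<close>. The anchor of
  that word is a label of \<open>R\<close> outside \<open>X\<close>, and the condition on
  \<open>Y\<close> prevents it from being a credit.\<close>

lemma hot_credit:
  assumes "proper (X + R)" "hot (X + R) R y" "y \<in> labs X" "y \<notin> labs X'"
    "labs X' \<inter> labs R \<subseteq> labs X" "Y \<inter> labs R \<subseteq> labs X" "W' = X' + R"
  shows "tot W' y = 1 \<and> (\<exists>w\<in>#W'. y \<in> set w \<and> (\<exists>a. a \<notin> Y \<and> anchor W' w a))"
proof -
  obtain w e where w: "w \<in># R" "y \<in> set w" "anchor (X + R) w e"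
    using assms(2) by (auto simp: hot_def active_def)
  have "e \<notin> labs X" using w anchor_replace(1) by blast
  moreover have "e \<in> labs R" using w in_labs by (auto simp: anchor_def)
  ultimately have "e \<notin> Y" using assms(6) by auto
  moreover have "anchor W' w e" using w assms(5,7) anchor_replace(2) by blast
  moreover have "w \<in># W'" using w assms by simp
  moreover have "1 \<le> tot X y" "1 \<le> tot R y" using assms(3) w in_labs tot_pos by blast+
  then have "tot W' y = 1" using assms(1,4) properD[of "X + R" y] by (simp add: assms(7))
  ultimately show ?thesis using w by blast
qed

lemma hot_count:
  assumes "proper (X + R)" "hot (X + R) R y" "y \<in> labs X"
  shows "tot X y = 1"
proof -
  have "y \<in> labs R" using assms(2) in_labs by (auto simp: hot_def)
  then show ?thesis using assms(1,3) tot_pos[of y X] tot_pos[of y R] properD[of "X + R" y] by simp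
qed

text \<open>The second occurrence of \<open>y\<close> is taken up by \<open>R\<close>. This makes
  the labels of the polygons below distinct, on which the sizes of the credit sets depend.\<close>

lemma hot_unique:
  assumes "proper (X + R)" "hot (X + R) R y" "X = add_mset (u @ y # v) M"
  shows "y \<notin> set u" "y \<notin> set v" "y \<notin> labs M"
proof -
  have "tot X y = 1" using hot_count[OF assms(1,2)] assms(3) by simp
  then show "y \<notin> set u" "y \<notin> set v" "y \<notin> labs M"
    by (auto simp: assms(3) count_list_0_iff tot_eq_0_iff)
qed

text \<open>A side benefit of spending a hot credit: \<open>[m, y]\<close> is active through
  \<open>m\<close> and shares \<open>y\<close> with the active cycle that makes \<open>y\<close>
  hot.\<close>

lemma pair_in_leaf:
  assumes "hot W R y" "m \<noteq> y" "[m, y] \<in># L" "tot W m = 1"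
  shows "pair_in W (R + L)"
proof -
  obtain w where w: "w \<in># R" "y \<in> set w" "active W w" using assms(1) by (auto simp: hot_def)
  have "anchor W [m, y] m" using assms by (simp add: anchor_def)
  then have "active W [m, y]" by (auto simp: active_def)
  moreover have "{#w, [m, y]#} \<subseteq># R + L"
    using mset_subset_eq_mono_add[of "{#w#}" R "{#[m, y]#}" L] w assms(3) by (simp add: add_mset_commute)
  ultimately show ?thesis using w unfolding pair_in_def
    by (metis list.set_intros(1) list.set_intros(2))
qed

lemma hot_mono: "hot W R y \<Longrightarrow> R \<subseteq># R' \<Longrightarrow> hot W R' y"
  unfolding hot_def by (meson mset_subset_eqD)

lemma pair_in_mono: "pair_in W R \<Longrightarrow> R \<subseteq># R' \<Longrightarrow> pair_in W R'"
  unfolding pair_in_def by (meson subset_mset.order_trans)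

text \<open>The accounts after a drop that turns \<open>X\<close> into \<open>X'\<close>. The
  credits in \<open>Yh\<close> are hot labels lost with the dropped part, those in \<open>Yc\<close>
  sit in the surviving cycles \<open>X'\<close>, like the label of the cut itself. The last premise
  passes on what outlives the spending: hot labels stay hot, and a pair is available if there was
  one in \<open>R\<close> or if some hot credit has been spent.\<close>

lemma safe_drop:
  assumes "proper (X + R)" "proper (X' + R)" "E \<le> 10" "finite Yh" "finite Yc" "Yh \<inter> Yc = {}"
    and labs: "labs X' \<inter> labs R \<subseteq> labs X" "Yc \<inter> labs R \<subseteq> labs X"
    and Yh: "\<And>y. y \<in> Yh \<Longrightarrow> hot (X + R) R y \<and> y \<in> labs X \<and> y \<notin> labs X'"
    and Yc: "\<And>y. y \<in> Yc \<Longrightarrow> tot (X' + R) y = 1 \<and>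
           (\<exists>w\<in>#X'. y \<in> set w \<and> (\<exists>a. a \<notin> Yh \<union> Yc \<and> anchor (X' + R) w a))"
    and safe: "\<And>L. proper (X' + R + L) \<Longrightarrow> labs L \<inter> labs (X' + R) \<subseteq> Yh \<union> Yc \<Longrightarrow>
           (\<And>y. hot (X + R) R y \<Longrightarrow> hot (X' + R + L) (R + L) y) \<Longrightarrow>
           pair_in (X + R) R \<or> Yh \<noteq> {} \<longrightarrow> pair_in (X' + R + L) (R + L) \<Longrightarrow>
           safe (X' + R + L) (E - int (card Yh) - int (card Yc))"
  shows "safe (X' + R) E"
proof (rule safe_credits[of "Yh \<union> Yc"])
  have Y: "(Yh \<union> Yc) \<inter> labs R \<subseteq> labs X" using labs Yh by auto
  show "tot (X' + R) y = 1 \<and> (\<exists>w\<in>#X' + R. y \<in> set w \<and> (\<exists>a. a \<notin> Yh \<union> Yc \<and> anchor (X' + R) w a))"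
    if "y \<in> Yh \<union> Yc" for y
    using that hot_credit[OF assms(1) _ _ _ labs(1) Y refl, of y] Yh[of y] Yc[of y] by auto
  fix L assume L: "proper (X' + R + L)" "labs L \<inter> labs (X' + R) \<subseteq> Yh \<union> Yc"
    "\<And>y. y \<in> Yh \<union> Yc \<Longrightarrow> \<exists>m. m \<noteq> y \<and> [m, y] \<in># L \<and> tot (X' + R + L) m = 1"
  have XL: "labs (X' + L) \<inter> labs R \<subseteq> labs X" using labs L(2) Y by auto
  have W: "X' + R + L = X' + L + R" by simp
  have hot: "hot (X' + R + L) R y" if "hot (X + R) R y" for y
    using hot_replace[OF that XL W] by simp
  have pair: "pair_in (X' + R + L) (R + L)" if "pair_in (X + R) R \<or> Yh \<noteq> {}"
    using that
  proof
    assume "pair_in (X + R) R"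
    then show ?thesis using pair_in_replace[OF _ XL W, of "R + L"] by simp
  next
    assume "Yh \<noteq> {}"
    then obtain y where "y \<in> Yh" by auto
    then show ?thesis using L(3)[of y] hot Yh pair_in_leaf by blast
  qed
  have "safe (X' + R + L) (E - int (card Yh) - int (card Yc))"
    using L hot pair by (intro safe) (auto intro: hot_mono[OF _ mset_subset_eq_add_left])
  then show "safe (X' + R + L) (E - int (card (Yh \<union> Yc)))"
    using assms(4-6) by (simp add: card_Un_disjoint algebra_simps)
qed (use assms in auto)

section \<open>Marker's strategy on words\<close>

text \<open>The side \<open>[l]\<close> holds the only occurrence of \<open>l\<close>, so Cutter can
  only keep both sides or drop \<open>[a, b, c]\<close>. In the first case the potential is at most
  \<open>5\<close> and the pair in \<open>R\<close> is still there. In the second case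
  \<open>r\<close> is a credit in \<open>[l, r]\<close>, anchored by \<open>l\<close>, besides
  \<open>a\<close> and \<open>b\<close>. With an empty chain \<open>c\<close> is a fourth credit and
  the balance is \<open>3 - 4\<close>. Otherwise three credits restore \<open>E\<close>, and
  \<open>c\<close> plays the part of \<open>l\<close> in the next 4-gon.\<close>

lemma cascade:
  assumes "W = add_mset [l, a, b, c] (mset qs + R)" "tot W l = 1"
    "hot W R a" "hot W R b" "warm (hot W R) qs c" "pair_in W R" "proper W" "E \<le> 6"
  shows "safe W E"
  using assms
proof (induction "length qs" arbitrary: qs W R l a b c E rule: less_induct)
  case less
  have IH: "safe W' E'" if "qs = q # qs'" "W' = add_mset [l', a', b', c'] (mset qs' + R')" "tot W' l' = 1"
    "hot W' R' a'" "hot W' R' b'" "warm (hot W' R') qs' c'" "pair_in W' R'" "proper W'" "E' \<le> 6"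
    for q qs' l' a' b' c' R' W' E'
    by (rule less.hyps[OF _ that(2-9)]) (simp add: that(1))
  note W0 = less.prems(1) and l = less.prems(2) and hot = less.prems(3,4) and warm = less.prems(5)
    and pair = less.prems(6)
  obtain r where r: "r \<notin> labs W" by (rule fresh)
  define X where "X = add_mset [l, a, b, c] (mset qs)"
  define X' where "X' = add_mset [l, r] (mset qs)"
  have W: "W = X + R" by (simp add: X_def W0)
  let ?M = "mset qs"
  have "a \<notin> {l, b, c} \<and> a \<notin> labs ?M"
    using hot_unique[of X R a "[l]" "[b, c]" ?M] hot(1) less.prems(7) by (simp add: X_def W)
  moreover have "b \<notin> {l, a, c} \<and> b \<notin> labs ?M"
    using hot_unique[of X R b "[l, a]" "[c]" ?M] hot(2) less.prems(7) by (simp add: X_def W)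
  moreover have "l \<notin> {a, b, c} \<and> l \<notin> labs ?M \<and> l \<notin> labs R"
    using l by (auto simp: W0 tot_eq_0_iff)
  ultimately have neq: "a \<noteq> b" "a \<noteq> c" "b \<noteq> c" "l \<noteq> a" "l \<noteq> b" "l \<noteq> c" "a \<notin> labs (mset qs)" "b \<notin> labs (mset qs)"
    "l \<notin> labs R" "l \<notin> labs (mset qs)"
    by simp_all
  have r': "r \<notin> {l, a, b, c}" "r \<notin> labs R" "r \<notin> labs (mset qs)" using r by (auto simp: W0)
  have X': "labs X' \<inter> labs R \<subseteq> labs X" using r' by (auto simp: X'_def X_def)
  have pr: "proper (X' + R)"
    by (rule proper_fresh[OF less.prems(7), of r]) (use r' in \<open>auto simp: X'_def W X_def\<close>)
  have cred: "tot (X' + R) r = 1 \<and> (\<exists>w\<in>#X'. r \<in> set w \<and> (\<exists>e. e \<notin> Y \<union> {r} \<and> anchor (X' + R) w e))"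
    if "l \<notin> Y" for Y
    using r' l neq that by (intro conjI bexI[of _ "[l, r]"] exI[of _ l]) (auto simp: X'_def X_def W anchor_def)
  have "safe (add_mset ([l] @ [a, b, c]) (mset qs + R)) E"
  proof (rule safe_split[where l = r])
    show "r \<notin> labs (add_mset ([l] @ [a, b, c]) (mset qs + R))" using r by (simp add: W0)
    show "safe (add_mset ([l] @ [r]) (add_mset ([a, b, c] @ [r]) (mset qs + R))) (E - 1)" (is "safe ?W _")
    proof (rule safe_pair[of _ _ R])
      show "proper ?W"
        by (rule proper_fresh[OF less.prems(7), of r]) (use r' in \<open>auto simp: W0\<close>)
      show "pair_in ?W R" using pair
        by (rule pair_in_replace[of X R "add_mset ([l] @ [r]) (add_mset ([a, b, c] @ [r]) (mset qs))", folded W])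
          (use r in \<open>auto simp: X_def W\<close>)
    qed (use less.prems(8) in auto)
    have "safe (X' + R) (E + 3)"
    proof (cases qs)
      case Nil
      then have c: "hot W R c" using warm by simp
      then have "tot X c = 1" using hot_count[of X R c] less.prems(7) by (auto simp: W X_def)
      show ?thesis
      proof (rule safe_drop[of X R X' _ "{a, b, c}" "{r}"])
        fix L assume L: "proper (X' + R + L)"
          "pair_in (X + R) R \<or> {a, b, c} \<noteq> {} \<longrightarrow> pair_in (X' + R + L) (R + L)"
        show "safe (X' + R + L) (E + 3 - int (card {a, b, c}) - int (card {r}))"
          by (rule safe_pair[of _ _ "R + L"]) (use L neq less.prems(8) in auto)
      next
        fix y assume "y \<in> {a, b, c}"
        then show "hot (X + R) R y \<and> y \<in> labs X \<and> y \<notin> labs X'"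
          using hot c neq r' by (auto simp: W X_def X'_def Nil)
      qed (use less.prems(7) less.prems(8) pr X' r' neq cred[of "{a, b, c}"] in \<open>auto simp: W\<close>)
    next
      case (Cons q qs')
      obtain a' b' d where q: "q = [c, a', b', d]" and h: "hot W R a'" "hot W R b'" "warm (hot W R) qs' d"
        using warm Cons by auto
      \<comment> \<open>The two occurrences that properness allows \<open>c\<close> are one in the
        dropped side and one in the first link of the chain.\<close>
      have "1 \<le> count_list [l, a, b, c] c" "1 \<le> count_list q c" by (auto simp: q intro!: count_list_pos)
      then have c1: "tot (X' + R) c = 1" 
        using properD[OF less.prems(7), of c] r' neq by (auto simp: W0 Cons X'_def)
      show ?thesis
      proof (rule safe_drop[of X R X' _ "{a, b}" "{r}"])
        fix L assume L: "proper (X' + R + L)" "labs L \<inter> labs (X' + R) \<subseteq> {a, b} \<union> {r}"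
          "\<And>y. hot (X + R) R y \<Longrightarrow> hot (X' + R + L) (R + L) y"
          "pair_in (X + R) R \<or> {a, b} \<noteq> {} \<longrightarrow> pair_in (X' + R + L) (R + L)"
        \<comment> \<open>The remnant \<open>[l, r]\<close> is of no further use and is counted
          among the other cycles of the next stage.\<close>
        let ?R = "add_mset [l, r] (R + L)"
        have WL: "X' + R + L = add_mset [c, a', b', d] (mset qs' + ?R)" by (simp add: X'_def Cons q)
        have sub: "R + L \<subseteq># ?R" by simp
        have hot': "hot (X' + R + L) ?R y" if "hot W R y" for y
          using L(3)[of y] that hot_mono[OF _ sub] by (simp add: W)
        show "safe (X' + R + L) (E + 3 - int (card {a, b}) - int (card {r}))"
        proof (rule IH[OF Cons WL])
          have "c \<notin> labs L" using L(2) r' neq by (auto simp: X'_def Cons q)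
          then show "tot (X' + R + L) c = 1" using c1 by simp
          show "warm (hot (X' + R + L) ?R) qs' d" using h(3) hot' by (rule warm_mono)
          show "pair_in (X' + R + L) ?R" using L(4) pair_in_mono[OF _ sub] by auto
        qed (use h hot' L(1) less.prems(8) neq in auto)
      next
        fix y assume "y \<in> {a, b}"
        then show "hot (X + R) R y \<and> y \<in> labs X \<and> y \<notin> labs X'"
          using hot neq r' by (auto simp: W X_def X'_def)
      qed (use less.prems(7) less.prems(8) pr X' r' neq cred[of "{a, b}"] in \<open>auto simp: W\<close>)
    qed
    then show "active (add_mset ([l] @ [a, b, c]) (mset qs + R)) [a, b, c] \<or> safe (add_mset ([l] @ [r]) (mset qs + R)) (E + 3)"
      by (simp add: X'_def)
    show "active (add_mset ([l] @ [a, b, c]) (mset qs + R)) [l] \<or> safe (add_mset ([a, b, c] @ [r]) (mset qs + R)) (E + 3)"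
      using l by (auto simp: active_def anchor_def W0)
  qed (use less.prems(8) in auto)
  then show ?case by (simp add: W0)
qed

text \<open>The bound is one higher than in \<open>cascade\<close> because the first 4-gon earns one
  point whatever Cutter does: keeping gives \<open>-1\<close>, dropping gives \<open>3 - 4\<close>
  with the credits \<open>a\<close>, \<open>b\<close>, \<open>c\<close>, \<open>r\<close>. The
  second 4-gon, in which \<open>z\<close> has its only occurrence, is not touched and is left to
  \<open>cascade\<close>.\<close>

lemma cascade2:
  assumes "W = add_mset [l, a, b, c] (add_mset [z, a', b', d] (mset qs + R))" "tot W l = 1" "tot W z = 1"
    "hot W R a" "hot W R b" "hot W R c" "hot W R a'" "hot W R b'" "warm (hot W R) qs d"
    "pair_in W R" "proper W" "E \<le> 7"
  shows "safe W E"
proof -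
  note hot = assms(4-8) and W0 = assms(1)
  obtain r where r: "r \<notin> labs W" by (rule fresh)
  define X where "X = add_mset [l, a, b, c] (add_mset [z, a', b', d] (mset qs))"
  define X' where "X' = add_mset [l, r] (add_mset [z, a', b', d] (mset qs))"
  have W: "W = X + R" by (simp add: X_def W0)
  let ?M = "add_mset [z, a', b', d] (mset qs)"
  have "a \<notin> {l, b, c} \<and> a \<notin> labs ?M"
    using hot_unique[of X R a "[l]" "[b, c]" ?M] hot(1) \<open>proper W\<close> by (simp add: X_def W)
  moreover have "b \<notin> {l, a, c} \<and> b \<notin> labs ?M"
    using hot_unique[of X R b "[l, a]" "[c]" ?M] hot(2) \<open>proper W\<close> by (simp add: X_def W)
  moreover have "c \<notin> {l, a, b} \<and> c \<notin> labs ?M"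
    using hot_unique[of X R c "[l, a, b]" "[]" ?M] hot(3) \<open>proper W\<close> by (simp add: X_def W)
  moreover have "l \<notin> {a, b, c} \<and> l \<notin> labs ?M \<and> l \<notin> labs R"
    using assms(2) by (simp add: W0 tot_eq_0_iff)
  ultimately have neq: "a \<noteq> b" "a \<noteq> c" "b \<noteq> c" "l \<noteq> a" "l \<noteq> b" "l \<noteq> c" "a \<notin> labs (mset qs)" "b \<notin> labs (mset qs)"
    "c \<notin> labs (mset qs)" "l \<notin> labs R" "l \<notin> labs (mset qs)"
    "a \<notin> {z, a', b', d}" "b \<notin> {z, a', b', d}" "c \<notin> {z, a', b', d}" "l \<notin> {z, a', b', d}"
    by simp_all
  have r': "r \<notin> {l, a, b, c}" "r \<notin> labs R" "r \<notin> labs (mset qs)" "r \<notin> {z, a', b', d}"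
    using r by (auto simp: W0)
  have X': "labs X' \<inter> labs R \<subseteq> labs X" using r' by (auto simp: X'_def X_def)
  have pr: "proper (X' + R)"
    by (rule proper_fresh[OF \<open>proper W\<close>, of r]) (use r' in \<open>auto simp: X'_def W X_def\<close>)
  have cred: "tot (X' + R) r = 1 \<and> (\<exists>w\<in>#X'. r \<in> set w \<and> (\<exists>e. e \<notin> Y \<union> {r} \<and> anchor (X' + R) w e))"
    if "l \<notin> Y" for Y
    using r' assms(2) neq that by (intro conjI bexI[of _ "[l, r]"] exI[of _ l]) (auto simp: X'_def X_def W anchor_def)
  have z1: "tot (X' + R) z = 1" using assms(3) r' neq by (auto simp: X'_def X_def W)
  have "safe (add_mset ([l] @ [a, b, c]) (add_mset [z, a', b', d] (mset qs + R))) E"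
  proof (rule safe_split[where l = r])
    show "r \<notin> labs (add_mset ([l] @ [a, b, c]) (add_mset [z, a', b', d] (mset qs + R)))"
      using r by (simp add: W0)
    show "safe (add_mset ([l] @ [r]) (add_mset ([a, b, c] @ [r]) (add_mset [z, a', b', d] (mset qs + R)))) (E - 1)"
      (is "safe ?W _")
    proof (rule cascade)
      let ?R = "add_mset [l, r] (add_mset [a, b, c, r] R)"
      have WX: "?W = add_mset [l, r] (add_mset [a, b, c, r] (add_mset [z, a', b', d] (mset qs))) + R"
        (is "_ = ?X + R") by simp
      have X: "labs ?X \<inter> labs R \<subseteq> labs X" using r' by (auto simp: X_def)
      have sub: "R \<subseteq># ?R" by (metis mset_subset_eq_add_right union_mset_add_mset_left add_mset_add_single add_0)
      have hot': "hot ?W ?R y" if "hot W R y" for y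
        using hot_replace[OF _ X WX sub] that by (simp add: W)
      show "?W = add_mset [z, a', b', d] (mset qs + ?R)" by simp
      show "tot ?W z = 1" using assms(3) r' neq by (auto simp: W0)
      show "pair_in ?W ?R" using pair_in_replace[OF _ X WX sub] assms(10) by (simp add: W)
      show "warm (hot ?W ?R) qs d" using assms(9) hot' by (rule warm_mono)
      show "proper ?W"
        by (rule proper_fresh[OF \<open>proper W\<close>, of r]) (use r' in \<open>auto simp: W0\<close>)
      show "hot ?W ?R a'" "hot ?W ?R b'" using hot hot' by auto
    qed (use \<open>E \<le> 7\<close> in auto)
    have "safe (X' + R) (E + 3)"
    proof (rule safe_drop[of X R X' _ "{a, b, c}" "{r}"])
      fix L assume L: "proper (X' + R + L)" "labs L \<inter> labs (X' + R) \<subseteq> {a, b, c} \<union> {r}"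
        "\<And>y. hot (X + R) R y \<Longrightarrow> hot (X' + R + L) (R + L) y"
        "pair_in (X + R) R \<or> {a, b, c} \<noteq> {} \<longrightarrow> pair_in (X' + R + L) (R + L)"
      let ?R = "add_mset [l, r] (R + L)"
      have WL: "X' + R + L = add_mset [z, a', b', d] (mset qs + ?R)" by (simp add: X'_def)
      have sub: "R + L \<subseteq># ?R" by simp
      have hot': "hot (X' + R + L) ?R y" if "hot W R y" for y
        using L(3)[of y] that hot_mono[OF _ sub] by (simp add: W)
      show "safe (X' + R + L) (E + 3 - int (card {a, b, c}) - int (card {r}))"
      proof (rule cascade[OF WL])
        have "z \<notin> labs L" using L(2) r' neq by (auto simp: X'_def)
        then show "tot (X' + R + L) z = 1" using z1 by simp
        show "warm (hot (X' + R + L) ?R) qs d" using assms(9) hot' by (rule warm_mono)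
        show "pair_in (X' + R + L) ?R" using L(4) pair_in_mono[OF _ sub] by auto
      qed (use hot hot' L(1) \<open>E \<le> 7\<close> neq in auto)
    next
      fix y assume "y \<in> {a, b, c}"
      then show "hot (X + R) R y \<and> y \<in> labs X \<and> y \<notin> labs X'"
        using hot neq r' by (auto simp: W X_def X'_def)
    qed (use \<open>proper W\<close> \<open>E \<le> 7\<close> pr X' r' neq cred[of "{a, b, c}"] in \<open>auto simp: W\<close>)
    then show "active (add_mset ([l] @ [a, b, c]) (add_mset [z, a', b', d] (mset qs + R))) [a, b, c] \<or>
        safe (add_mset ([l] @ [r]) (add_mset [z, a', b', d] (mset qs + R))) (E + 3)"
      by (simp add: X'_def)
    show "active (add_mset ([l] @ [a, b, c]) (add_mset [z, a', b', d] (mset qs + R))) [l] \<or>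
        safe (add_mset ([a, b, c] @ [r]) (add_mset [z, a', b', d] (mset qs + R))) (E + 3)"
      using assms(2) by (auto simp: active_def anchor_def W0)
  qed (use \<open>E \<le> 7\<close> in auto)
  then show ?thesis by (simp add: W0)
qed

text \<open>Neither half of the hexagon need be active, so all three answers must be met. Keeping
  both gives two 4-gons linked by \<open>r\<close>, a chain state with one more link. Dropping
  \<open>[h3, h4, h5]\<close> yields three credits, and the surviving 4-gon contains
  \<open>r\<close> once and leads into the old chain. Dropping \<open>[h1, h2, z]\<close> yields a
  third credit \<open>z\<close> only if the chain is empty. Otherwise the potential is
  \<open>E + 1\<close>, at most \<open>7\<close>, but \<open>z\<close> now has a single occurrence,
  in the first link, so that there are two 4-gons for \<open>cascade2\<close>.\<close>

lemma hexagon: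
  assumes "W = add_mset [h1, h2, z, h3, h4, h5] (mset qs + R)" "proper W" "E \<le> 6"
    "hot W R h1" "hot W R h2" "hot W R h3" "hot W R h4" "hot W R h5" "warm (hot W R) qs z"
  shows "safe W E"
proof -
  note hot = assms(4-8) and W0 = assms(1) and warm = assms(9)
  obtain r where r: "r \<notin> labs W" by (rule fresh)
  define X where "X = add_mset [h1, h2, z, h3, h4, h5] (mset qs)"
  have W: "W = X + R" by (simp add: X_def W0)
  let ?M = "mset qs"
  have "h1 \<notin> {h2, z, h3, h4, h5} \<and> h1 \<notin> labs ?M"
    using hot_unique[of X R h1 "[]" "[h2, z, h3, h4, h5]" ?M] hot(1) \<open>proper W\<close> by (simp add: X_def W)
  moreover have "h2 \<notin> {h1, z, h3, h4, h5} \<and> h2 \<notin> labs ?M"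
    using hot_unique[of X R h2 "[h1]" "[z, h3, h4, h5]" ?M] hot(2) \<open>proper W\<close> by (simp add: X_def W)
  moreover from calculation have "z \<notin> {h1, h2}" by (simp add: eq_commute[of z])
  moreover have "h3 \<notin> {h1, h2, z, h4, h5} \<and> h3 \<notin> labs ?M"
    using hot_unique[of X R h3 "[h1, h2, z]" "[h4, h5]" ?M] hot(3) \<open>proper W\<close> by (simp add: X_def W)
  moreover have "h4 \<notin> {h1, h2, z, h3, h5} \<and> h4 \<notin> labs ?M"
    using hot_unique[of X R h4 "[h1, h2, z, h3]" "[h5]" ?M] hot(4) \<open>proper W\<close> by (simp add: X_def W)
  moreover have "h5 \<notin> {h1, h2, z, h3, h4} \<and> h5 \<notin> labs ?M"
    using hot_unique[of X R h5 "[h1, h2, z, h3, h4]" "[]" ?M] hot(5) \<open>proper W\<close> by (simp add: X_def W)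
  moreover from calculation have "z \<notin> {h3, h4, h5}" by (simp add: eq_commute[of z])
  ultimately have neq: "distinct [h1, h2, z, h3, h4, h5]"
    "h1 \<notin> labs (mset qs)" "h2 \<notin> labs (mset qs)" "h3 \<notin> labs (mset qs)" "h4 \<notin> labs (mset qs)" "h5 \<notin> labs (mset qs)"
    by simp_all
  have r': "r \<notin> {h1, h2, z, h3, h4, h5}" "r \<notin> labs R" "r \<notin> labs (mset qs)" using r by (auto simp: W0)
  have sub: "R \<subseteq># R" by simp
  have "safe (add_mset ([h1, h2, z] @ [h3, h4, h5]) (mset qs + R)) E"
  proof (rule safe_split[where l = r])
    show "r \<notin> labs (add_mset ([h1, h2, z] @ [h3, h4, h5]) (mset qs + R))" using r by (simp add: W0)
    \<comment> \<open>The new label \<open>r\<close> takes the place of \<open>z\<close> and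
      \<open>h5\<close> that of \<open>p\<close>. The other half becomes the new front link and
      connects \<open>r\<close> with the old label \<open>z\<close>.\<close>
    have "safe (add_mset [r, h3, h4, h5] (mset ([r, h1, h2, z] # qs) + R)) (E - 1)" (is "safe ?W _")
    proof (rule safe_chain[OF refl])
      define X' where "X' = add_mset [r, h3, h4, h5] (mset ([r, h1, h2, z] # qs))"
      have X': "labs X' \<inter> labs R \<subseteq> labs X" "?W = X' + R" using r' by (auto simp: X'_def X_def)
      have hot': "hot ?W R y" if "hot W R y" for y
        using hot_replace[OF _ X' sub] that by (simp add: W)
      show "proper ?W"
        by (rule proper_fresh[OF \<open>proper W\<close>, of r]) (use r' in \<open>auto simp: W0\<close>)
      show "warm (hot ?W R) ([r, h1, h2, z] # qs) r"
        using hot hot' warm_mono[OF warm hot'] by auto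
      show "hot ?W R h3" "hot ?W R h4" "hot ?W R h5" using hot hot' by auto
    qed (use \<open>E \<le> 6\<close> in auto)
    then have "safe (add_mset [r, h1, h2, z] (add_mset [r, h3, h4, h5] (mset qs + R))) (E - 1)"
      by (simp add: add_mset_commute)
    then have "safe (add_mset [h1, h2, z, r] (add_mset [r, h3, h4, h5] (mset qs + R))) (E - 1)"
      by (rule safe_rotate[where u = "[h1, h2, z]" and v = "[r]"]) auto
    then have "safe (add_mset [r, h3, h4, h5] (add_mset [h1, h2, z, r] (mset qs + R))) (E - 1)"
      by (simp add: add_mset_commute)
    then have "safe (add_mset [h3, h4, h5, r] (add_mset [h1, h2, z, r] (mset qs + R))) (E - 1)"
      by (rule safe_rotate[where u = "[h3, h4, h5]" and v = "[r]"]) auto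
    then show "safe (add_mset ([h1, h2, z] @ [r]) (add_mset ([h3, h4, h5] @ [r]) (mset qs + R))) (E - 1)"
      by (simp add: add_mset_commute)
    have "safe (add_mset [r, h1, h2, z] (mset qs) + R) (E + 3)" (is "safe (?X + R) _")
    proof (rule safe_drop[of X R ?X _ "{h3, h4, h5}" "{}"])
      fix L assume L: "proper (?X + R + L)" "labs L \<inter> labs (?X + R) \<subseteq> {h3, h4, h5} \<union> {}"
        "\<And>y. hot (X + R) R y \<Longrightarrow> hot (?X + R + L) (R + L) y"
        "pair_in (X + R) R \<or> {h3, h4, h5} \<noteq> {} \<longrightarrow> pair_in (?X + R + L) (R + L)"
      show "safe (?X + R + L) (E + 3 - int (card {h3, h4, h5}) - int (card ({} :: nat set)))"
      proof (rule cascade)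
        show "?X + R + L = add_mset [r, h1, h2, z] (mset qs + (R + L))" by simp
        have "r \<notin> labs L" using L(2) r' by auto
        then show "tot (?X + R + L) r = 1" using r' by auto
        show "warm (hot (?X + R + L) (R + L)) qs z" using warm L(3) by (rule warm_mono) (simp add: W)
      qed (use L hot neq \<open>E \<le> 6\<close> in \<open>auto simp: W\<close>)
    next
      show "proper (?X + R)"
        by (rule proper_fresh[OF \<open>proper W\<close>, of r]) (use r' in \<open>auto simp: W0\<close>)
      show "hot (X + R) R y \<and> y \<in> labs X \<and> y \<notin> labs ?X" if "y \<in> {h3, h4, h5}" for y
        using that hot neq r' by (auto simp: W X_def)
    qed (use \<open>proper W\<close> \<open>E \<le> 6\<close> r' in \<open>auto simp: W X_def\<close>)
    then have "safe (add_mset [r, h1, h2, z] (mset qs + R)) (E + 3)" by simp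
    then have "safe (add_mset ([h1, h2, z] @ [r]) (mset qs + R)) (E + 3)"
      by (rule safe_rotate[where u = "[h1, h2, z]" and v = "[r]"]) auto
    then show "active (add_mset ([h1, h2, z] @ [h3, h4, h5]) (mset qs + R)) [h3, h4, h5] \<or>
        safe (add_mset ([h1, h2, z] @ [r]) (mset qs + R)) (E + 3)" ..
    have "safe (add_mset [r, h3, h4, h5] (mset qs) + R) (E + 3)" (is "safe (?X + R) _")
    proof (cases qs)
      case Nil
      then have z: "hot W R z" using warm by simp
      show ?thesis
      proof (rule safe_drop[of X R ?X _ "{h1, h2, z}" "{}"])
        fix L assume L: "proper (?X + R + L)" "labs L \<inter> labs (?X + R) \<subseteq> {h1, h2, z} \<union> {}"
          "\<And>y. hot (X + R) R y \<Longrightarrow> hot (?X + R + L) (R + L) y"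
          "pair_in (X + R) R \<or> {h1, h2, z} \<noteq> {} \<longrightarrow> pair_in (?X + R + L) (R + L)"
        show "safe (?X + R + L) (E + 3 - int (card {h1, h2, z}) - int (card ({} :: nat set)))"
        proof (rule cascade)
          show "?X + R + L = add_mset [r, h3, h4, h5] (mset [] + (R + L))" by (simp add: Nil)
          have "r \<notin> labs L" using L(2) r' by auto
          then show "tot (?X + R + L) r = 1" using r' by auto
        qed (use L hot neq \<open>E \<le> 6\<close> in \<open>auto simp: W\<close>)
      next
        show "proper (?X + R)"
          by (rule proper_fresh[OF \<open>proper W\<close>, of r]) (use r' in \<open>auto simp: W0\<close>)
        show "hot (X + R) R y \<and> y \<in> labs X \<and> y \<notin> labs ?X" if "y \<in> {h1, h2, z}" for y
          using that hot z neq r' by (auto simp: W X_def Nil)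
      qed (use \<open>proper W\<close> \<open>E \<le> 6\<close> r' in \<open>auto simp: W X_def\<close>)
    next
      case (Cons q qs')
      obtain a b d where q: "q = [z, a, b, d]" and h: "hot W R a" "hot W R b" "warm (hot W R) qs' d"
        using warm Cons by auto
      have "1 \<le> count_list [h1, h2, z, h3, h4, h5] z" "1 \<le> count_list q z"
        by (auto simp: q intro!: count_list_pos)
      then have z1: "tot (?X + R) z = 1"
        using properD[OF \<open>proper W\<close>, of z] r' neq by (auto simp: W0 Cons)
      show ?thesis
      proof (rule safe_drop[of X R ?X _ "{h1, h2}" "{}"])
        fix L assume L: "proper (?X + R + L)" "labs L \<inter> labs (?X + R) \<subseteq> {h1, h2} \<union> {}"
          "\<And>y. hot (X + R) R y \<Longrightarrow> hot (?X + R + L) (R + L) y"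
          "pair_in (X + R) R \<or> {h1, h2} \<noteq> {} \<longrightarrow> pair_in (?X + R + L) (R + L)"
        show "safe (?X + R + L) (E + 3 - int (card {h1, h2}) - int (card ({} :: nat set)))"
        proof (rule cascade2)
          show "?X + R + L = add_mset [r, h3, h4, h5] (add_mset [z, a, b, d] (mset qs' + (R + L)))"
            by (simp add: Cons q)
          have "r \<notin> labs L" using L(2) r' by auto
          then show "tot (?X + R + L) r = 1" using r' by auto
          have "z \<notin> labs L" using L(2) neq by (auto simp: Cons q)
          then show "tot (?X + R + L) z = 1" using z1 by simp
          show "warm (hot (?X + R + L) (R + L)) qs' d" using h(3) L(3) by (rule warm_mono) (simp add: W)
        qed (use L hot h neq \<open>E \<le> 6\<close> in \<open>auto simp: W\<close>)
      next
        show "proper (?X + R)"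
          by (rule proper_fresh[OF \<open>proper W\<close>, of r]) (use r' in \<open>auto simp: W0\<close>)
        show "hot (X + R) R y \<and> y \<in> labs X \<and> y \<notin> labs ?X" if "y \<in> {h1, h2}" for y
          using that hot neq r' by (auto simp: W X_def)
      qed (use \<open>proper W\<close> \<open>E \<le> 6\<close> r' in \<open>auto simp: W X_def\<close>)
    qed
    then have "safe (add_mset [r, h3, h4, h5] (mset qs + R)) (E + 3)" by simp
    then have "safe (add_mset ([h3, h4, h5] @ [r]) (mset qs + R)) (E + 3)"
      by (rule safe_rotate[where u = "[h3, h4, h5]" and v = "[r]"]) auto
    then show "active (add_mset ([h1, h2, z] @ [h3, h4, h5]) (mset qs + R)) [h1, h2, z] \<or>
        safe (add_mset ([h3, h4, h5] @ [r]) (mset qs + R)) (E + 3)" ..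
  qed (use \<open>E \<le> 6\<close> in auto)
  then show ?thesis by (simp add: W0)
qed

text \<open>The join puts \<open>K\<close> between the two occurrences of \<open>p\<close>. Cutting
  off \<open>\<alpha>\<close> is forced, since the other side contains \<open>p\<close> twice.
  Exchanging \<open>p\<close> with the label \<open>t\<close> of this cut restores the cycle
  \<open>p # \<alpha>\<close> and leaves an octagon containing \<open>t, K, t\<close>, which is cut
  beside this block. The block cannot be dropped because of \<open>t\<close>. If both sides are
  kept, \<open>[t, K, t, u]\<close> makes \<open>K\<close> and \<open>u\<close> hot and the other
  side is a hexagon with the single doubtful label \<open>z\<close>. If the other side is dropped,
  \<open>p\<close>, \<open>s\<close>, \<open>s'\<close>, \<open>K\<close>, \<open>u\<close> are
  credits.\<close>

lemma chain_move:
  assumes "chain_state W" "proper W" "E \<le> 5"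
  shows "one_move safe W E"
proof -
  obtain z s s' p \<alpha> qs R R' where
    W0: "W = add_mset [z, s, s', p] (mset qs + R)" and R: "R = add_mset (p # \<alpha>) R'"
    and ac: "active W \<alpha>" and hot: "hot W R s" "hot W R s'" and warm: "warm (hot W R) qs z"
    using assms(1) unfolding chain_state_def by blast
  obtain e where e: "anchor W \<alpha> e" using ac by (auto simp: active_def)
  obtain K where K: "K \<notin> labs W" by (rule fresh)
  obtain t where t: "t \<notin> insert K (labs W)" using fresh[of "add_mset [K] W"] by auto
  obtain u where u: "u \<notin> insert t (insert K (labs W))" using fresh[of "add_mset [K, t] W"] by auto
  have K': "K \<notin> {z, s, s', p}" "K \<notin> set \<alpha>" "K \<notin> labs (mset qs)" "K \<notin> labs R'"
    using K by (auto simp: W0 R)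
  have t': "t \<notin> {z, s, s', p, K}" "t \<notin> set \<alpha>" "t \<notin> labs (mset qs)" "t \<notin> labs R'"
    using t by (auto simp: W0 R)
  have u': "u \<notin> {z, s, s', p, K, t}" "u \<notin> set \<alpha>" "u \<notin> labs (mset qs)" "u \<notin> labs R'"
    using u by (auto simp: W0 R)
  have "1 \<le> count_list [z, s, s', p] p" by (rule count_list_pos) simp
  then have p: "p \<notin> {z, s, s'}" "p \<notin> set \<alpha>" "p \<notin> labs (mset qs)" "p \<notin> labs R'"
    using properD[OF assms(2), of p]
    by (auto simp: W0 R tot_eq_0_iff[symmetric] count_list_0_iff[symmetric] split: if_splits)
  have "p \<in> labs (add_mset (p # \<alpha>) R')" by simp
  have ep: "e \<noteq> p" using e p by (auto simp: anchor_def)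
  have te: "tot (add_mset [z, s, s', p] (mset qs) + R') e = 0" using e ep by (auto simp: anchor_def W0 R)
  then have e': "e \<notin> {z, s, s', p}" "e \<notin> labs (mset qs)" "e \<notin> labs R'" "e \<in> set \<alpha>"
    using e unfolding tot_eq_0_iff anchor_def by auto
  define X where "X = add_mset [z, s, s', p] (mset qs)"
  have W: "W = X + R" by (simp add: X_def W0)
  have ps: "s \<notin> {z, s'}" "s \<notin> labs (mset qs)"
    using hot_unique[of X R s "[z]" "[s', p]" "mset qs"] hot(1) assms(2) by (auto simp: X_def W)
  have ps': "s' \<notin> {z, s}" "s' \<notin> labs (mset qs)"
    using hot_unique[of X R s' "[z, s]" "[p]" "mset qs"] hot(2) assms(2) by (auto simp: X_def W)

  define X2 where "X2 = add_mset ([t, K, t] @ [p, K, z, s, s']) (mset qs)"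
  have labs2: "labs X2 \<inter> labs R \<subseteq> labs X" using K' t' by (auto simp: X_def X2_def R)
  have p2: "proper (X2 + R)"
  proof (rule proper_fresh[of "add_mset [K, K] W" t])
    show "proper (add_mset [K, K] W)"
      by (rule proper_fresh[OF assms(2), of K]) (use K in auto)
  qed (use t' K in \<open>auto simp: X2_def W0 R\<close>)
  have hot2: "hot (X2 + R) R y" if "hot W R y" for y
    using hot_replace[of X R y X2 "X2 + R" R] that labs2 by (simp add: W)
  have hotp: "hot W R p" 
  proof -
    have "anchor W (p # \<alpha>) e" using e ep by (auto simp: anchor_def)
    then show ?thesis unfolding hot_def active_def R by auto
  qed

  \<comment> \<open>The potential may be \<open>10\<close> here. The labels \<open>p\<close>,
    \<open>s\<close>, \<open>s'\<close> have their remaining occurrences in hot cycles of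
    \<open>R\<close>, while \<open>K\<close> and \<open>u\<close> are cut off
    \<open>[t, K, t, u]\<close>, whose anchor \<open>t\<close> is not spent.\<close>
  have drop: "safe (add_mset [t, K, t, u] (mset qs) + R) (E + 2 + 3)" (is "safe (?X + R) _")
  proof (rule safe_drop[of X2 R ?X _ "{p, s, s'}" "{K, u}"])
    show "proper ((?X) + R)"
      by (rule proper_fresh[OF p2, of u]) (use u' in \<open>auto simp: X2_def R\<close>)
    fix y assume "y \<in> {p, s, s'}"
    then show "hot (X2 + R) R y \<and> y \<in> labs X2 \<and> y \<notin> labs ?X"
      using hot2 hot hotp p ps ps' K' t' u' by (auto simp: X2_def)
  next
    fix y assume "y \<in> {K, u}"
    moreover have "anchor (?X + R) [t, K, t, u] t" using K' t' u' by (auto simp: anchor_def R)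
    ultimately show "tot (?X + R) y = 1 \<and> (\<exists>w\<in>#?X. y \<in> set w \<and>
        (\<exists>a. a \<notin> {p, s, s'} \<union> {K, u} \<and> anchor (?X + R) w a))"
      using K' t' u' by (intro conjI bexI[of _ "[t, K, t, u]"] exI[of _ t]) (auto simp: R)
  next
    fix L assume L: "proper (?X + R + L)"
      "pair_in (X2 + R) R \<or> {p, s, s'} \<noteq> {} \<longrightarrow> pair_in (?X + R + L) (R + L)"
    show "safe (?X + R + L) (E + 2 + 3 - int (card {p, s, s'}) - int (card {K, u}))"
      by (rule safe_pair[of _ _ "R + L"]) (use L p ps ps' K' u' assms(3) in auto)
  qed (use p2 assms(3) K' t' u' p ps ps' in \<open>auto simp: X2_def R\<close>)

  have keep: "safe (add_mset [p, K, z, s, s', u] (mset qs + add_mset [t, K, t, u] R)) (E + 2 - 1)" (is "safe ?W _")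
  proof (rule hexagon[OF refl])
    let ?R = "add_mset [t, K, t, u] R"
    let ?X = "add_mset [p, K, z, s, s', u] (add_mset [t, K, t, u] (mset qs))"
    have WX: "?W = ?X + R" by simp
    have X: "labs ?X \<inter> labs R \<subseteq> labs X2" using u' by (auto simp: X2_def R)
    have sub: "R \<subseteq># ?R" by simp
    have hot': "hot ?W ?R y" if "hot W R y" for y
      using hot_replace[OF hot2[OF that] X WX sub] .
    show "proper ?W"
      by (rule proper_fresh[OF p2, of u]) (use u' in \<open>auto simp: X2_def R\<close>)
    show "hot ?W ?R p" "hot ?W ?R s" "hot ?W ?R s'" using hot hotp hot' by auto
    have "anchor ?W [t, K, t, u] t" using K' t' u' by (auto simp: anchor_def R)
    then show "hot ?W ?R K" "hot ?W ?R u" unfolding hot_def active_def by auto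
    show "warm (hot ?W ?R) qs z" using warm hot' by (rule warm_mono)
  qed (use assms(3) in auto)

  \<comment> \<open>From here on the moves of the round are put together backwards, from the last
    cut to the join.\<close>
  have "safe (X2 + R) (E + 2)"
  proof -
    have "safe (add_mset ([t, K, t] @ [p, K, z, s, s']) (mset qs + R)) (E + 2)"
    proof (rule safe_split[where l = u])
      show "u \<notin> labs (add_mset ([t, K, t] @ [p, K, z, s, s']) (mset qs + R))" using u' by (auto simp: R)
      show "safe (add_mset ([t, K, t] @ [u]) (add_mset ([p, K, z, s, s'] @ [u]) (mset qs + R))) (E + 2 - 1)"
        using keep by (simp add: add_mset_commute)
      show "active (add_mset ([t, K, t] @ [p, K, z, s, s']) (mset qs + R)) [p, K, z, s, s'] \<or>
        safe (add_mset ([t, K, t] @ [u]) (mset qs + R)) (E + 2 + 3)"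
        using drop by simp
      show "active (add_mset ([t, K, t] @ [p, K, z, s, s']) (mset qs + R)) [t, K, t] \<or>
        safe (add_mset ([p, K, z, s, s'] @ [u]) (mset qs + R)) (E + 2 + 3)"
        unfolding active_def using t' K' by (intro disjI1 exI[of _ t]) (auto simp: anchor_def R)
    qed (use assms(3) in auto)
    then show ?thesis by (simp add: X2_def)
  qed
  then have "safe (add_mset (p # \<alpha>) (add_mset ([t, K, t] @ [p, K, z, s, s']) (mset qs + R'))) (E + 2)"
    by (simp add: X2_def R add_mset_commute)
  then have "safe (add_mset (\<alpha> @ [p]) (add_mset ([t, K, t] @ [p, K, z, s, s']) (mset qs + R'))) (E + 2)"
    by (rule safe_rotate[where u = \<alpha> and v = "[p]"]) auto
  then have "safe (add_mset ([t, K, t] @ [p, K, z, s, s']) (add_mset (\<alpha> @ [p]) (mset qs + R'))) (E + 2)"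
    by (simp add: add_mset_commute)
  then have "safe (add_mset [K, z, s, s', t, K, t, p] (add_mset (\<alpha> @ [p]) (mset qs + R'))) (E + 2)"
    by (rule safe_rotate[where u = "[K, z, s, s']" and v = "[t, K, t, p]"]) auto
  moreover have "transpose p t K = K" "transpose p t z = z" "transpose p t s = s" "transpose p t s' = s'"
    using p t' K' by (auto simp: transpose_def)
  ultimately have "safe (image_mset (map (transpose p t)) (add_mset (\<alpha> @ [t])
      (add_mset ([K, z, s, s', p, K, p] @ [t]) (mset qs + R')))) (E + 3 - 1)"
    using p t' K' ps ps' by (simp add: image_swap_id map_swap_id add_mset_commute add.commute[of _ E])
  then have "safe (add_mset (\<alpha> @ [t]) (add_mset ([K, z, s, s', p, K, p] @ [t]) (mset qs + R'))) (E + 3 - 1)"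
    by (rule safe_swap)
  then have "safe (add_mset (\<alpha> @ [K, z, s, s', p, K, p]) (mset qs + R')) (E + 3)"
  proof (rule safe_forced[rotated 4])
    show "active (add_mset (\<alpha> @ [K, z, s, s', p, K, p]) (mset qs + R')) \<alpha>"
      unfolding active_def using e e' K' by (intro exI[of _ e]) (auto simp: anchor_def W0 R)
    show "active (add_mset (\<alpha> @ [K, z, s, s', p, K, p]) (mset qs + R')) [K, z, s, s', p, K, p]"
      unfolding active_def using p K' by (intro exI[of _ p]) (auto simp: anchor_def)
    show "t \<notin> labs (add_mset (\<alpha> @ [K, z, s, s', p, K, p]) (mset qs + R'))" using t' by auto
  qed (use assms(3) in auto)
  then have "safe (add_mset ([z, s, s', p] @ [K] @ (p # \<alpha>) @ [K]) (mset qs + R')) (E + 3)"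
    by (rule safe_rotate[where u = "[z, s, s', p, K, p]" and v = "\<alpha> @ [K]"]) auto
  then have "one_move safe (add_mset [z, s, s', p] (add_mset (p # \<alpha>) (mset qs + R'))) E"
    by (intro join_move[of _ K]) (use assms(3) K' in auto)
  then show ?thesis by (simp add: W0 R)
qed

text \<open>The join yields the cycle \<open>\<alpha>, x, K, x, \<beta>, K\<close>. Two cuts are
  forced: one separates \<open>\<alpha>\<close>, and after \<open>x\<close> and the cut label
  \<open>p\<close> have exchanged names, the next separates \<open>[p, K, p]\<close> through the
  anchor \<open>p\<close>. There remains \<open>\<beta> @ [K, x, q]\<close>, which is cut after
  \<open>\<beta>\<close>. If both sides are kept, \<open>[K, x, q, r]\<close> consists of hot labels
  and forms a chain state with an empty chain. If it is lost, its labels survive once each in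
  \<open>[p, K, p, q]\<close>, \<open>\<alpha> @ [x]\<close> and \<open>\<beta> @ [r]\<close>, and
  four credits reduce \<open>E + 4\<close> to \<open>E\<close>.\<close>

lemma pair_move:
  assumes "pair_state W" "proper W" "E \<le> 5"
  shows "one_move safe W E"
proof -
  obtain \<alpha> x \<beta> M where
    W0: "W = add_mset (\<alpha> @ [x]) (add_mset (x # \<beta>) M)" and ac: "active W \<alpha>" "active W \<beta>"
    using assms(1) unfolding pair_state_def by blast
  obtain a b where a: "anchor W \<alpha> a" and b: "anchor W \<beta> b" using ac by (auto simp: active_def)
  have x: "x \<notin> set \<alpha>" "x \<notin> set \<beta>" "x \<notin> labs M"
    using properD[OF assms(2), of x] by (auto simp: W0 tot_eq_0_iff count_list_0_iff)
  have ax: "a \<noteq> x" "b \<noteq> x" using a b x by (auto simp: anchor_def)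
  have a': "a \<in> set \<alpha>" "a \<notin> set \<beta>" "a \<notin> labs M" using a ax by (auto simp: anchor_def W0 tot_eq_0_iff count_list_0_iff)
  have b': "b \<in> set \<beta>" "b \<notin> set \<alpha>" "b \<notin> labs M" using b ax by (auto simp: anchor_def W0 tot_eq_0_iff count_list_0_iff)
  obtain K where K: "K \<notin> labs W" by (rule fresh)
  obtain p where p: "p \<notin> insert K (labs W)" using fresh[of "add_mset [K] W"] by auto
  obtain q where q: "q \<notin> insert p (insert K (labs W))" using fresh[of "add_mset [K, p] W"] by auto
  obtain r where r: "r \<notin> insert q (insert p (insert K (labs W)))" using fresh[of "add_mset [K, p, q] W"] by auto
  have K': "K \<noteq> x" "K \<notin> set \<alpha>" "K \<notin> set \<beta>" "K \<notin> labs M" using K by (auto simp: W0)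
  have p': "p \<noteq> x" "p \<noteq> K" "p \<notin> set \<alpha>" "p \<notin> set \<beta>" "p \<notin> labs M" using p by (auto simp: W0)
  have q': "q \<noteq> x" "q \<noteq> K" "q \<noteq> p" "q \<notin> set \<alpha>" "q \<notin> set \<beta>" "q \<notin> labs M" using q by (auto simp: W0)
  have r': "r \<noteq> x" "r \<noteq> K" "r \<noteq> p" "r \<noteq> q" "r \<notin> set \<alpha>" "r \<notin> set \<beta>" "r \<notin> labs M" using r by (auto simp: W0)
  note fr = a' b' ax x K' p' q' r'
  have le2: "count_list \<alpha> y + count_list \<beta> y + tot M y \<le> 2" for y
    using properD[OF assms(2), of y] by (auto simp: W0)

  let ?R = "add_mset [p, K, p, q] (add_mset (\<alpha> @ [x]) M)"
  have anchors: "anchor (add_mset w ?R) [p, K, p, q] p" "anchor (add_mset w ?R) (\<alpha> @ [x]) a"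
    if "p \<notin> set w" "a \<notin> set w" for w
    using that fr a by (auto simp: anchor_def W0)

  have keep: "safe (add_mset (\<beta> @ [r]) (add_mset [K, x, q, r] ?R)) (E + 1 - 1)"
  proof -
    have "safe (add_mset [K, x, q, r] (mset [] + add_mset (\<beta> @ [r]) ?R)) (E + 1 - 1)" (is "safe ?W _")
    proof (rule safe_chain[OF refl])
      show "proper ?W" unfolding proper_def
      proof
        fix y show "tot ?W y \<le> 2" using le2[of y] fr
          by (cases "y \<in> {K, x, q, r, p}") auto
      qed
      have "anchor ?W [p, K, p, q] p" "anchor ?W (\<alpha> @ [x]) a" "anchor ?W (\<beta> @ [r]) b"
        using fr a b by (auto simp: anchor_def W0)
      then show "hot ?W (add_mset (\<beta> @ [r]) ?R) x" "hot ?W (add_mset (\<beta> @ [r]) ?R) q"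
         "hot ?W (add_mset (\<beta> @ [r]) ?R) r" "warm (hot ?W (add_mset (\<beta> @ [r]) ?R)) [] K"
        unfolding hot_def active_def by auto
    qed (use assms(3) in auto)
    then show ?thesis by (simp add: add_mset_commute)
  qed

  have drop: "safe (add_mset (\<beta> @ [r]) ?R) (E + 1 + 3)" (is "safe ?W _")
  proof (rule safe_credits[of "{K, x, q, r}"])
    show "proper ?W" unfolding proper_def
    proof
      fix y show "tot ?W y \<le> 2" using le2[of y] fr
        by (cases "y \<in> {K, x, q, r, p}") auto
    qed
    have "anchor ?W [p, K, p, q] p" "anchor ?W (\<alpha> @ [x]) a" "anchor ?W (\<beta> @ [r]) b"
      using fr a b by (auto simp: anchor_def W0)
    moreover have "p \<notin> {K, x, q, r}" "a \<notin> {K, x, q, r}" "b \<notin> {K, x, q, r}" using fr by auto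
    ultimately show "tot ?W y = 1 \<and> (\<exists>w\<in>#?W. y \<in> set w \<and> (\<exists>a. a \<notin> {K, x, q, r} \<and> anchor ?W w a))"
      if "y \<in> {K, x, q, r}" for y
      using that fr by (auto simp del: insert_iff) 
    fix L assume L: "proper (?W + L)" "labs L \<inter> labs ?W \<subseteq> {K, x, q, r}"
      "\<And>y. y \<in> {K, x, q, r} \<Longrightarrow> \<exists>m. m \<noteq> y \<and> [m, y] \<in># L \<and> tot (?W + L) m = 1"
    \<comment> \<open>One hot credit suffices to obtain a pair once its 2-cycle has been split off.
      Here \<open>q\<close> serves, through the anchor \<open>p\<close> of
      \<open>[p, K, p, q]\<close>.\<close>
    have "hot (?W + L) ?W q"
    proof -
      have "p \<notin> labs L" using L(2) fr by auto
      then have "anchor (?W + L) [p, K, p, q] p" using fr by (auto simp: anchor_def)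
      then show ?thesis unfolding hot_def active_def by auto
    qed
    then have "pair_in (?W + L) (?W + L)" using L(3)[of q] pair_in_leaf by blast
    moreover have "card {K, x, q, r} = 4" using fr by auto
    ultimately show "safe (?W + L) (E + 1 + 3 - int (card {K, x, q, r}))"
      using L(1) assms(3) by (intro safe_pair) auto
  qed (use assms(3) in auto)

  let ?M = "add_mset [p, K, p, q] (add_mset (\<alpha> @ [x]) M)"
  have "safe (add_mset (\<beta> @ [K, x, q]) ?M) (E + 1)"
  proof (rule safe_split[where l = r])
    show "r \<notin> labs (add_mset (\<beta> @ [K, x, q]) ?M)" using fr by auto
    show "active (add_mset (\<beta> @ [K, x, q]) ?M) \<beta> \<or> safe (add_mset ([K, x, q] @ [r]) ?M) (E + 1 + 3)"
      using fr b unfolding active_def by (intro disjI1 exI[of _ b]) (auto simp: anchor_def W0)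
  qed (use assms(3) keep drop b' in auto)
  then have "safe (add_mset ([p, K, p] @ [q]) (add_mset ((\<beta> @ [K, x]) @ [q]) (add_mset (\<alpha> @ [x]) M))) (E + 2 - 1)"
    by (simp add: add_mset_commute add.commute[of _ E])
  then have "safe (add_mset ([p, K, p] @ (\<beta> @ [K, x])) (add_mset (\<alpha> @ [x]) M)) (E + 2)"
  proof (rule safe_forced[rotated 4])
    let ?V = "add_mset ([p, K, p] @ (\<beta> @ [K, x])) (add_mset (\<alpha> @ [x]) M)"
    show "active ?V [p, K, p]" unfolding active_def using fr by (intro exI[of _ p]) (auto simp: anchor_def)
    show "active ?V (\<beta> @ [K, x])" unfolding active_def using fr b by (intro exI[of _ b]) (auto simp: anchor_def W0)
    show "q \<notin> labs ?V" using fr by auto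
  qed (use assms(3) in auto)
  then have "safe (image_mset (map (transpose x p)) (add_mset (\<alpha> @ [p])
      (add_mset (([x, K, x] @ \<beta> @ [K]) @ [p]) M))) (E + 3 - 1)"
    using fr by (simp add: image_swap_id map_swap_id add_mset_commute transpose_apply_other[of K x p] add.commute[of _ E])
  then have "safe (add_mset (\<alpha> @ [p]) (add_mset (([x, K, x] @ \<beta> @ [K]) @ [p]) M)) (E + 3 - 1)"
    by (rule safe_swap)
  then have "safe (add_mset (\<alpha> @ [x, K, x] @ \<beta> @ [K]) M) (E + 3)"
  proof (rule safe_forced[rotated 4])
    let ?V = "add_mset (\<alpha> @ [x, K, x] @ \<beta> @ [K]) M"
    show "active ?V \<alpha>" unfolding active_def using fr a by (intro exI[of _ a]) (auto simp: anchor_def W0)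
    show "active ?V ([x, K, x] @ \<beta> @ [K])" unfolding active_def using fr by (intro exI[of _ x]) (auto simp: anchor_def)
    show "p \<notin> labs ?V" using fr by auto
  qed (use assms(3) in auto)
  then have "one_move safe (add_mset (\<alpha> @ [x]) (add_mset (x # \<beta>) M)) E"
    by (intro join_move[of _ K]) (use assms(3) fr in auto)
  then show ?thesis by (simp add: W0)
qed

text \<open>Closes the cycle: every leaf of a tree for \<open>safe\<close> is the root of a further
  round.\<close>

lemma base_move: "base_state W E \<Longrightarrow> one_move safe W E"
  unfolding base_state_def using pair_move chain_move by blast

text \<open>Joining two dummies and then a third gives the word \<open>[0, 0, 1, 1]\<close> at
  potential \<open>6\<close>. The cut in its middle is forced, since each half contains its own
  label twice, and leaves a pair with shared label \<open>2\<close> at potential exactly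
  \<open>5\<close>.\<close>

lemma safe_start: "safe {#} 0"
proof -
  have "anchor {#[0, 0, 2], [2, 1, 1]#} [0, 0] 0" "anchor {#[0, 0, 2], [2, 1, 1]#} [1, 1] 1"
    by (auto simp: anchor_def)
  then have "pair_state {#[0, 0, 2], [2, 1, 1]#}"
    unfolding pair_state_def active_def
    by (intro exI[of _ "[0, 0]"] exI[of _ 2] exI[of _ "[1, 1]"] exI[of _ "{#}"]) auto
  then have "base_state {#[0, 0, 2], [2, 1, 1]#} 5"
    by (auto simp: base_state_def proper_def of_bool_def)
  then have "safe (add_mset [2, 1, 1] {#[0, 0, 2]#}) 5"
    by (intro safe_base) (simp add: add_mset_commute)
  then have "safe (add_mset ([1, 1] @ [2]) {#[0, 0, 2]#}) 5"
    by (rule safe_rotate[where u = "[1, 1]" and v = "[2]"]) auto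
  then have "safe {#[0, 0] @ [1, 1]#} 6"
    by (intro safe_forced[of _ "[0, 0]" "[1, 1]" "{#}" 2])
      (auto simp: active_def anchor_def add_mset_commute)
  then have "one_move safe {#[0, 0]#} 3"
    by (intro join_dummy_move[of _ 1]) auto
  then have "safe {#[0, 0]#} 3" by (rule safe_move)
  then have "one_move safe {#} 0"
    by (intro dummies_move[of _ 0]) auto
  then show ?thesis by (rule safe_move)
qed

lemma safe_le_10: "safe W E \<Longrightarrow> E \<le> 10"
proof (induction rule: safe.induct)
  case (safe_move W E)
  then show ?case by (auto elim: one_move.cases)
qed (auto simp: base_state_def)

section \<open>Graphs made of cycles\<close>

abbreviation trail :: "dgraph \<Rightarrow> nat \<Rightarrow> nat list \<Rightarrow> nat \<Rightarrow> bool" where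
  "trail \<equiv> pre_digraph.cas"

lemmas trail_simps [simp] = pre_digraph.cas.simps

lemma trail_append: "trail G a (A @ B) b \<longleftrightarrow> (\<exists>m. trail G a A m \<and> trail G m B b)"
  by (induction A arbitrary: a) auto

lemma trail_start_in: "trail G a A b \<Longrightarrow> a \<in> insert b (tail G ` set A)"
  by (cases A) auto

lemma trail_head_in: "trail G a A b \<Longrightarrow> e \<in> set A \<Longrightarrow> head G e \<in> insert b (tail G ` set A)"
proof (induction A arbitrary: a)
  case (Cons e' A)
  then show ?case using trail_start_in[of G "head G e'" A b] by auto
qed simp

text \<open>Splitting a vertex changes tails and heads in different ways, hence two maps. They have
  to agree only at inner vertices of the trail, where a head meets the next tail.\<close>

lemma trail_map:
  assumes "trail G a A b" "A \<noteq> []"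
    "\<And>e. e \<in> set A \<Longrightarrow> tail H e = \<phi> (tail G e) \<and> head H e = \<psi> (head G e)"
    "\<And>e. e \<in> set (tl A) \<Longrightarrow> \<phi> (tail G e) = \<psi> (tail G e)"
  shows "trail H (\<phi> a) A (\<psi> b)"
  using assms
proof (induction A arbitrary: a)
  case (Cons e A)
  show ?case
  proof (cases A)
    case Nil
    then show ?thesis using Cons.prems by auto
  next
    case (Cons e' A')
    then have "trail H (\<phi> (head G e)) A (\<psi> b)"
      using Cons.IH[of "head G e"] Cons.prems by auto
    moreover have "tail G e' = head G e" using Cons.prems(1) Cons by simp
    then have "\<phi> (head G e) = \<psi> (head G e)" using Cons.prems(4)[of e'] Cons by simp
    ultimately show ?thesis using Cons.prems by auto
  qed
qed simp

lemma trail_cong: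
  assumes "\<And>e. e \<in> set A \<Longrightarrow> tail H e = tail G e \<and> head H e = head G e"
  shows "trail H a A b \<longleftrightarrow> trail G a A b"
  using assms by (induction A arbitrary: a) auto

text \<open>Each nonempty entry of \<open>cs\<close> lists the arcs of one component in cyclic
  order. Closed trails together with injectivity of \<open>tail\<close> express that the entries are
  vertex-disjoint directed cycles, without recourse to reachability.\<close>

definition represents :: "dgraph \<Rightarrow> nat list list \<Rightarrow> bool" where
  "represents D cs \<longleftrightarrow> arcs D = set (concat cs) \<and> distinct (concat cs) \<and>
     inj_on (tail D) (arcs D) \<and> verts D = tail D ` arcs D \<and> (\<forall>c\<in>set cs. \<exists>a. trail D a c a)"

definition dipath :: "dgraph \<Rightarrow> nat \<Rightarrow> nat list \<Rightarrow> nat \<Rightarrow> bool" where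
  "dipath G a A b \<longleftrightarrow> arcs G = set A \<and> trail G a A b \<and> distinct A \<and> inj_on (tail G) (set A) \<and>
     b \<notin> tail G ` set A \<and> verts G = insert b (tail G ` set A)"

lemma represents_mset:
  assumes "represents D cs" "mset cs = mset cs'"
  shows "represents D cs'"
proof -
  have "mset (concat cs) = mset (concat cs')"
    using assms(2) by (simp add: mset_concat sum_mset_sum_list[symmetric])
  then have "set (concat cs) = set (concat cs')" "distinct (concat cs) = distinct (concat cs')"
    by (metis set_mset_mset, metis distinct_count_atmost_1 set_mset_mset)
  moreover have "set cs = set cs'" using assms(2) by (metis set_mset_mset)
  ultimately show ?thesis using assms(1) unfolding represents_def by metis
qed

lemma represents_rotate:
  assumes "represents D ((A @ B) # cs)"
  shows "represents D ((B @ A) # cs)"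
  using assms unfolding represents_def by (auto simp: trail_append)

text \<open>Following the trail forwards reaches all its vertices, and no other arc touches any of
  them, so reachability in the symmetric closure cannot leave the trail.\<close>

lemma component_trail:
  assumes "trail G a A b" "set A \<subseteq> arcs G" "insert b (tail G ` set A) \<subseteq> verts G"
    and "\<And>e. e \<in> arcs G \<Longrightarrow> e \<notin> set A \<Longrightarrow>
      tail G e \<notin> insert b (tail G ` set A) \<and> head G e \<notin> insert b (tail G ` set A)"
  shows "component G a = \<lparr>verts = insert b (tail G ` set A), arcs = set A, tail = tail G, head = head G\<rparr>"
proof -
  let ?X = "insert b (tail G ` set A)"
  let ?H = "with_proj (mk_symmetric G)"
  have head: "head G e \<in> ?X" if "e \<in> set A" for e using trail_head_in[OF assms(1) that] .
  have "?X \<subseteq> {x. a \<rightarrow>\<^sup>*\<^bsub>?H\<^esub> x}"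
    using assms(1-3)
  proof (induction A arbitrary: a)
    case Nil
    then show ?case by (auto simp: reachable_def)
  next
    case (Cons e A)
    have a: "a = tail G e" and e: "e \<in> arcs G" using Cons.prems by auto
    have IH: "insert b (tail G ` set A) \<subseteq> {x. head G e \<rightarrow>\<^sup>*\<^bsub>?H\<^esub> x}"
      using Cons.IH[of "head G e"] Cons.prems by auto
    have hv: "head G e \<in> verts G"
      using trail_start_in[of G "head G e" A b] Cons.prems by auto
    have step: "(a, head G e) \<in> arcs_ends ?H" using e a by (auto simp: parcs_mk_symmetric)
    have av: "a \<in> verts ?H" using Cons.prems a by auto
    have "a \<rightarrow>\<^sup>*\<^bsub>?H\<^esub> x" if "x \<in> insert b (tail G ` set A)" for x
    proof -
      have "(head G e, x) \<in> rtrancl_on (verts ?H) (arcs_ends ?H)"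
        using IH that by (auto simp: reachable_def)
      then show ?thesis unfolding reachable_def
        by (rule converse_rtrancl_on_into_rtrancl_on[OF step _ av])
    qed
    moreover have "a \<rightarrow>\<^sup>*\<^bsub>?H\<^esub> a" using av by (auto simp: reachable_def)
    moreover have "insert b (tail G ` set (e # A)) = insert a (insert b (tail G ` set A))"
      using a by auto
    ultimately show ?case by blast
  qed
  moreover have "x \<in> ?X" if "a \<rightarrow>\<^sup>*\<^bsub>?H\<^esub> x" for x
  proof -
    have "(a, x) \<in> rtrancl_on (verts ?H) (arcs_ends ?H)" using that by (simp add: reachable_def)
    then show ?thesis
    proof (induction rule: rtrancl_on_induct)
      case base
      show ?case using trail_start_in[OF assms(1)] .
    next
      case (step y z)
      then obtain e where e: "e \<in> arcs G" "(y, z) = (tail G e, head G e) \<or> (y, z) = (head G e, tail G e)"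
        by (auto simp: parcs_mk_symmetric)
      then have "e \<in> set A" using step.IH assms(4)[of e] by auto
      then show ?case using e head by auto
    qed
  qed
  ultimately have X: "{x. a \<rightarrow>\<^sup>*\<^bsub>?H\<^esub> x} = ?X" by blast
  have "{e \<in> arcs G. tail G e \<in> ?X \<and> head G e \<in> ?X} = set A"
    using assms(2,4) head by blast
  then show ?thesis unfolding component_def X induce_subgraph_def by simp
qed

text \<open>An empty list stands for a dummy vertex that has not been added to the graph yet.\<close>

definition starts_at :: "dgraph \<Rightarrow> nat \<Rightarrow> nat list \<Rightarrow> bool" where
  "starts_at D x A \<longleftrightarrow> (if A = [] then x \<notin> verts D else trail D x A x)"

abbreviation part :: "dgraph \<Rightarrow> nat \<Rightarrow> nat list \<Rightarrow> dgraph" where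
  "part D x A \<equiv> \<lparr>verts = insert x (tail D ` set A), arcs = set A, tail = tail D, head = head D\<rparr>"

lemma represents_head:
  assumes "represents D cs" "e \<in> arcs D"
  shows "head D e \<in> verts D"
proof -
  obtain c where c: "c \<in> set cs" "e \<in> set c" using assms by (auto simp: represents_def)
  then obtain a where "trail D a c a" using assms by (auto simp: represents_def)
  moreover have "a \<in> tail D ` set c" using calculation c by (cases c) auto
  ultimately show ?thesis using trail_head_in[of D a c a e] c assms by (auto simp: represents_def)
qed

text \<open>An arc outside \<open>A\<close> has a tail of its own by injectivity, and its head is
  the tail of an arc of its own cycle. If \<open>A\<close> is empty, \<open>x\<close> is a dummy and
  not a vertex of \<open>D\<close> at all.\<close>

lemma represents_separate:
  assumes "represents D (A # cs)" "starts_at D x A" "e \<in> arcs D" "e \<notin> set A"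
  shows "tail D e \<notin> insert x (tail D ` set A)" "head D e \<notin> insert x (tail D ` set A)"
proof -
  have e: "e \<in> set (concat cs)" using assms by (auto simp: represents_def)
  have inj: "inj_on (tail D) (arcs D)" and arcs: "arcs D = set A \<union> set (concat cs)"
    and disj: "set A \<inter> set (concat cs) = {}" and verts: "verts D = tail D ` arcs D"
    using assms(1) by (auto simp: represents_def)
  have x: "x \<notin> tail D ` set (concat cs)"
  proof (cases "A = []")
    case True
    then show ?thesis using assms(2) verts arcs by (auto simp: starts_at_def)
  next
    case False
    then have "x \<in> tail D ` set A" using assms(2) by (cases A) (auto simp: starts_at_def)
    then show ?thesis using inj arcs disj by (auto dest!: inj_onD)
  qed
  have *: "t \<notin> insert x (tail D ` set A)" if "t \<in> tail D ` set (concat cs)" for t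
    using that x inj arcs disj by (auto dest!: inj_onD)
  show "tail D e \<notin> insert x (tail D ` set A)" using * e by blast
  obtain c where c: "c \<in> set cs" "e \<in> set c" using e by auto
  then obtain a where a: "trail D a c a" using assms(1) by (auto simp: represents_def)
  then have "a \<in> tail D ` set c" using c by (cases c) auto
  then have "head D e \<in> tail D ` set c" using trail_head_in[OF a c(2)] by auto
  moreover have "tail D ` set c \<subseteq> tail D ` set (concat cs)" using c by auto
  ultimately show "head D e \<notin> insert x (tail D ` set A)" using * by blast
qed

lemma represents_component:
  assumes "represents D (A # cs)" "starts_at D x A"
    "arcs G = arcs D" "tail G = tail D" "head G = head D" "insert x (verts D) \<subseteq> verts G"
  shows "component G x = part D x A"
proof -
  have "trail D x A x" using assms(2) by (auto simp: starts_at_def split: if_splits)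
  then have "trail G x A x" using trail_cong[of A G D] assms by simp
  then have "component G x =
    \<lparr>verts = insert x (tail G ` set A), arcs = set A, tail = tail G, head = head G\<rparr>"
  proof (rule component_trail)
    show "set A \<subseteq> arcs G" "insert x (tail G ` set A) \<subseteq> verts G"
      using assms by (auto simp: represents_def)
    show "tail G e \<notin> insert x (tail G ` set A) \<and> head G e \<notin> insert x (tail G ` set A)"
      if "e \<in> arcs G" "e \<notin> set A" for e
      using represents_separate[OF assms(1,2), of e] that assms(3-5) by simp
  qed
  then show ?thesis using assms by simp
qed

section \<open>Closing paths to cycles, uniting and deleting cycles\<close>

lemma represents_insert_edge:
  assumes "dipath G a A b" "f \<notin> set A"
  shows "represents (insert_edge G f b a) [A @ [f]]"
proof -
  let ?H = "insert_edge G f b a"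
  have A: "arcs G = set A" "trail G a A b" "distinct A" "inj_on (tail G) (set A)"
    "b \<notin> tail G ` set A" "verts G = insert b (tail G ` set A)"
    using assms(1) by (auto simp: dipath_def)
  have t: "tail ?H e = tail G e \<and> head ?H e = head G e" if "e \<in> set A" for e
    using that assms(2) by (auto simp: insert_edge_def)
  have im: "tail ?H ` set A = tail G ` set A" using t by (intro image_cong) auto
  have f: "tail ?H f = b" "head ?H f = a" by (auto simp: insert_edge_def)
  have "trail ?H a A b" using trail_cong[of A ?H G a b] t A(2) by blast
  then have "trail ?H a (A @ [f]) a" using f by (auto simp: trail_append)
  moreover have "inj_on (tail ?H) (insert f (set A))"
  proof -
    have "inj_on (tail ?H) (set A)" using A(4) t by (simp add: inj_on_def)
    moreover have "tail ?H f \<notin> tail ?H ` (set A - {f})" using A(5) im f assms(2) by auto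
    ultimately show ?thesis unfolding inj_on_insert by blast
  qed
  moreover have "verts ?H = tail ?H ` insert f (set A)"
  proof -
    have "verts ?H = insert b (tail G ` set A)"
      using A(6) trail_start_in[OF A(2)] by (auto simp: insert_edge_def)
    then show ?thesis using im f by simp
  qed
  moreover have "arcs ?H = insert f (set A)" using A(1) by (simp add: insert_edge_def)
  ultimately show ?thesis using A(3) assms(2) unfolding represents_def by auto
qed

text \<open>The list follows the closed walk from \<open>a\<close> along \<open>A\<close> to
  \<open>b\<close>, over \<open>f'\<close> to \<open>c\<close>, along \<open>B\<close> to
  \<open>d\<close> and over \<open>f\<close> back to \<open>a\<close>.\<close>

lemma represents_join:
  assumes P: "dipath G a A b" "dipath H c B d" and "set A \<inter> set B = {}" "verts G \<inter> verts H = {}"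
    and f: "f \<notin> set A \<union> set B" "f' \<notin> set A \<union> set B" "f \<noteq> f'"
  shows "represents (insert_edge (insert_edge (graph_union G H) f d a) f' b c) [A @ [f'] @ B @ [f]]"
    (is "represents ?K _")
proof -
  have A: "arcs G = set A" "trail G a A b" "distinct A" "inj_on (tail G) (set A)"
    "b \<notin> tail G ` set A" "verts G = insert b (tail G ` set A)"
    using P(1) by (auto simp: dipath_def)
  have B: "arcs H = set B" "trail H c B d" "distinct B" "inj_on (tail H) (set B)"
    "d \<notin> tail H ` set B" "verts H = insert d (tail H ` set B)"
    using P(2) by (auto simp: dipath_def)
  have tA: "tail ?K e = tail G e \<and> head ?K e = head G e" if "e \<in> set A" for e
    using that f A(1) by (auto simp: insert_edge_def graph_union_def)
  have tB: "tail ?K e = tail H e \<and> head ?K e = head H e" if "e \<in> set B" for e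
    using that f A(1) assms(3) by (auto simp: insert_edge_def graph_union_def)
  have tf: "tail ?K f = d" "head ?K f = a" "tail ?K f' = b" "head ?K f' = c"
    using f by (auto simp: insert_edge_def)
  have "trail ?K a A b" using A(2) trail_cong[of A ?K G a b] tA by blast
  moreover have "trail ?K c B d" using B(2) trail_cong[of B ?K H c d] tB by blast
  ultimately have tr: "trail ?K a (A @ [f'] @ B @ [f]) a"
    using tf by (auto simp: trail_append)
  have arcs: "arcs ?K = insert f (insert f' (set A \<union> set B))"
    using A(1) B(1) by (auto simp: insert_edge_def graph_union_def)
  have imA: "tail ?K ` set A = tail G ` set A" and imB: "tail ?K ` set B = tail H ` set B"
    using tA tB by (auto intro!: image_cong)
  have "inj_on (tail ?K) (set A)" "inj_on (tail ?K) (set B)"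
    using A(4) B(4) tA tB by (simp_all add: inj_on_def)
  moreover have "tail ?K ` set A \<inter> tail ?K ` set B = {}" using imA imB A(6) B(6) assms(4) by auto
  ultimately have "inj_on (tail ?K) (set A \<union> set B)" unfolding inj_on_Un by blast
  moreover have "b \<notin> tail ?K ` (set A \<union> set B)" "d \<notin> tail ?K ` (set A \<union> set B)" "b \<noteq> d"
    unfolding image_Un imA imB using A(5,6) B(5,6) assms(4) by auto
  ultimately have inj: "inj_on (tail ?K) (arcs ?K)"
    unfolding arcs using tf f by (auto simp: inj_on_insert)
  have verts: "verts ?K = tail ?K ` arcs ?K"
  proof -
    have "tail ?K ` arcs ?K = insert d (insert b (tail G ` set A \<union> tail H ` set B))"
      unfolding arcs image_insert image_Un imA imB tf ..
    moreover have "verts ?K = verts G \<union> verts H \<union> {a, b, c, d}"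
      by (auto simp: insert_edge_def graph_union_def)
    ultimately show ?thesis
      using A(6) B(6) trail_start_in[OF A(2)] trail_start_in[OF B(2)] by auto
  qed
  show ?thesis unfolding represents_def
    using arcs inj verts tr A(3) B(3) assms(3) f by (intro conjI) auto
qed

lemma represents_union:
  assumes "represents G cs" "represents H cs'" "arcs G \<inter> arcs H = {}" "verts G \<inter> verts H = {}"
  shows "represents (graph_union G H) (cs @ cs')" (is "represents ?K _")
proof -
  have G: "arcs G = set (concat cs)" "distinct (concat cs)" "inj_on (tail G) (arcs G)"
    "verts G = tail G ` arcs G" "\<forall>c\<in>set cs. \<exists>a. trail G a c a"
    using assms(1) unfolding represents_def by blast+
  have H: "arcs H = set (concat cs')" "distinct (concat cs')" "inj_on (tail H) (arcs H)"
    "verts H = tail H ` arcs H" "\<forall>c\<in>set cs'. \<exists>a. trail H a c a"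
    using assms(2) unfolding represents_def by blast+
  have tG: "tail ?K e = tail G e \<and> head ?K e = head G e" if "e \<in> arcs G" for e
    using that by (simp add: graph_union_def)
  have tH: "tail ?K e = tail H e \<and> head ?K e = head H e" if "e \<in> arcs H" for e
    using that assms(3) by (auto simp: graph_union_def)
  have im: "tail ?K ` arcs G = tail G ` arcs G" "tail ?K ` arcs H = tail H ` arcs H"
    using tG tH by (auto intro!: image_cong)
  have arcs: "arcs ?K = arcs G \<union> arcs H" by (simp add: graph_union_def)
  have "inj_on (tail ?K) (arcs G)" "inj_on (tail ?K) (arcs H)"
    using G(3) H(3) tG tH by (simp_all add: inj_on_def)
  moreover have "tail ?K ` arcs G \<inter> tail ?K ` arcs H = {}"
    using im G(4) H(4) assms(4) by auto
  ultimately have inj: "inj_on (tail ?K) (arcs ?K)" unfolding arcs inj_on_Un by blast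
  have verts: "verts ?K = tail ?K ` arcs ?K"
    unfolding arcs image_Un im using G(4) H(4) by (simp add: graph_union_def)
  have "\<exists>a. trail ?K a c a" if c: "c \<in> set cs" for c
  proof -
    have "set c \<subseteq> arcs G" using c G(1) by auto
    then have "trail ?K a c a = trail G a c a" for a using tG by (intro trail_cong) blast
    then show ?thesis using c G(5) by blast
  qed
  moreover have "\<exists>a. trail ?K a c a" if c: "c \<in> set cs'" for c
  proof -
    have "set c \<subseteq> arcs H" using c H(1) by auto
    then have "trail ?K a c a = trail H a c a" for a using tH by (intro trail_cong) blast
    then show ?thesis using c H(5) by blast
  qed
  moreover have "arcs ?K = set (concat (cs @ cs'))" "distinct (concat (cs @ cs'))"
    using G(1,2) H(1,2) assms(3) arcs by simp_all
  ultimately show ?thesis unfolding represents_def using inj verts by auto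
qed

lemma represents_delete:
  assumes "represents D (A # cs)" "starts_at D x A" "verts C = insert x (tail D ` set A)"
  shows "represents (delete_part D C) cs" "verts (delete_part D C) = verts D - insert x (tail D ` set A)"
    "arcs (delete_part D C) = set (concat cs)" "tail (delete_part D C) = tail D" "head (delete_part D C) = head D"
proof -
  let ?K = "delete_part D C"
  show v: "verts ?K = verts D - insert x (tail D ` set A)" and t: "tail ?K = tail D" "head ?K = head D"
    by (auto simp: delete_part_def induce_subgraph_def assms(3))
  have arcs: "arcs D = set A \<union> set (concat cs)" "set A \<inter> set (concat cs) = {}"
    using assms(1) by (auto simp: represents_def)
  have sep: "tail D e \<notin> insert x (tail D ` set A)" "head D e \<notin> insert x (tail D ` set A)"
    if "e \<in> set (concat cs)" for e
    using represents_separate[OF assms(1,2), of e] that arcs by blast+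
  have vD: "tail D e \<in> verts D" "head D e \<in> verts D" if "e \<in> arcs D" for e
    using represents_head[OF assms(1) that] assms(1) that by (auto simp: represents_def)
  have aK: "arcs ?K = {e \<in> arcs D. tail D e \<in> verts D - insert x (tail D ` set A) \<and> head D e \<in> verts D - insert x (tail D ` set A)}"
    by (simp add: delete_part_def induce_subgraph_def assms(3))
  show a: "arcs ?K = set (concat cs)"
  proof
    show "set (concat cs) \<subseteq> arcs ?K"
      unfolding aK using sep vD arcs(1) by blast
    show "arcs ?K \<subseteq> set (concat cs)"
    proof
      fix e assume "e \<in> arcs ?K"
      then have "e \<in> arcs D" "tail D e \<notin> tail D ` set A" unfolding aK by auto
      then show "e \<in> set (concat cs)" using arcs(1) by auto
    qed
  qed
  have vv: "verts ?K = tail D ` set (concat cs)"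
  proof
    show "tail D ` set (concat cs) \<subseteq> verts ?K"
    proof (rule image_subsetI)
      fix e assume e: "e \<in> set (concat cs)"
      then have "e \<in> arcs D" using arcs(1) by simp
      then show "tail D e \<in> verts ?K" using sep(1)[OF e] vD(1)[of e] unfolding v by simp
    qed
    have "verts D = tail D ` set A \<union> tail D ` set (concat cs)"
    proof -
      have "verts D = tail D ` arcs D" using assms(1) unfolding represents_def by blast
      then show ?thesis unfolding arcs(1) image_Un .
    qed
    then show "verts ?K \<subseteq> tail D ` set (concat cs)" unfolding v by auto
  qed
  have "inj_on (tail D) (arcs D)" using assms(1) unfolding represents_def by blast
  then have "inj_on (tail D) (set (concat cs))" by (rule inj_on_subset) (use arcs in blast)
  moreover have "trail ?K a c a = trail D a c a" for a c by (rule trail_cong) (simp add: t)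
  moreover have "distinct (concat cs)" "\<forall>c\<in>set cs. \<exists>a. trail D a c a"
    using assms(1) by (auto simp: represents_def)
  ultimately show "represents ?K cs" unfolding represents_def a t vv by simp
qed

text \<open>Only the first arc of \<open>A\<close> starts at \<open>x\<close>, so giving tails the
  source \<open>v1\<close> and heads the sink \<open>v2\<close> opens the cycle exactly there. The
  last assumption covers a dummy, whose path is a single vertex.\<close>

lemma dipath_split_vertex:
  assumes "represents D (A # cs)" "starts_at D x A"
    and "v1 \<notin> insert x (verts D)" "v2 \<notin> insert x (verts D)" "v1 = v2 \<longleftrightarrow> A = []"
  shows "dipath (split_vertex (part D x A) x v1 v2) v1 A v2" (is "dipath ?S _ _ _")
    "verts (split_vertex (part D x A) x v1 v2) \<subseteq> {v1, v2} \<union> tail D ` set A"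
proof -
  have "set A \<subseteq> arcs D" "inj_on (tail D) (arcs D)" "verts D = tail D ` arcs D"
    using assms(1) unfolding represents_def by auto
  then have D: "inj_on (tail D) (set A)" "tail D ` set A \<subseteq> verts D"
    by (auto intro: inj_on_subset)
  have dA: "distinct A" using assms(1) by (simp add: represents_def)
  have x: "trail D x A x" using assms(2) by (auto simp: starts_at_def split: if_splits)
  let ?\<phi> = "\<lambda>t. if t = x then v1 else t" and ?\<psi> = "\<lambda>t. if t = x then v2 else t"
  have t: "tail ?S e = ?\<phi> (tail D e) \<and> head ?S e = ?\<psi> (head D e)" for e
    by (simp add: split_vertex_def)
  have v: "arcs ?S = set A" "verts ?S = (insert x (tail D ` set A) - {x}) \<union> {v1, v2}"
    by (simp_all add: split_vertex_def)
  show "verts ?S \<subseteq> {v1, v2} \<union> tail D ` set A" unfolding v by auto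
  show "dipath ?S v1 A v2"
  proof (cases A)
    case Nil
    then show ?thesis using assms(5) v by (auto simp: dipath_def)
  next
    case (Cons e A')
    have e: "tail D e = x" using x Cons by simp
    have ne: "tail D e' \<noteq> x" if "e' \<in> set A'" for e'
    proof -
      have "e \<in> set A" "e' \<in> set A" "e \<noteq> e'" using that dA Cons by auto
      then show ?thesis using inj_onD[OF D(1)] e by metis
    qed
    have "trail ?S (?\<phi> x) A (?\<psi> x)"
      by (rule trail_map[OF x]) (use Cons t ne in auto)
    then have tr: "trail ?S v1 A v2" by simp
    have "inj_on ?\<phi> (verts D)" using assms(3) by (auto simp: inj_on_def)
    then have "inj_on (?\<phi> \<circ> tail D) (set A)" using D by (intro comp_inj_on) (auto intro: inj_on_subset)
    then have inj: "inj_on (tail ?S) (set A)" using t by (simp add: inj_on_def)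
    have "tail ?S e = v1" using e t by simp
    moreover have "tail ?S e' = tail D e'" if "e' \<in> set A'" for e' using ne[OF that] t by simp
    then have "tail ?S ` set A' = tail D ` set A'" by (intro image_cong) auto
    ultimately have im: "tail ?S ` set A = insert v1 (tail D ` set A')" using Cons by simp
    have "insert x (tail D ` set A) - {x} = tail D ` set A'" using ne e Cons by auto
    then have "verts ?S = insert v2 (tail ?S ` set A)" unfolding v im by auto
    moreover have "v2 \<notin> tail ?S ` set A" unfolding im using assms(4,5) D(2) Cons by auto
    ultimately show ?thesis unfolding dipath_def using v(1) tr dA inj by simp
  qed
qed

lemma represents_inj: "represents D cs \<Longrightarrow> inj_on (tail D) (arcs D)"
  unfolding represents_def by blast

lemma represents_verts: "represents D cs \<Longrightarrow> verts D = tail D ` arcs D"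
  unfolding represents_def by blast

lemma represents_arcs: "represents D cs \<Longrightarrow> arcs D = set (concat cs)"
  unfolding represents_def by blast

lemma represents_prefix:
  assumes "represents D (A # cs)"
  shows "set A \<subseteq> arcs D" "distinct A"
proof -
  have "arcs D = set (concat (A # cs))" "distinct (concat (A # cs))"
    using assms unfolding represents_def by blast+
  then show "set A \<subseteq> arcs D" "distinct A" by simp_all
qed

lemma starts_at_mem: "starts_at D x A \<Longrightarrow> A \<noteq> [] \<Longrightarrow> x \<in> tail D ` set A"
  by (cases A) (auto simp: starts_at_def)

lemma starts_at_verts:
  assumes "represents D (A # cs)" "starts_at D x A"
  shows "x \<notin> verts D \<longleftrightarrow> A = []"
proof (cases "A = []")
  case False
  then have "x \<in> tail D ` set A" using starts_at_mem assms(2) by blast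
  moreover have "tail D ` set A \<subseteq> verts D"
    unfolding represents_verts[OF assms(1)] represents_arcs[OF assms(1)] by auto
  ultimately show ?thesis using False by auto
qed (use assms(2) in \<open>simp add: starts_at_def\<close>)

lemma starts_at_disjoint:
  assumes "represents D (A # B # cs)" "starts_at D x A" "starts_at D y B" "A = [] \<longrightarrow> B = [] \<longrightarrow> x \<noteq> y"
  shows "insert x (tail D ` set A) \<inter> insert y (tail D ` set B) = {}"
proof -
  have rep: "represents D (B # A # cs)" by (rule represents_mset[OF assms(1)]) (simp add: add_mset_commute)
  have "set A \<subseteq> arcs D" "set A \<inter> set B = {}" using assms(1) by (auto simp: represents_def)
  then have tA: "t \<notin> insert y (tail D ` set B)" if t: "t \<in> tail D ` set A" for t
  proof -
    obtain e where e: "e \<in> set A" "t = tail D e" using t by auto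
    then have "e \<in> arcs D" "e \<notin> set B" using \<open>set A \<subseteq> arcs D\<close> \<open>set A \<inter> set B = {}\<close> by auto
    then show ?thesis using represents_separate(1)[OF rep assms(3)] e(2) by simp
  qed
  moreover have "x \<notin> insert y (tail D ` set B)"
  proof (cases "A = []")
    case True
    then have "x \<notin> verts D" using assms(2) by (simp add: starts_at_def)
    moreover have "tail D ` set B \<subseteq> verts D"
      using represents_verts[OF rep] represents_arcs[OF rep] by auto
    ultimately show ?thesis using starts_at_mem[OF assms(3)] assms(4) True by (cases "B = []") auto
  next
    case False
    then show ?thesis using tA starts_at_mem[OF assms(2)] by blast
  qed
  ultimately show ?thesis by blast
qed

lemma with_dummies_simps [simp]:
  "verts (with_dummies D x y) = verts D \<union> {x, y}" "arcs (with_dummies D x y) = arcs D"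
  "tail (with_dummies D x y) = tail D" "head (with_dummies D x y) = head D"
  by (simp_all add: with_dummies_def)

section \<open>Joining two cycles\<close>

lemma join_components:
  assumes "represents D (A # B # cs)" "starts_at D x A" "starts_at D y B" "A = [] \<longrightarrow> B = [] \<longrightarrow> x \<noteq> y"
  shows "component (with_dummies D x y) x = part D x A" "component (with_dummies D x y) y = part D y B"
    "\<not> same_component D x y"
proof -
  have rep: "represents D (B # A # cs)" by (rule represents_mset[OF assms(1)]) (simp add: add_mset_commute)
  show 1: "component (with_dummies D x y) x = part D x A"
    by (rule represents_component[OF assms(1,2)]) auto
  show 2: "component (with_dummies D x y) y = part D y B"
    by (rule represents_component[OF rep assms(3)]) auto
  show "\<not> same_component D x y"
    unfolding same_component_def 1 2 using starts_at_disjoint[OF assms] by auto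
qed

lemma represents_join_cycles:
  assumes rep: "represents D (A # B # cs)" and x: "starts_at D x A" and y: "starts_at D y B"
    and xy: "A = [] \<longrightarrow> B = [] \<longrightarrow> x \<noteq> y"
    and "new_edges U D f f' l" "join_cycles D x y f f' C"
  shows "represents (graph_union
    (delete_part (other_components D x y) (component (with_dummies D x y) y)) C) ((A @ [f'] @ B @ [f]) # cs)"
proof -
  note comp = join_components[OF rep x y xy]
  note disj = starts_at_disjoint[OF rep x y xy]
  have rep': "represents D (B # A # cs)" by (rule represents_mset[OF rep]) (simp add: add_mset_commute)
  have f: "f \<noteq> f'" "f \<notin> arcs D" "f' \<notin> arcs D" using assms(5) by (auto simp: new_edges_def)
  have arcs: "arcs D = set A \<union> set B \<union> set (concat cs)"
    using represents_arcs[OF rep] by (simp add: Un_assoc)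
  have dist: "distinct (concat (A # B # cs))" using rep unfolding represents_def by blast
  obtain v1 v2 w1 w2 P P' where v: "{v1, v2, w1, w2} \<inter> (verts D \<union> {x, y}) = {}" "{v1, v2} \<inter> {w1, w2} = {}"
    and vx: "v1 = v2 \<longleftrightarrow> x \<notin> verts D" and wy: "w1 = w2 \<longleftrightarrow> y \<notin> verts D"
    and P: "P = split_vertex (part D x A) x v1 v2" and P': "P' = split_vertex (part D y B) y w1 w2"
    and C: "C = insert_edge (insert_edge (graph_union P P') f w2 v1) f' v2 w1"
    using assms(6) unfolding join_cycles_def comp(1,2) by (elim exE conjE) (rule that)
  have dA: "dipath P v1 A v2" "verts P \<subseteq> {v1, v2} \<union> tail D ` set A"
    unfolding P using dipath_split_vertex[OF rep x, of v1 v2] v vx starts_at_verts[OF rep x] by auto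
  have dB: "dipath P' w1 B w2" "verts P' \<subseteq> {w1, w2} \<union> tail D ` set B"
    unfolding P' using dipath_split_vertex[OF rep' y, of w1 w2] v wy starts_at_verts[OF rep' y] by auto
  have vD: "verts D = tail D ` arcs D" using represents_verts[OF rep] .
  have sub: "tail D ` set A \<subseteq> verts D" "tail D ` set B \<subseteq> verts D"
    unfolding vD arcs by auto
  have "({v1, v2} \<union> tail D ` set A) \<inter> ({w1, w2} \<union> tail D ` set B) = {}"
    using disj v sub by auto
  then have vPP: "verts P \<inter> verts P' = {}" using dA(2) dB(2) by blast
  have AB: "set A \<inter> set B = {}" using dist by auto
  have "represents C [A @ [f'] @ B @ [f]]"
    unfolding C by (rule represents_join[OF dA(1) dB(1) AB vPP]) (use f arcs in auto)
  let ?K = "other_components D x y"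
  let ?L = "delete_part ?K (component (with_dummies D x y) y)"
  have K: "represents ?K (B # cs)" "verts ?K = verts D - insert x (tail D ` set A)"
    "tail ?K = tail D" "head ?K = head D"
    unfolding other_components_def comp(1) using represents_delete[OF rep x] by simp_all
  have yK: "starts_at ?K y B"
    using y K(2) trail_cong[of B ?K D y y] by (auto simp: starts_at_def K(3,4))
  have L: "represents ?L cs" "verts ?L = verts ?K - insert y (tail D ` set B)" "arcs ?L = set (concat cs)"
    using represents_delete[OF K(1) yK, of "part D y B"] unfolding comp(2) by (simp_all add: K(3))
  have vC: "verts C \<subseteq> {v1, v2, w1, w2} \<union> tail D ` set A \<union> tail D ` set B"
    using dA(2) dB(2) unfolding C by (auto simp: insert_edge_def graph_union_def)
  have "represents (graph_union ?L C) (cs @ [A @ [f'] @ B @ [f]])"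
  proof (rule represents_union[OF L(1)])
    show "represents C [A @ [f'] @ B @ [f]]" by fact
    have "arcs C = insert f' (insert f (set A \<union> set B))"
      using \<open>represents C _\<close> by (auto simp: represents_def)
    then show "arcs ?L \<inter> arcs C = {}" using L(3) f arcs dist by auto
    show "verts ?L \<inter> verts C = {}" using vC L(2) K(2) v by auto
  qed
  then show ?thesis by (rule represents_mset) simp
qed

section \<open>Cutting one cycle at two of its vertices\<close>

lemma split_vertices:
  assumes "represents D ((A @ B) # cs)" "A \<noteq> []" "B \<noteq> []" "trail D x A y" "trail D y B x"
  shows "starts_at D x (A @ B)" "x \<in> verts D" "y \<in> verts D" "x \<noteq> y" "same_component D x y"
    "component (with_dummies D x y) x = part D x (A @ B)"
    "\<And>e. e \<in> set (tl A) \<Longrightarrow> tail D e \<noteq> x \<and> tail D e \<noteq> y"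
    "\<And>e. e \<in> set (tl B) \<Longrightarrow> tail D e \<noteq> x \<and> tail D e \<noteq> y"
proof -
  show x: "starts_at D x (A @ B)" using assms by (auto simp: starts_at_def trail_append)
  have rep': "represents D ((B @ A) # cs)" by (rule represents_rotate[OF assms(1)])
  have y: "starts_at D y (B @ A)" using assms by (auto simp: starts_at_def trail_append)
  obtain a A' b B' where AB: "A = a # A'" "B = b # B'" using assms(2,3) by (meson neq_Nil_conv)
  then have ab: "tail D a = x" "tail D b = y" using assms(4,5) by auto
  have arcs: "set (A @ B) \<subseteq> arcs D" "distinct (A @ B)" using represents_prefix[OF assms(1)] .
  then show "x \<in> verts D" "y \<in> verts D"
    using represents_verts[OF assms(1)] ab AB by auto
  have inj: "tail D e \<noteq> tail D e'" if "e \<in> set (A @ B)" "e' \<in> set (A @ B)" "e \<noteq> e'" for e e'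
    using inj_onD[OF represents_inj[OF assms(1)], of e e'] that arcs(1) by blast
  \<comment> \<open>The first arcs of the two nonempty sides have different tails, so the splits
    below always concern two distinct vertices.\<close>
  show "x \<noteq> y" using inj[of a b] AB ab arcs(2) by auto
  show "tail D e \<noteq> x \<and> tail D e \<noteq> y" if "e \<in> set (tl A)" for e
    using inj[of e a] inj[of e b] that AB ab arcs(2) by auto
  show "tail D e \<noteq> x \<and> tail D e \<noteq> y" if "e \<in> set (tl B)" for e
    using inj[of e a] inj[of e b] that AB ab arcs(2) by auto
  show c: "component (with_dummies D x y) x = part D x (A @ B)"
    by (rule represents_component[OF assms(1) x]) auto
  have "component (with_dummies D x y) y = part D y (B @ A)"
    by (rule represents_component[OF rep' y]) auto
  moreover have "part D y (B @ A) = part D x (A @ B)" using AB ab by auto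
  ultimately show "same_component D x y" unfolding same_component_def by (simp only: c)
qed

lemma dipath_component:
  assumes "trail S a A b" "set A \<subseteq> arcs S" "insert b (tail S ` set A) \<subseteq> verts S"
    "distinct A" "inj_on (tail S) (set A)" "b \<notin> tail S ` set A"
    "trail S c B d" "arcs S = set A \<union> set B"
    "insert b (tail S ` set A) \<inter> insert d (tail S ` set B) = {}"
  shows "dipath (component S a) a A b" "verts (component S a) = insert b (tail S ` set A)"
proof -
  have c: "component S a = \<lparr>verts = insert b (tail S ` set A), arcs = set A, tail = tail S, head = head S\<rparr>"
  proof (rule component_trail[OF assms(1-3)])
    fix e assume "e \<in> arcs S" "e \<notin> set A"
    then have "e \<in> set B" using assms(8) by auto
    then have "tail S e \<in> insert d (tail S ` set B)" "head S e \<in> insert d (tail S ` set B)"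
      using trail_head_in[OF assms(7)] by auto
    then show "tail S e \<notin> insert b (tail S ` set A) \<and> head S e \<notin> insert b (tail S ` set A)"
      using assms(9) by blast
  qed
  then show "verts (component S a) = insert b (tail S ` set A)" by simp
  have "trail (component S a) a A b" using assms(1) trail_cong[of A "component S a" S a b] c by simp
  then show "dipath (component S a) a A b" unfolding dipath_def using assms(4-6) c by simp
qed

text \<open>Tails move to the source copies and heads to the sink copies, so after the two splits
  \<open>A\<close> runs from \<open>v1\<close> to \<open>w2\<close> and \<open>B\<close> from
  \<open>w1\<close> to \<open>v2\<close>. The new edges close exactly these two paths.\<close>

lemma cut_cycle_represents:
  assumes rep: "represents D ((A @ B) # cs)" and "A \<noteq> []" "B \<noteq> []" "trail D x A y" "trail D y B x"
    and new: "new_edges U D f f' l" and cut: "cut_cycle D x y f f' C1 C2"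
  shows "represents C1 [A @ [f]]" "represents C2 [B @ [f']]" "verts C1 \<inter> verts C2 = {}"
    "verts (other_components D x y) \<inter> (verts C1 \<union> verts C2) = {}"
    "represents (other_components D x y) cs" "arcs (other_components D x y) = set (concat cs)"
proof -
  note sv = split_vertices[OF rep assms(2-5)]
  have f: "f \<noteq> f'" "f \<notin> arcs D" "f' \<notin> arcs D" using new by (auto simp: new_edges_def)
  have arcs: "set (A @ B) \<subseteq> arcs D" "distinct (A @ B)" using represents_prefix[OF rep] .
  obtain v1 v2 w1 w2 S where S: "split_same D (part D x (A @ B)) x y v1 v2 w1 w2 S"
    and C: "C1 = insert_edge (component S v1) f w2 v1" "C2 = insert_edge (component S w1) f' v2 w1"
    using cut unfolding cut_cycle_def sv(6) by (elim exE conjE) (rule that)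
  then have fresh: "{v1, v2, w1, w2} \<inter> (verts D \<union> {x, y}) = {}" "distinct [v1, v2, w1, w2]"
    and S: "S = split_vertex (split_vertex (part D x (A @ B)) x v1 v2) y w1 w2"
    using sv(4) by (auto simp: split_same_def)
  let ?\<phi> = "\<lambda>t. if t = x then v1 else if t = y then w1 else t"
  let ?\<psi> = "\<lambda>t. if t = x then v2 else if t = y then w2 else t"
  have t: "tail S e = ?\<phi> (tail D e) \<and> head S e = ?\<psi> (head D e)" for e
    using fresh by (auto simp: S split_vertex_def)
  have arcsS: "arcs S = set A \<union> set B" by (simp add: S split_vertex_def)
  have tA: "trail S v1 A w2"
    using trail_map[OF assms(4,2), of S ?\<phi> ?\<psi>] t sv(4,7) by auto
  have tB: "trail S w1 B v2"
    using trail_map[OF assms(5,3), of S ?\<phi> ?\<psi>] t sv(4,8) by auto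
  obtain a A' b B' where AB: "A = a # A'" "B = b # B'" using assms(2,3) by (meson neq_Nil_conv)
  then have ab: "tail D a = x" "tail D b = y" using assms(4,5) by auto
  have sub: "tail D ` set (A @ B) \<subseteq> verts D" using represents_verts[OF rep] arcs(1) by auto
  have "tail S a = v1" "tail S b = w1" using t ab sv(4) by auto
  moreover have "tail S ` set A' = tail D ` set A'" "tail S ` set B' = tail D ` set B'"
    using t sv(7,8) AB by (auto intro!: image_cong)
  ultimately have im: "tail S ` set A = insert v1 (tail D ` set A')" "tail S ` set B = insert w1 (tail D ` set B')"
    using AB by simp_all
  have "inj_on ?\<phi> (verts D)" using fresh by (auto simp: inj_on_def)
  moreover have "inj_on (tail D) (set (A @ B))"
    using represents_inj[OF rep] arcs(1) by (rule inj_on_subset)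
  ultimately have "inj_on (?\<phi> \<circ> tail D) (set (A @ B))" using sub by (intro comp_inj_on) (auto intro: inj_on_subset)
  moreover have "tail S = ?\<phi> \<circ> tail D" using t by (intro ext) simp
  ultimately have inj: "inj_on (tail S) (set (A @ B))" by simp
  then have injA: "inj_on (tail S) (set A)" and injB: "inj_on (tail S) (set B)"
    by (auto intro: inj_on_subset)
  have "tail S ` set A \<inter> tail S ` set B = {}"
    using inj arcs(2) by (auto simp: inj_on_Un)
  moreover have "w2 \<notin> tail S ` set A" "w2 \<notin> tail S ` set B" "v2 \<notin> tail S ` set A" "v2 \<notin> tail S ` set B"
    unfolding im using fresh sub AB by auto
  ultimately have disj: "insert w2 (tail S ` set A) \<inter> insert v2 (tail S ` set B) = {}"
    using fresh(2) by auto
  have "verts S = ((insert x (tail D ` set (A @ B)) - {x}) \<union> {v1, v2} - {y}) \<union> {w1, w2}"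
    by (simp add: S split_vertex_def)
  moreover have "x \<notin> tail D ` set A'" "y \<notin> tail D ` set A'" "x \<notin> tail D ` set B'" "y \<notin> tail D ` set B'"
    using sv(7,8) AB by auto
  moreover have "v1 \<noteq> y" "v2 \<noteq> y" using fresh(1) by auto
  ultimately have vS: "insert w2 (tail S ` set A) \<subseteq> verts S" "insert v2 (tail S ` set B) \<subseteq> verts S"
    unfolding im using AB by auto
  have dA: "dipath (component S v1) v1 A w2" "verts (component S v1) = insert w2 (tail S ` set A)"
    by (rule dipath_component[OF tA _ vS(1) _ injA _ tB arcsS disj];
        use arcsS arcs(2) \<open>w2 \<notin> tail S ` set A\<close> in auto)+
  have disj': "insert v2 (tail S ` set B) \<inter> insert w2 (tail S ` set A) = {}" using disj by auto
  have arcsS': "arcs S = set B \<union> set A" using arcsS by auto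
  have dB: "dipath (component S w1) w1 B v2" "verts (component S w1) = insert v2 (tail S ` set B)"
    by (rule dipath_component[OF tB _ vS(2) _ injB _ tA arcsS' disj'];
        use arcsS arcs(2) \<open>v2 \<notin> tail S ` set B\<close> in auto)+
  show "represents C1 [A @ [f]]" unfolding C
    by (rule represents_insert_edge[OF dA(1)]) (use f arcs in auto)
  show "represents C2 [B @ [f']]" unfolding C
    by (rule represents_insert_edge[OF dB(1)]) (use f arcs in auto)
  have vC: "verts C1 = insert w2 (tail S ` set A)" "verts C2 = insert v2 (tail S ` set B)"
    unfolding C by (auto simp: insert_edge_def dA(2) dB(2) im)
  show "verts C1 \<inter> verts C2 = {}" unfolding vC by (rule disj)
  have O: "represents (other_components D x y) cs"
    "verts (other_components D x y) = verts D - insert x (tail D ` set (A @ B))"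
    "arcs (other_components D x y) = set (concat cs)"
    unfolding other_components_def sv(6) using represents_delete[OF rep sv(1)] by simp_all
  show "represents (other_components D x y) cs" "arcs (other_components D x y) = set (concat cs)" by fact+
  have "insert w2 (tail S ` set A) \<subseteq> {w2, v1} \<union> tail D ` set A" "insert v2 (tail S ` set B) \<subseteq> {v2, w1} \<union> tail D ` set B"
    unfolding im using AB by auto
  then show "verts (other_components D x y) \<inter> (verts C1 \<union> verts C2) = {}"
    unfolding O(2) vC using fresh(1) by auto
qed

section \<open>Contractions and isomorphisms\<close>

text \<open>The tail of the second arc moves to the tail of \<open>e\<close>, a place that is vacant
  because \<open>e\<close> disappears, so tails remain distinct. As \<open>c\<close> is nonempty,
  the component does not vanish.\<close>

lemma represents_contract_hd:
  assumes rep: "represents D ((e # c) # cs)" and c: "c \<noteq> []"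
  shows "represents (contract D e) (c # cs)"
proof -
  let ?K = "contract D e" and ?m = "\<lambda>x. if x = head D e then tail D e else x"
  let ?A = "arcs D - {e}"
  have K: "arcs ?K = ?A" "tail ?K = ?m \<circ> tail D" "head ?K = ?m \<circ> head D"
    "verts ?K = {x \<in> ?m ` verts D. \<exists>a\<in>?A. x = ?m (tail D a) \<or> x = ?m (head D a)}"
    by (simp_all add: contract_def Let_def)
  have arcs: "arcs D = insert e (set c \<union> set (concat cs))" using represents_arcs[OF rep] by simp
  have dist: "distinct (concat ((e # c) # cs))" using rep unfolding represents_def by blast
  then have A: "?A = set (concat (c # cs))" using arcs by auto
  obtain a where a: "trail D a (e # c) a"
    using rep unfolding represents_def by (meson list.set_intros(1))
  obtain e' c' where e': "c = e' # c'" using c by (meson neq_Nil_conv)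
  have te: "tail D e = a" "tail D e' = head D e" and tr: "trail D (head D e) c a" using a e' by auto
  have ee: "e' \<in> ?A" "e' \<noteq> e" using A e' dist by auto
  have inj: "inj_on (tail D) (arcs D)" using represents_inj[OF rep] .
  have na: "tail D x \<noteq> tail D e" if "x \<in> ?A" for x
    using inj_onD[OF inj, of x e] that arcs by auto
  have "inj_on ?m (verts D - {tail D e})" by (auto simp: inj_on_def)
  moreover have "tail D ` ?A \<subseteq> verts D - {tail D e}"
    using na represents_verts[OF rep] by auto
  ultimately have "inj_on (?m \<circ> tail D) ?A"
    using inj by (intro comp_inj_on) (auto intro: inj_on_subset)
  then have injK: "inj_on (tail ?K) (arcs ?K)" unfolding K .
  have tail_next: "\<exists>x\<in>?A. ?m (tail D x) = ?m v" if v: "v \<in> verts D" for v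
  proof -
    obtain x where x: "x \<in> arcs D" "v = tail D x" using v represents_verts[OF rep] by auto
    show ?thesis
    proof (cases "x = e")
      case True
      then have "?m (tail D e') = ?m v" using x te by simp
      then show ?thesis using ee by blast
    next
      case False
      then show ?thesis using x by blast
    qed
  qed
  have verts: "verts ?K = tail ?K ` arcs ?K"
  proof
    show "verts ?K \<subseteq> tail ?K ` arcs ?K"
    proof
      fix x assume "x \<in> verts ?K"
      then obtain v where "v \<in> verts D" "x = ?m v" unfolding K(4) by blast
      then obtain y where "y \<in> ?A" "?m (tail D y) = x" using tail_next[of v] by metis
      then show "x \<in> tail ?K ` arcs ?K" unfolding K(1,2) comp_def by blast
    qed
    show "tail ?K ` arcs ?K \<subseteq> verts ?K"
    proof (rule image_subsetI)
      fix x assume x: "x \<in> arcs ?K"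
      then have "tail D x \<in> verts D" using represents_verts[OF rep] K(1) by auto
      then show "tail ?K x \<in> verts ?K" using x unfolding K by auto
    qed
  qed
  have map: "trail ?K (?m u) d (?m v)" if "trail D u d v" for u d v
  proof (cases "d = []")
    case False
    then show ?thesis
      using trail_map[OF that, of ?K ?m ?m] by (simp add: K(2,3))
  qed (use that in simp)
  have "\<exists>a. trail ?K a d a" if d: "d \<in> set (c # cs)" for d
  proof -
    consider "d = c" | "d \<in> set cs" using d by auto
    then show ?thesis
    proof cases
      case 1
      have "trail ?K (?m (head D e)) c (?m a)" using map[OF tr] .
      then have "trail ?K a c a" using te by (simp split: if_splits)
      then show ?thesis using 1 by blast
    next
      case 2
      then obtain b where "trail D b d b" using rep unfolding represents_def by auto
      then show ?thesis using map by blast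
    qed
  qed
  moreover have "distinct (concat (c # cs))" using dist by simp
  ultimately show ?thesis unfolding represents_def using injK verts K(1) A by blast
qed

lemma represents_contract:
  assumes "represents D ((X @ e # Y) # cs)" "X @ Y \<noteq> []"
  shows "represents (contract D e) ((X @ Y) # cs)" "contraction D (contract D e)"
proof -
  have 1: "represents D ((e # Y @ X) # cs)" using represents_rotate[OF assms(1)] by simp
  have "Y @ X \<noteq> []" using assms(2) by auto
  then have "represents (contract D e) ((Y @ X) # cs)" by (rule represents_contract_hd[OF 1])
  then show "represents (contract D e) ((X @ Y) # cs)" by (rule represents_rotate)
  have "e \<in> arcs D" using represents_prefix(1)[OF assms(1)] by simp
  then show "contraction D (contract D e)" unfolding contraction_def by blast
qed

lemma contract_to_edge:
  assumes "represents D ((A @ B) # cs)" "e \<in> set B"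
  shows "\<exists>D'. contraction\<^sup>*\<^sup>* D D' \<and> represents D' ((A @ [e]) # cs)"
  using assms
proof (induction "length B" arbitrary: B D rule: less_induct)
  case less
  show ?case
  proof (cases "\<exists>e'\<in>set B. e' \<noteq> e")
    case True
    then obtain e' X Y where B: "B = X @ e' # Y" "e' \<noteq> e" by (meson split_list)
    then have e: "e \<in> set (X @ Y)" using less.prems(2) by auto
    then have "(A @ X) @ Y \<noteq> []" by auto
    then have r: "represents (contract D e') (((A @ X) @ Y) # cs)" and step: "contraction D (contract D e')"
      using represents_contract[of D "A @ X" e' Y cs] less.prems(1) B by simp_all
    from r obtain D' where D': "contraction\<^sup>*\<^sup>* (contract D e') D'" "represents D' ((A @ [e]) # cs)"
      using less.hyps[of "X @ Y" "contract D e'"] B e by auto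
    show ?thesis
      by (rule exI[of _ D'], rule conjI[OF converse_rtranclp_into_rtranclp[of contraction, OF step D'(1)] D'(2)])
  next
    case False
    then have "set B = {e}" using less.prems(2) by blast
    moreover have "distinct B" using represents_prefix(2)[OF less.prems(1)] by simp
    ultimately have "B = [e]" by (cases B; cases "tl B") auto
    then show ?thesis using less.prems(1) by blast
  qed
qed

text \<open>The successor \<open>e'\<close> depends only on the position of \<open>e\<close> in the
  cyclic list, so one choice is correct in every renamed copy of the cycle. This is how an
  isomorphism is checked on heads.\<close>

lemma next_arc:
  assumes "trail D b c b" "e \<in> set c"
  shows "\<exists>e'\<in>set c. head D e = tail D e' \<and>
    (\<forall>D' b' \<phi>. trail D' b' (map \<phi> c) b' \<longrightarrow> head D' (\<phi> e) = tail D' (\<phi> e'))"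
proof -
  obtain X Y where c: "c = X @ e # Y" using assms(2) by (meson split_list)
  show ?thesis
  proof (cases Y)
    case (Cons e' Y')
    then show ?thesis using assms(1) c by (intro bexI[of _ e']) (auto simp: trail_append)
  next
    case Nil
    have fin: "head D' (\<phi> e) = b'" if "trail D' b' (map \<phi> c) b'" for D' b' and \<phi> :: "nat \<Rightarrow> nat"
      using that c Nil by (auto simp: trail_append)
    have start: "tail D' (\<phi> (hd c)) = b'" if "trail D' b' (map \<phi> c) b'" for D' b' and \<phi> :: "nat \<Rightarrow> nat"
      using that assms(2) by (cases c) auto
    have "hd c \<in> set c" using assms(2) by (cases c) auto
    moreover have "head D e = tail D (hd c)"
      using fin[of D b id] start[of D b id] assms(1) by simp
    ultimately show ?thesis using fin start by metis
  qed
qed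

lemma represents_iso:
  assumes D: "represents D cs" and D': "represents D' (map (map \<phi>) cs)" and \<phi>: "inj_on \<phi> (arcs D)"
  shows "\<exists>h. pre_digraph.digraph_isomorphism D h \<and> D' = app_iso h D \<and> iso_arcs h = \<phi>"
proof -
  \<comment> \<open>Every vertex is the tail of exactly one arc, so the map on arcs determines the
    map on vertices.\<close>
  let ?V = "\<lambda>x. tail D' (\<phi> (the_inv_into (arcs D) (tail D) x))"
  \<comment> \<open>The equation \<open>D' = app_iso h D\<close> compares total functions, so the
    tail and head fields are taken from \<open>D'\<close> also outside its arcs.\<close>
  let ?h = "\<lparr>iso_verts = ?V, iso_arcs = \<phi>, iso_head = head D', iso_tail = tail D'\<rparr>"
  note inj = represents_inj[OF D] and verts = represents_verts[OF D]
  have arcs': "arcs D' = \<phi> ` arcs D" unfolding represents_arcs[OF D] represents_arcs[OF D'] by auto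
  have V: "?V (tail D a) = tail D' (\<phi> a)" if "a \<in> arcs D" for a
    using that inj by (simp add: the_inv_into_f_f)
  have hd: "?V (head D a) = head D' (\<phi> a)" if a: "a \<in> arcs D" for a
  proof -
    obtain c where c: "c \<in> set cs" "a \<in> set c" using a unfolding represents_arcs[OF D] by auto
    obtain b where b: "trail D b c b" using D c(1) unfolding represents_def by blast
    obtain b' where b': "trail D' b' (map \<phi> c) b'" using D' c(1) unfolding represents_def by auto
    obtain a' where a': "a' \<in> set c" "head D a = tail D a'" "head D' (\<phi> a) = tail D' (\<phi> a')"
      using next_arc[OF b c(2)] b' by blast
    then have "a' \<in> arcs D" using c(1) unfolding represents_arcs[OF D] by auto
    then show ?thesis using V a' by simp
  qed
  have inv: "inj_on ?V (verts D)"
  proof (rule inj_onI)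
    fix x y assume "x \<in> verts D" "y \<in> verts D" and eq: "?V x = ?V y"
    then obtain a b where ab: "a \<in> arcs D" "b \<in> arcs D" "x = tail D a" "y = tail D b" unfolding verts by auto
    then have "tail D' (\<phi> a) = tail D' (\<phi> b)" using eq V by simp
    moreover have "\<phi> a \<in> arcs D'" "\<phi> b \<in> arcs D'" using ab arcs' by auto
    ultimately have "\<phi> a = \<phi> b" using inj_onD[OF represents_inj[OF D']] by blast
    then show "x = y" using ab inj_onD[OF \<phi>] by blast
  qed
  have "wf_digraph D"
    by unfold_locales (use verts represents_head[OF D] in auto)
  then have "pre_digraph.digraph_isomorphism D ?h"
    unfolding pre_digraph.digraph_isomorphism_def using inv \<phi> V hd by simp
  moreover have "?V ` verts D = verts D'"
  proof -
    have "?V ` verts D = (\<lambda>a. tail D' (\<phi> a)) ` arcs D" unfolding verts image_image using V by (intro image_cong) auto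
    then show ?thesis unfolding represents_verts[OF D'] arcs' image_image .
  qed
  then have "D' = app_iso ?h D" unfolding app_iso_def using arcs' by simp
  ultimately show ?thesis by (intro exI[of _ ?h]) simp
qed

lemma bij_betw_rename:
  assumes "l \<notin> S" "k \<notin> S"
  shows "bij_betw (id(l := k)) (insert l S) (insert k S)"
proof (rule bij_betwI[of _ _ _ "id(k := l)"])
  show "id(l := k) \<in> insert l S \<rightarrow> insert k S" "id(k := l) \<in> insert k S \<rightarrow> insert l S" by auto
  show "(id(k := l)) ((id(l := k)) x) = x" if "x \<in> insert l S" for x using that assms by auto
  show "(id(l := k)) ((id(k := l)) x) = x" if "x \<in> insert k S" for x using that assms by auto
qed

text \<open>Contracting all of \<open>B\<close> except \<open>e\<close> produces the graph that
  remains when \<open>B\<close> is dropped, with \<open>e\<close> in the place of the new edge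
  \<open>f\<close>. The label of \<open>e\<close> occurs nowhere outside \<open>B\<close>, and
  \<open>l\<close> is new, so exchanging one for the other is a bijection of the labels in
  use.\<close>

lemma drop_internal_illegal:
  assumes D: "represents D ((A @ B) # cs)" and D1: "represents D1 ((A @ [f]) # cs)"
    and e: "e \<in> set B" "\<And>a. a \<in> arcs D \<Longrightarrow> a \<notin> set B \<Longrightarrow> \<chi> a \<noteq> \<chi> e"
    and f: "f \<notin> arcs D" "\<chi>1 f = l" "l \<notin> \<chi> ` arcs D" "\<And>a. a \<in> arcs D \<Longrightarrow> \<chi>1 a = \<chi> a"
  shows "\<exists>\<rho>. reduction \<rho> (D, \<chi>, g) \<and> equivalent (D1, \<chi>1, g) \<rho>"
proof -
  obtain D' where D': "contraction\<^sup>*\<^sup>* D D'" "represents D' ((A @ [e]) # cs)"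
    using contract_to_edge[OF D e(1)] by blast
  let ?\<phi> = "id(f := e)" and ?\<pi> = "id(l := \<chi> e)"
  have arcs: "arcs D = set A \<union> set B \<union> set (concat cs)"
    using represents_arcs[OF D] by (simp add: Un_assoc)
  have dist: "distinct (concat ((A @ B) # cs))" using D unfolding represents_def by blast
  let ?R = "set A \<union> set (concat cs)"
  have arcs1: "arcs D1 = insert f ?R" using represents_arcs[OF D1] by simp
  have arcs': "arcs D' = insert e ?R" using represents_arcs[OF D'(2)] by simp
  have R: "?R \<subseteq> arcs D" "?R \<inter> set B = {}" "f \<notin> ?R" using arcs f(1) dist by auto
  have map_id: "map ?\<phi> c = c" if "set c \<subseteq> ?R" for c
    using that R(3) by (intro map_idI) auto
  have "map (map ?\<phi>) cs = cs" by (intro map_idI map_id) auto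
  moreover have "map ?\<phi> A = A" by (rule map_id) auto
  ultimately have "map (map ?\<phi>) ((A @ [f]) # cs) = (A @ [e]) # cs" by simp
  moreover have "e \<notin> ?R" using R(2) e(1) by blast
  then have "inj_on ?\<phi> (arcs D1)" unfolding arcs1 using R(3) by (auto simp: inj_on_def)
  ultimately obtain h where h: "pre_digraph.digraph_isomorphism D1 h" "D' = app_iso h D1" "iso_arcs h = ?\<phi>"
    using represents_iso[OF D1, of D' ?\<phi>] D'(2) by auto
  have eD: "e \<in> arcs D" using e(1) arcs by auto
  have \<chi>R: "\<chi>1 a = \<chi> a \<and> \<chi> a \<noteq> \<chi> e \<and> \<chi> a \<noteq> l" if "a \<in> ?R" for a
  proof -
    have "a \<in> arcs D" "a \<notin> set B" using R that by blast+
    then show ?thesis using e(2)[of a] f(3) f(4)[of a] by auto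
  qed
  have "\<chi>1 ` ?R = \<chi> ` ?R" using \<chi>R by (intro image_cong) auto
  then have img: "\<chi>1 ` arcs D1 = insert l (\<chi> ` ?R)" "\<chi> ` arcs D' = insert (\<chi> e) (\<chi> ` ?R)"
    unfolding arcs1 arcs' using f(2) by simp_all
  have lR: "l \<notin> \<chi> ` ?R" "\<chi> e \<notin> \<chi> ` ?R" using \<chi>R by (metis imageE)+
  have "bij_betw ?\<pi> (\<chi>1 ` arcs D1) (\<chi> ` arcs D')"
    unfolding img by (rule bij_betw_rename[OF lR])
  moreover have "\<chi> (iso_arcs h a) = ?\<pi> (\<chi>1 a)" if a: "a \<in> arcs D1" for a
  proof (cases "a = f")
    case True
    then show ?thesis using f(2) h(3) by simp
  next
    case False
    then have "a \<in> ?R" using a arcs1 by blast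
    then show ?thesis using \<chi>R[of a] False h(3) by simp
  qed
  ultimately have "equivalent (D1, \<chi>1, g) (D', \<chi>, g)"
    unfolding equivalent.simps using h(1,2) by blast
  moreover have "reduction (D', \<chi>, g) (D, \<chi>, g)" using D'(1) by simp
  ultimately show ?thesis by blast
qed

section \<open>Cutter's moves on words\<close>

text \<open>Words consist of numbers while the labels of the game have an arbitrary type. The
  injection \<open>h\<close> names the labels in use, and this leaves Cutter free in the choice of
  new labels. Empty entries, the placeholders of dummies, are excluded.\<close>

definition encodes :: "dgraph \<Rightarrow> (nat \<Rightarrow> 'l) \<Rightarrow> nat list multiset \<Rightarrow> bool" where
  "encodes D \<chi> W \<longleftrightarrow> (\<exists>cs h. represents D cs \<and> [] \<notin> set cs \<and> inj_on h (\<chi> ` arcs D) \<and>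
     W = mset (map (map (h \<circ> \<chi>)) cs))"

lemma labs_words:
  assumes "represents D cs"
  shows "labs (mset (map (map k) cs)) = k ` arcs D"
  unfolding represents_arcs[OF assms] by (auto simp: labs_def)

lemma mset_map_add:
  assumes "add_mset w M = mset (map F cs)"
  obtains c cs' where "mset cs = mset (c # cs')" "F c = w" "M = mset (map F cs')"
proof -
  have "w \<in># mset (map F cs)" using assms by (metis union_single_eq_member)
  then obtain c where c: "c \<in> set cs" "F c = w" by auto
  then have 1: "mset cs = mset (c # remove1 c cs)" by simp
  then have "mset (map F cs) = add_mset w (mset (map F (remove1 c cs)))"
    using c(2) by (metis list.simps(9) mset.simps(2) mset_map)
  then show ?thesis using that[OF 1 c(2)] assms by simp
qed

lemma encodes_cycle:
  assumes "encodes D \<chi> (add_mset w M)"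
  obtains c cs h where "represents D (c # cs)" "c \<noteq> []" "[] \<notin> set cs" "inj_on h (\<chi> ` arcs D)"
    "w = map (h \<circ> \<chi>) c" "M = mset (map (map (h \<circ> \<chi>)) cs)"
proof -
  obtain cs h where cs: "represents D cs" "[] \<notin> set cs" "inj_on h (\<chi> ` arcs D)"
    "add_mset w M = mset (map (map (h \<circ> \<chi>)) cs)"
    using assms unfolding encodes_def by blast
  obtain c cs' where c: "mset cs = mset (c # cs')" "map (h \<circ> \<chi>) c = w" "M = mset (map (map (h \<circ> \<chi>)) cs')"
    using mset_map_add[OF cs(4)] by metis
  have "set cs = set (c # cs')" using c(1) by (metis set_mset_mset)
  then show ?thesis using that[of c cs' h] represents_mset[OF cs(1) c(1)] cs(2,3) c by auto
qed

lemma encodesI: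
  "represents D cs \<Longrightarrow> [] \<notin> set cs \<Longrightarrow> inj_on h (\<chi> ` arcs D) \<Longrightarrow>
   W = mset (map (map (h \<circ> \<chi>)) cs) \<Longrightarrow> encodes D \<chi> W"
  unfolding encodes_def by blast

lemma encodes_rotate:
  assumes "encodes D \<chi> (add_mset (u @ v) M)"
  shows "encodes D \<chi> (add_mset (v @ u) M)"
proof -
  obtain c cs h where c: "represents D (c # cs)" "c \<noteq> []" "[] \<notin> set cs" "inj_on h (\<chi> ` arcs D)"
    "u @ v = map (h \<circ> \<chi>) c" "M = mset (map (map (h \<circ> \<chi>)) cs)"
    using encodes_cycle[OF assms] by metis
  obtain c1 c2 where c12: "c = c1 @ c2" "u = map (h \<circ> \<chi>) c1" "v = map (h \<circ> \<chi>) c2"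
    using c(5) by (metis append_eq_map_conv)
  show ?thesis
    by (rule encodesI[OF represents_rotate[of D c1 c2 cs], of h]) (use c c12 in auto)
qed

lemma encodes_relabel:
  assumes "encodes D \<chi> (image_mset (map \<pi>) W)" "inj_on \<pi> (labs W)"
  shows "encodes D \<chi> W"
proof -
  obtain cs h where cs: "represents D cs" "[] \<notin> set cs" "inj_on h (\<chi> ` arcs D)"
    "image_mset (map \<pi>) W = mset (map (map (h \<circ> \<chi>)) cs)"
    using assms(1) unfolding encodes_def by blast
  let ?i = "inv_into (labs W) \<pi>"
  have "labs (image_mset (map \<pi>) W) = \<pi> ` labs W" by (auto simp: labs_def)
  then have im: "h ` \<chi> ` arcs D = \<pi> ` labs W"
    using labs_words[OF cs(1), of "h \<circ> \<chi>"] cs(4) by (simp add: image_comp)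
  have "map ?i (map \<pi> w) = w" if "w \<in># W" for w
    using that assms(2) by (auto intro!: map_idI simp: in_labs)
  then have "image_mset (map ?i) (image_mset (map \<pi>) W) = image_mset id W"
    unfolding multiset.map_comp by (intro image_mset_cong) auto
  then have "W = image_mset (map ?i) (mset (map (map (h \<circ> \<chi>)) cs))" using cs(4) by simp
  then have "W = mset (map (map ((?i \<circ> h) \<circ> \<chi>)) cs)"
    by (simp add: multiset.map_comp comp_def)
  moreover have "inj_on (?i \<circ> h) (\<chi> ` arcs D)"
    using cs(3) by (rule comp_inj_on) (simp add: im inj_on_inv_into)
  ultimately show ?thesis using cs(1,2) by (intro encodesI)
qed

text \<open>Whatever new label \<open>l\<close> Cutter picks, it receives the number
  \<open>m\<close> that the analysis of words has prepared for it.\<close>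

lemma encodes_new:
  assumes D: "represents D cs" and h: "inj_on h (\<chi> ` arcs D)"
    and D': "represents D' cs'" "[] \<notin> set cs'" "arcs D' \<subseteq> arcs D \<union> {f, f'}"
    and new: "l \<notin> \<chi> ` arcs D" "m \<notin> (h \<circ> \<chi>) ` arcs D"
    and \<chi>': "\<chi>' = \<chi>(f := l, f' := l)" and h': "h' = h(l := m)"
  shows "encodes D' \<chi>' (mset (map (map (h' \<circ> \<chi>')) cs'))"
    "card (\<chi>' ` arcs D') \<le> Suc (card (\<chi> ` arcs D))"
proof -
  have sub: "\<chi>' ` arcs D' \<subseteq> insert l (\<chi> ` arcs D)" using D'(3) unfolding \<chi>' by auto
  have "inj_on h' (\<chi> ` arcs D)"
    using h new(1) unfolding h' by (metis fun_upd_idem_iff inj_on_fun_updI inj_on_cong fun_upd_other)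
  moreover have "h' l \<notin> h' ` (\<chi> ` arcs D)" using new unfolding h' by auto
  ultimately have "inj_on h' (insert l (\<chi> ` arcs D))" using new(1) by (simp add: inj_on_insert)
  then have "inj_on h' (\<chi>' ` arcs D')" using sub by (rule inj_on_subset)
  then show "encodes D' \<chi>' (mset (map (map (h' \<circ> \<chi>')) cs'))" using D' by (intro encodesI) auto
  have "finite (\<chi> ` arcs D)" unfolding represents_arcs[OF D] by simp
  then have "card (\<chi>' ` arcs D') \<le> card (insert l (\<chi> ` arcs D))" using sub by (intro card_mono) auto
  also have "\<dots> \<le> Suc (card (\<chi> ` arcs D))" using \<open>finite _\<close> by (simp add: card_insert_if)
  finally show "card (\<chi>' ` arcs D') \<le> Suc (card (\<chi> ` arcs D))" .
qed

lemma relabel_old: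
  assumes "set c \<subseteq> arcs D" "f \<notin> arcs D" "f' \<notin> arcs D" "l \<notin> \<chi> ` arcs D"
  shows "map (h(l := m) \<circ> \<chi>(f := l, f' := l)) c = map (h \<circ> \<chi>) c"
  using assms by (intro map_cong) auto

section \<open>Outcomes of joins and cuts\<close>

lemma join_outcome:
  assumes rep: "represents D (A # B # cs)" and ne: "[] \<notin> set cs"
    and x: "starts_at D x A" and y: "starts_at D y B" and xy: "A = [] \<longrightarrow> B = [] \<longrightarrow> x \<noteq> y"
    and h: "inj_on h (\<chi> ` arcs D)" and m: "m \<notin> (h \<circ> \<chi>) ` arcs D" and U: "\<chi> ` arcs D \<subseteq> U"
    and move: "cutter_move U (D, \<chi>, g) x y Db gb \<gamma>'"
  shows "\<exists>D' \<chi>'. \<gamma>' = (D', \<chi>', g) \<and>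
    encodes D' \<chi>' (add_mset (map (h \<circ> \<chi>) A @ [m] @ map (h \<circ> \<chi>) B @ [m]) (mset (map (map (h \<circ> \<chi>)) cs))) \<and>
    card (\<chi>' ` arcs D') \<le> Suc (card (\<chi> ` arcs D))"
  using move
proof cases
  case (move_d f f' l C)
  let ?D = "graph_union (delete_part (other_components D x y) (component (with_dummies D x y) y)) C"
  let ?\<chi> = "\<chi>(f := l, f' := l)"
  have f: "f \<noteq> f'" "f \<notin> arcs D" "f' \<notin> arcs D" and l: "l \<notin> \<chi> ` arcs D"
    using move_d(3) U by (auto simp: new_edges_def)
  have D': "represents ?D ((A @ [f'] @ B @ [f]) # cs)"
    by (rule represents_join_cycles[OF rep x y xy move_d(3,4)])
  have arcs: "set A \<subseteq> arcs D" "set B \<subseteq> arcs D" "\<And>c. c \<in> set cs \<Longrightarrow> set c \<subseteq> arcs D"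
    unfolding represents_arcs[OF rep] by auto
  have "arcs ?D \<subseteq> arcs D \<union> {f, f'}" unfolding represents_arcs[OF D'] represents_arcs[OF rep] by auto
  note enc = encodes_new[OF rep h D' _ this l m refl refl]
  have old: "map (h(l := m) \<circ> ?\<chi>) c = map (h \<circ> \<chi>) c" if "set c \<subseteq> arcs D" for c
    by (rule relabel_old[OF that f(2,3) l])
  have "mset (map (map (h(l := m) \<circ> ?\<chi>)) ((A @ [f'] @ B @ [f]) # cs)) =
      add_mset (map (h \<circ> \<chi>) A @ [m] @ map (h \<circ> \<chi>) B @ [m]) (mset (map (map (h \<circ> \<chi>)) cs))"
  proof -
    have "map (map (h(l := m) \<circ> ?\<chi>)) cs = map (map (h \<circ> \<chi>)) cs"
      by (intro map_cong refl old arcs(3))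
    moreover have "map (h(l := m) \<circ> ?\<chi>) (A @ [f'] @ B @ [f]) = map (h \<circ> \<chi>) A @ [m] @ map (h \<circ> \<chi>) B @ [m]"
      unfolding map_append old[OF arcs(1)] old[OF arcs(2)] by simp
    ultimately show ?thesis by (simp only: list.map mset.simps)
  qed
  then have "encodes ?D ?\<chi> (add_mset (map (h \<circ> \<chi>) A @ [m] @ map (h \<circ> \<chi>) B @ [m]) (mset (map (map (h \<circ> \<chi>)) cs)))"
    using enc(1) ne by simp
  moreover have "card (?\<chi> ` arcs ?D) \<le> Suc (card (\<chi> ` arcs D))" using enc(2) ne by simp
  ultimately show ?thesis using move_d(1) by blast
qed (use join_components(3)[OF rep x y xy] in auto)

text \<open>An anchor of the word of \<open>B\<close> is the name of the label of some arc
  \<open>e\<close> in \<open>B\<close>. As \<open>B\<close> accounts for all occurrences of this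
  name, no other arc carries that label.\<close>

lemma active_part:
  assumes "represents D ((A @ B) # cs)"
    "active W (map (h \<circ> \<chi>) B)" "\<And>v. tot W v = tot (mset (map (map (h \<circ> \<chi>)) ((A @ B) # cs))) v"
  shows "\<exists>e\<in>set B. \<forall>a\<in>arcs D. a \<notin> set B \<longrightarrow> \<chi> a \<noteq> \<chi> e"
proof -
  let ?k = "h \<circ> \<chi>"
  obtain v where v: "v \<in> set (map ?k B)"
    "count_list (map ?k B) v = tot (mset (map (map ?k) ((A @ B) # cs))) v"
    using assms(2) unfolding active_def anchor_def assms(3) by blast
  obtain e where e: "e \<in> set B" "v = ?k e" using v(1) by auto
  have "tot (add_mset (map ?k A) (mset (map (map ?k) cs))) v = 0" using v(2) by simp
  then have "v \<notin> labs (add_mset (map ?k A) (mset (map (map ?k) cs)))" unfolding tot_eq_0_iff .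
  then have out: "?k a \<noteq> v" if "a \<in> set A \<union> set (concat cs)" for a
    using that by (auto simp: labs_def)
  have "\<chi> a \<noteq> \<chi> e" if "a \<in> arcs D" "a \<notin> set B" for a
  proof -
    have "a \<in> set A \<union> set (concat cs)" using that unfolding represents_arcs[OF assms(1)] by auto
    then show ?thesis using out[of a] e(2) by auto
  qed
  then show ?thesis using e(1) by blast
qed

lemma split_outcome:
  assumes rep: "represents D ((A @ B) # cs)" and ne: "[] \<notin> set cs" and AB: "A \<noteq> []" "B \<noteq> []"
    and tr: "trail D x A y" "trail D y B x"
    and h: "inj_on h (\<chi> ` arcs D)" and m: "m \<notin> (h \<circ> \<chi>) ` arcs D" and U: "\<chi> ` arcs D \<subseteq> U"
    and move: "cutter_move U (D, \<chi>, g) x y (other_components D x y) g \<gamma>'"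
    and legal: "\<not> (\<exists>\<rho>. reduction \<rho> (D, \<chi>, g) \<and> equivalent \<gamma>' \<rho>)"
  defines "F \<equiv> map (h \<circ> \<chi>)" and "W \<equiv> mset (map (map (h \<circ> \<chi>)) ((A @ B) # cs))"
  shows "\<exists>D' \<chi>' g' W'. \<gamma>' = (D', \<chi>', g') \<and> encodes D' \<chi>' W' \<and>
    card (\<chi>' ` arcs D') \<le> Suc (card (\<chi> ` arcs D)) \<and>
    (1 \<le> g \<and> g' = g - 1 \<and> W' = add_mset (F A @ [m]) (add_mset (F B @ [m]) (mset (map F cs))) \<or>
     g' = g \<and> \<not> active W (F B) \<and> W' = add_mset (F A @ [m]) (mset (map F cs)) \<or>
     g' = g \<and> \<not> active W (F A) \<and> W' = add_mset (F B @ [m]) (mset (map F cs)))"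
proof -
  have rep': "represents D ((B @ A) # cs)" by (rule represents_rotate[OF rep])
  have arcs: "set A \<subseteq> arcs D" "set B \<subseteq> arcs D" "\<And>c. c \<in> set cs \<Longrightarrow> set c \<subseteq> arcs D"
    unfolding represents_arcs[OF rep] by auto
  have dist: "distinct (concat ((A @ B) # cs))" using rep unfolding represents_def by blast
  have sep: "set (concat cs) \<inter> (set A \<union> set B) = {}" "set (concat cs) \<subseteq> arcs D" "set A \<inter> set B = {}"
    using dist unfolding represents_arcs[OF rep] by auto
  let ?O = "other_components D x y"
  \<comment> \<open>The moves (a), (b), (c) differ only in the new cycles \<open>ds\<close> that are
    added to the untouched ones, so they are treated together. If a drop removed an active side,
    \<open>drop_internal_illegal\<close> would contradict \<open>legal\<close>.\<close>
  have glue: ?thesis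
    if f: "new_edges U D f f' l" and \<gamma>': "\<gamma>' = (D', \<chi>(f := l, f' := l), g')"
      and D': "represents D' (cs @ ds)" "ds = [A @ [f], B @ [f']] \<and> 1 \<le> g \<and> g' = g - 1 \<or>
        ds = [A @ [f]] \<and> g' = g \<or> ds = [B @ [f']] \<and> g' = g"
    for f f' l D' g' ds
  proof -
    let ?\<chi> = "\<chi>(f := l, f' := l)" and ?F = "map (h(l := m) \<circ> \<chi>(f := l, f' := l))"
    have f: "f \<notin> arcs D" "f' \<notin> arcs D" "l \<notin> \<chi> ` arcs D" "f \<noteq> f'" using f U by (auto simp: new_edges_def)
    have sub: "arcs D' \<subseteq> arcs D \<union> {f, f'}"
      unfolding represents_arcs[OF D'(1)] represents_arcs[OF rep] using D'(2) by auto
    have ne': "[] \<notin> set (cs @ ds)" using ne D'(2) by auto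
    note enc = encodes_new[OF rep h D'(1) ne' sub f(3) m refl refl]
    have old: "?F c = F c" if "set c \<subseteq> arcs D" for c
      unfolding F_def by (rule relabel_old[OF that f(1-3)])
    have Fcs: "map ?F cs = map F cs" by (intro map_cong refl old arcs(3))
    have FA: "?F (A @ [f]) = F A @ [m]" and FB: "?F (B @ [f']) = F B @ [m]"
      unfolding map_append old[OF arcs(1)] old[OF arcs(2)] by simp_all
    have words: "mset (map ?F (cs @ ds)) = mset (map F cs) + mset (map ?F ds)"
      by (simp only: map_append mset_append Fcs)
    have old_lab: "?\<chi> a = \<chi> a" if "a \<in> arcs D" for a using that f by auto
    have notB: "\<not> active W (F B)" if ds: "ds = [A @ [f]]" "g' = g"
    proof
      assume "active W (F B)"
      then obtain e where e: "e \<in> set B" "\<And>a. a \<in> arcs D \<Longrightarrow> a \<notin> set B \<Longrightarrow> \<chi> a \<noteq> \<chi> e"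
        using active_part[OF rep, of W h \<chi>] unfolding F_def W_def by blast
      have "represents D' ((A @ [f]) # cs)" using represents_mset[OF D'(1)] ds by simp
      then show False
        using drop_internal_illegal[OF rep _ e f(1) _ f(3) old_lab, of D' g] legal \<gamma>' ds f(4) by auto
    qed
    have notA: "\<not> active W (F A)" if ds: "ds = [B @ [f']]" "g' = g"
    proof
      assume "active W (F A)"
      moreover have "tot W v = tot (mset (map (map (h \<circ> \<chi>)) ((B @ A) # cs))) v" for v
        unfolding W_def by simp
      ultimately obtain e where e: "e \<in> set A" "\<And>a. a \<in> arcs D \<Longrightarrow> a \<notin> set A \<Longrightarrow> \<chi> a \<noteq> \<chi> e"
        using active_part[OF rep', of W h \<chi>] unfolding F_def by blast
      have "represents D' ((B @ [f']) # cs)" using represents_mset[OF D'(1)] ds by simp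
      then show False
        using drop_internal_illegal[OF rep' _ e f(2) _ f(3) old_lab, of D' g] legal \<gamma>' ds by auto
    qed
    have "W' = mset (map ?F (cs @ ds)) \<Longrightarrow> ?thesis" if "1 \<le> g \<and> g' = g - 1 \<and> W' = add_mset (F A @ [m]) (add_mset (F B @ [m]) (mset (map F cs))) \<or>
     g' = g \<and> \<not> active W (F B) \<and> W' = add_mset (F A @ [m]) (mset (map F cs)) \<or>
     g' = g \<and> \<not> active W (F A) \<and> W' = add_mset (F B @ [m]) (mset (map F cs))" for W'
      using that enc \<gamma>' by blast
    moreover consider (a) "ds = [A @ [f], B @ [f']]" "1 \<le> g" "g' = g - 1" | (b) "ds = [A @ [f]]" "g' = g"
      | (c) "ds = [B @ [f']]" "g' = g" using D'(2) by blast
    then have "1 \<le> g \<and> g' = g - 1 \<and> mset (map ?F (cs @ ds)) = add_mset (F A @ [m]) (add_mset (F B @ [m]) (mset (map F cs))) \<or>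
     g' = g \<and> \<not> active W (F B) \<and> mset (map ?F (cs @ ds)) = add_mset (F A @ [m]) (mset (map F cs)) \<or>
     g' = g \<and> \<not> active W (F A) \<and> mset (map ?F (cs @ ds)) = add_mset (F B @ [m]) (mset (map F cs))"
    proof cases
      case a
      then have "mset (map ?F ds) = {#F A @ [m], F B @ [m]#}" by (simp only: list.map FA FB mset.simps)
      then show ?thesis using a unfolding words by simp
    next
      case b
      then have "mset (map ?F ds) = {#F A @ [m]#}" by (simp only: list.map FA mset.simps)
      then show ?thesis using notB[OF b] b unfolding words by simp
    next
      case c
      then have "mset (map ?F ds) = {#F B @ [m]#}" by (simp only: list.map FB mset.simps)
      then show ?thesis using notA[OF c] c unfolding words by simp
    qed
    ultimately show ?thesis by blast
  qed
  show ?thesis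
    using move
  proof cases
    case (move_a f f' l C1 C2)
    note C = cut_cycle_represents[OF rep AB tr move_a(3,4)]
    have f: "f \<noteq> f'" "f \<notin> arcs D" "f' \<notin> arcs D" using move_a(3) by (auto simp: new_edges_def)
    have ar: "arcs C1 = insert f (set A)" "arcs C2 = insert f' (set B)"
      using represents_arcs[OF C(1)] represents_arcs[OF C(2)] by auto
    have ar': "arcs (graph_union C1 C2) = arcs C1 \<union> arcs C2" "verts (graph_union C1 C2) = verts C1 \<union> verts C2"
      by (simp_all add: graph_union_def)
    have "represents (graph_union C1 C2) ([A @ [f]] @ [B @ [f']])"
      by (rule represents_union[OF C(1,2) _ C(3)]) (use ar f arcs sep(3) in auto)
    then have "represents (graph_union ?O (graph_union C1 C2)) (cs @ [A @ [f]] @ [B @ [f']])"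
    proof (rule represents_union[OF C(5)])
      show "arcs ?O \<inter> arcs (graph_union C1 C2) = {}"
        unfolding ar' ar C(6) using f sep(1,2) by blast
      show "verts ?O \<inter> verts (graph_union C1 C2) = {}" unfolding ar' by (rule C(4))
    qed
    then show ?thesis using glue[OF move_a(3,1)] move_a(6) by simp
  next
    case (move_b f f' l C1 C2)
    note C = cut_cycle_represents[OF rep AB tr move_b(3,4)]
    have f: "f \<noteq> f'" "f \<notin> arcs D" "f' \<notin> arcs D" using move_b(3) by (auto simp: new_edges_def)
    have ar: "arcs C1 = insert f (set A)" using represents_arcs[OF C(1)] by auto
    have "arcs ?O \<inter> arcs C1 = {}" unfolding ar C(6) using f sep(1,2) by blast
    moreover have "verts ?O \<inter> verts C1 = {}" using C(4) by blast
    ultimately have "represents (graph_union ?O C1) (cs @ [A @ [f]])"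
      by (rule represents_union[OF C(5) C(1)])
    then show ?thesis using glue[OF move_b(3,1)] by simp
  next
    case (move_c f f' l C1 C2)
    note C = cut_cycle_represents[OF rep AB tr move_c(3,4)]
    have f: "f \<noteq> f'" "f \<notin> arcs D" "f' \<notin> arcs D" using move_c(3) by (auto simp: new_edges_def)
    have ar: "arcs C2 = insert f' (set B)" using represents_arcs[OF C(2)] by auto
    have "arcs ?O \<inter> arcs C2 = {}" unfolding ar C(6) using f sep(1,2) by blast
    moreover have "verts ?O \<inter> verts C2 = {}" using C(4) by blast
    ultimately have "represents (graph_union ?O C2) (cs @ [B @ [f']])"
      by (rule represents_union[OF C(5) C(2)])
    then show ?thesis using glue[OF move_c(3,1)] by simp
  next
    case (move_d f f' l C)
    then show ?thesis using split_vertices(5)[OF rep AB tr] by simp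
  qed
qed

section \<open>From safe words to a strategy for Marker\<close>

definition outcome :: "(nat list multiset \<Rightarrow> int \<Rightarrow> bool) \<Rightarrow> int \<Rightarrow> dgraph \<Rightarrow> (nat \<Rightarrow> 'l) \<Rightarrow> nat \<Rightarrow> 'l state \<Rightarrow> bool"
  where "outcome S E D \<chi> g \<gamma>' \<longleftrightarrow> (\<exists>D' \<chi>' g' W'. \<gamma>' = (D', \<chi>', g') \<and> encodes D' \<chi>' W' \<and>
    card (\<chi>' ` arcs D') \<le> Suc (card (\<chi> ` arcs D)) \<and>
    (1 \<le> g \<and> g' = g - 1 \<and> S W' (E - 1) \<or> g' = g \<and> S W' (E + 3)))"

text \<open>Legality is measured against the current state. It belongs to every history that ends in
  it, so each move of restricted Cutter qualifies.\<close>

definition forces :: "(nat list multiset \<Rightarrow> int \<Rightarrow> bool) \<Rightarrow> int \<Rightarrow> 'l set \<Rightarrow> dgraph \<Rightarrow> (nat \<Rightarrow> 'l) \<Rightarrow> nat \<Rightarrow> choice \<Rightarrow> choice \<Rightarrow> bool"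
  where "forces S E U D \<chi> g v w \<longleftrightarrow> legal_choice D v \<and> legal_choice D w \<and>
    (\<forall>x y \<gamma>'. placed D v w x y \<longrightarrow> cutter_move U (D, \<chi>, g) x y (other_components D x y) g \<gamma>' \<longrightarrow>
       \<not> (\<exists>\<rho>. reduction \<rho> (D, \<chi>, g) \<and> equivalent \<gamma>' \<rho>) \<longrightarrow> outcome S E D \<chi> g \<gamma>')"

lemma placed_Vertex: "placed D (Vertex x) (Vertex y) x' y' \<Longrightarrow> x' = x \<and> y' = y"
  by (auto simp: placed_def)

lemma represents_Nil:
  assumes "represents D cs"
  shows "represents D ([] # cs)"
proof -
  have "\<exists>a. trail D a [] a" by simp
  then show ?thesis
    using assms unfolding represents_def concat.simps append_Nil list.set by blast
qed

lemma represents_start: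
  assumes "represents D (c # cs)" "c \<noteq> []"
  obtains a where "starts_at D a c" "a \<in> verts D"
proof -
  obtain a where "trail D a c a" using assms(1) unfolding represents_def by auto
  then have "starts_at D a c" using assms(2) by (simp add: starts_at_def)
  then show ?thesis using that starts_at_verts[OF assms(1)] assms(2) by blast
qed

text \<open>A place in a word becomes a vertex: the two ends of the sides for a cut, the starting
  points of the words for a join. Dummies enter as additional empty cycles of the representation, so
  that one treatment of joins covers all cases.\<close>

lemma one_move_forces:
  assumes "one_move S W E" "encodes D \<chi> W" and U: "\<chi> ` arcs D \<subseteq> U"
  shows "\<exists>v w. forces S E U D \<chi> g v w"
  using assms(1)
proof cases
  case (split_move A B l M)
  obtain c cs h where c: "represents D (c # cs)" "[] \<notin> set cs" "inj_on h (\<chi> ` arcs D)"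
    "A @ B = map (h \<circ> \<chi>) c" "M = mset (map (map (h \<circ> \<chi>)) cs)"
    using encodes_cycle[OF assms(2)[unfolded split_move(1)]] by metis
  obtain c1 c2 where c12: "c = c1 @ c2" "A = map (h \<circ> \<chi>) c1" "B = map (h \<circ> \<chi>) c2"
    using c(4) by (metis append_eq_map_conv)
  have rep: "represents D ((c1 @ c2) # cs)" and ne: "c1 \<noteq> []" "c2 \<noteq> []"
    using c(1) c12 split_move(3,4) by auto
  obtain x where "trail D x (c1 @ c2) x" using rep unfolding represents_def by auto
  then obtain y where tr: "trail D x c1 y" "trail D y c2 x" unfolding trail_append by blast
  have W: "W = mset (map (map (h \<circ> \<chi>)) ((c1 @ c2) # cs))" using split_move(1) c(5) c12 by simp
  have "l \<notin> (h \<circ> \<chi>) ` arcs D" using split_move(5) labs_words[OF rep, of "h \<circ> \<chi>"] W split_move(1) by metis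
  note out = split_outcome[OF rep c(2) ne tr c(3) this U, folded W]
  have "forces S E U D \<chi> g (Vertex x) (Vertex y)"
    unfolding forces_def
  proof (intro conjI allI impI)
    show "legal_choice D (Vertex x)" "legal_choice D (Vertex y)"
      using split_vertices(2,3)[OF rep ne tr] by (simp_all add: legal_choice_def)
    fix x' y' \<gamma>'
    assume "placed D (Vertex x) (Vertex y) x' y'"
      and mv: "cutter_move U (D, \<chi>, g) x' y' (other_components D x' y') g \<gamma>'"
      and legal: "\<not> (\<exists>\<rho>. reduction \<rho> (D, \<chi>, g) \<and> equivalent \<gamma>' \<rho>)"
    then have "x' = x" "y' = y" using placed_Vertex by blast+
    then have "cutter_move U (D, \<chi>, g) x y (other_components D x y) g \<gamma>'" using mv by simp
    from out[OF this legal] show "outcome S E D \<chi> g \<gamma>'"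
      unfolding outcome_def using split_move(1,6-8) c(5) c12(2,3) by blast
  qed
  then show ?thesis by blast
next
  case (join_move l u v M)
  obtain c cs h where c: "represents D (c # cs)" "c \<noteq> []" "[] \<notin> set cs" "inj_on h (\<chi> ` arcs D)"
    "u = map (h \<circ> \<chi>) c" "add_mset v M = mset (map (map (h \<circ> \<chi>)) cs)"
    using encodes_cycle[OF assms(2)[unfolded join_move(1)]] by metis
  obtain c' cs' where c': "mset cs = mset (c' # cs')" "map (h \<circ> \<chi>) c' = v" "M = mset (map (map (h \<circ> \<chi>)) cs')"
    using mset_map_add[OF c(6)] by metis
  have "set cs = set (c' # cs')" using c'(1) by (metis set_mset_mset)
  then have ne: "c' \<noteq> []" "[] \<notin> set cs'" using c(3) by auto
  have rep: "represents D (c # c' # cs')" by (rule represents_mset[OF c(1)]) (simp add: c'(1))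
  have rep': "represents D (c' # c # cs')" by (rule represents_mset[OF rep]) (simp add: add_mset_commute)
  obtain x where x: "starts_at D x c" "x \<in> verts D" using represents_start[OF rep c(2)] .
  obtain y where y: "starts_at D y c'" "y \<in> verts D" using represents_start[OF rep' ne(1)] .
  have W: "W = mset (map (map (h \<circ> \<chi>)) (c # c' # cs'))" using join_move(1) c c' by simp
  have l: "l \<notin> (h \<circ> \<chi>) ` arcs D"
    using join_move(3) labs_words[OF rep, of "h \<circ> \<chi>"] W join_move(1) by metis
  have xy: "c = [] \<longrightarrow> c' = [] \<longrightarrow> x \<noteq> y" using c(2) by simp
  note out = join_outcome[OF rep ne(2) x(1) y(1) xy c(4) l U]
  have "forces S E U D \<chi> g (Vertex x) (Vertex y)"
    unfolding forces_def
  proof (intro conjI allI impI)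
    show "legal_choice D (Vertex x)" "legal_choice D (Vertex y)"
      using x(2) y(2) by (simp_all add: legal_choice_def)
    fix x' y' \<gamma>'
    assume "placed D (Vertex x) (Vertex y) x' y'"
      and mv: "cutter_move U (D, \<chi>, g) x' y' (other_components D x' y') g \<gamma>'"
    then have "x' = x" "y' = y" using placed_Vertex by blast+
    then have "cutter_move U (D, \<chi>, g) x y (other_components D x y) g \<gamma>'" using mv by simp
    from out[OF this] show "outcome S E D \<chi> g \<gamma>'"
      unfolding outcome_def using join_move(4) c(5) c'(2,3) by blast
  qed
  then show ?thesis by blast
next
  case (join_dummy_move l u M)
  obtain c cs h where c: "represents D (c # cs)" "c \<noteq> []" "[] \<notin> set cs" "inj_on h (\<chi> ` arcs D)"
    "u = map (h \<circ> \<chi>) c" "M = mset (map (map (h \<circ> \<chi>)) cs)"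
    using encodes_cycle[OF assms(2)[unfolded join_dummy_move(1)]] by metis
  obtain x where x: "starts_at D x c" "x \<in> verts D" using represents_start[OF c(1,2)] .
  have rep: "represents D (c # [] # cs)"
    by (rule represents_mset[OF represents_Nil[OF c(1)]]) (simp add: add_mset_commute)
  have W: "W = mset (map (map (h \<circ> \<chi>)) (c # cs))" using join_dummy_move(1) c(5,6) by simp
  have l: "l \<notin> (h \<circ> \<chi>) ` arcs D"
    using join_dummy_move(3) labs_words[OF c(1), of "h \<circ> \<chi>"] W join_dummy_move(1) by metis
  have "forces S E U D \<chi> g (Vertex x) Dummy_w"
    unfolding forces_def
  proof (intro conjI allI impI)
    show "legal_choice D (Vertex x)" "legal_choice D Dummy_w"
      using x(2) by (simp_all add: legal_choice_def)
    fix x' y' \<gamma>'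
    assume pl: "placed D (Vertex x) Dummy_w x' y'"
      and mv: "cutter_move U (D, \<chi>, g) x' y' (other_components D x' y') g \<gamma>'"
    have x': "x' = x" and y': "starts_at D y' []" using pl by (auto simp: placed_def starts_at_def)
    have "c = [] \<longrightarrow> [] = [] \<longrightarrow> x \<noteq> y'" using c(2) by simp
    from join_outcome[OF rep c(3) x(1) y' this c(4) l U mv[unfolded x']]
    obtain D' \<chi>' where "\<gamma>' = (D', \<chi>', g)" "encodes D' \<chi>' (add_mset (u @ [l, l]) M)"
      "card (\<chi>' ` arcs D') \<le> Suc (card (\<chi> ` arcs D))"
      by (auto simp: c(5,6))
    then show "outcome S E D \<chi> g \<gamma>'" unfolding outcome_def using join_dummy_move(4) by blast
  qed
  then show ?thesis by blast
next
  case (dummies_move l)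
  obtain cs h where cs: "represents D cs" "[] \<notin> set cs" "inj_on h (\<chi> ` arcs D)"
    "W = mset (map (map (h \<circ> \<chi>)) cs)"
    using assms(2) unfolding encodes_def by blast
  have rep: "represents D ([] # [] # cs)" using cs(1) by (intro represents_Nil)
  have l: "l \<notin> (h \<circ> \<chi>) ` arcs D"
    using dummies_move(2) labs_words[OF cs(1), of "h \<circ> \<chi>"] cs(4) by metis
  have "forces S E U D \<chi> g Dummy_v Dummy_w"
    unfolding forces_def
  proof (intro conjI allI impI)
    show "legal_choice D Dummy_v" "legal_choice D Dummy_w" by (simp_all add: legal_choice_def)
    fix x y \<gamma>'
    assume pl: "placed D Dummy_v Dummy_w x y"
      and mv: "cutter_move U (D, \<chi>, g) x y (other_components D x y) g \<gamma>'"
    have xy: "starts_at D x []" "starts_at D y []" "[] = [] \<longrightarrow> [] = [] \<longrightarrow> x \<noteq> y"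
      using pl by (auto simp: placed_def starts_at_def)
    from join_outcome[OF rep cs(2) xy cs(3) l U mv]
    obtain D' \<chi>' where "\<gamma>' = (D', \<chi>', g)" "encodes D' \<chi>' (add_mset [l, l] W)"
      "card (\<chi>' ` arcs D') \<le> Suc (card (\<chi> ` arcs D))"
      by (auto simp: cs(4))
    then show "outcome S E D \<chi> g \<gamma>'" unfolding outcome_def using dummies_move(3) by blast
  qed
  then show ?thesis by blast
qed

text \<open>Rotating or renaming words leaves the encoded graph as it is, and at a leaf
  \<open>base_move\<close> supplies the move. Hence a forcing choice exists at every safe state and
  all its outcomes are safe again.\<close>

lemma safe_forces:
  assumes "safe W E" "encodes D \<chi> W" "\<chi> ` arcs D \<subseteq> U"
  shows "\<exists>v w. forces safe E U D \<chi> g v w"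
  using assms
proof (induction rule: safe.induct)
  case (safe_base W E)
  then show ?case using one_move_forces[OF base_move] by blast
next
  case (safe_rot v u M E)
  then show ?case using encodes_rotate by blast
next
  case (safe_relabel W E \<pi>)
  then show ?case using encodes_relabel by blast
next
  case (safe_move W E)
  \<comment> \<open>The induction hypothesis concerns \<open>one_move\<close> of a conjunction, and
    monotonicity discards the second conjunct.\<close>
  have "(\<lambda>W E. safe W E \<and> (encodes D \<chi> W \<longrightarrow> \<chi> ` arcs D \<subseteq> U \<longrightarrow> (\<exists>v w. forces safe E U D \<chi> g v w))) \<le> safe"
    by auto
  from one_move_mono[OF this] have "one_move safe W E" using safe_move.IH unfolding le_fun_def le_bool_def by blast
  then show ?case using one_move_forces safe_move.prems by blast
qed

text \<open>
With \<open>A = g0 - g\<close> moves (a) among the \<open>length H - 1\<close> moves made, \<open>3 N - A\<close> is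
\<open>3 (length H - 1) - 4 (g0 - g)\<close>.
\<close>

definition winning :: "nat \<Rightarrow> 'l state list \<Rightarrow> bool" where
  "winning g0 H \<longleftrightarrow> H \<noteq> [] \<and> (\<exists>D \<chi> g W. last H = (D, \<chi>, g) \<and> encodes D \<chi> W \<and> g \<le> g0 \<and>
     safe W (3 * (int (length H) - 1) - 4 * (int g0 - int g)) \<and> card (\<chi> ` arcs D) < length H)"

lemma winning_step:
  assumes "winning g0 H"
  shows "\<exists>v w. legal_choice (fst (last H)) v \<and> legal_choice (fst (last H)) w \<and>
    (\<forall>\<gamma>'. restricted_cutter_move H v w \<gamma>' \<longrightarrow> winning g0 (H @ [\<gamma>']))"
proof -
  define E where "E g = 3 * (int (length H) - 1) - 4 * (int g0 - int g)" for g
  obtain D \<chi> g W where H: "H \<noteq> []" "last H = (D, \<chi>, g)" "encodes D \<chi> W" "g \<le> g0"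
    "safe W (E g)" "card (\<chi> ` arcs D) < length H"
    using assms unfolding winning_def E_def by blast
  let ?U = "\<Union>\<gamma>\<in>set H. labels \<gamma>"
  have last: "(D, \<chi>, g) \<in> set H" using H(1,2) last_in_set by metis
  then have "\<chi> ` arcs D \<subseteq> ?U" by force
  then obtain v w where f: "forces safe (E g) ?U D \<chi> g v w" using safe_forces[OF H(5,3)] by blast
  have "winning g0 (H @ [\<gamma>'])" if r: "restricted_cutter_move H v w \<gamma>'" for \<gamma>'
  proof -
    have "outcome safe (E g) D \<chi> g \<gamma>'"
    proof -
      obtain x y where "placed D v w x y"
        "cutter_move ?U (D, \<chi>, g) x y (other_components D x y) g \<gamma>'"
        using r unfolding restricted_cutter_move_def H(2) prod.case by blast
      moreover have "\<not> (\<exists>\<rho>. reduction \<rho> (D, \<chi>, g) \<and> equivalent \<gamma>' \<rho>)"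
        using r last unfolding restricted_cutter_move_def by blast
      ultimately show ?thesis using f unfolding forces_def by blast
    qed
    then obtain D' \<chi>' g' W' where o: "\<gamma>' = (D', \<chi>', g')" "encodes D' \<chi>' W'"
      "card (\<chi>' ` arcs D') \<le> Suc (card (\<chi> ` arcs D))"
      "1 \<le> g \<and> g' = g - 1 \<and> safe W' (E g - 1) \<or> g' = g \<and> safe W' (E g + 3)"
      unfolding outcome_def by blast
    \<comment> \<open>One more move adds \<open>3\<close>; if it is (a), the counter falls by one
      and \<open>4\<close> is subtracted, which gives the change \<open>-1\<close>.\<close>
    have "safe W' (3 * (int (length (H @ [\<gamma>'])) - 1) - 4 * (int g0 - int g'))" "g' \<le> g0"
      using o(4) H(4) by (auto simp: E_def of_nat_diff algebra_simps)
    then show ?thesis unfolding winning_def using o(1-3) H(6) by auto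
  qed
  then show ?thesis using f H(2) unfolding forces_def by auto
qed

lemma winning_start: "winning g0 [initial_state g0]"
proof -
  have "represents \<lparr>verts = {}, arcs = {}, tail = undefined, head = undefined\<rparr> []"
    by (simp add: represents_def)
  then have "encodes \<lparr>verts = {}, arcs = {}, tail = undefined, head = undefined\<rparr> undefined {#}"
    by (intro encodesI[where h = undefined]) auto
  then show ?thesis using safe_start by (auto simp: winning_def initial_state_def)
qed

text \<open>The value is at most the number of moves \<open>length H - 1\<close>, and the bound
  \<open>10\<close> on the potential limits three times that number to
  \<open>4 (g0 - g) + 10\<close>.\<close>

lemma winning_value:
  assumes "winning g0 H"
  shows "real (state_value (last H)) \<le> 4 / 3 * real g0 + 10 / 3"
proof -
  obtain D \<chi> g W where H: "last H = (D, \<chi>, g)"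
    "safe W (3 * (int (length H) - 1) - 4 * (int g0 - int g))" "card (\<chi> ` arcs D) < length H"
    using assms unfolding winning_def by blast
  have "3 * int (card (\<chi> ` arcs D)) \<le> 4 * int g0 + 10"
    using safe_le_10[OF H(2)] H(3) by (simp add: of_nat_less_iff[symmetric, where 'a = int] del: of_nat_less_iff)
  then have "3 * real (card (\<chi> ` arcs D)) \<le> 4 * real g0 + 10" by linarith
  then show ?thesis by (simp add: H(1) state_value_def)
qed

theorem theorem5p6:
  fixes g0 :: nat
  assumes "infinite (UNIV :: 'l set)"
  shows "\<exists>\<sigma> :: 'l strategy. marker_strategy \<sigma> \<and>
           (\<forall>H. play \<sigma> g0 H \<longrightarrow>
              (\<forall>\<gamma> \<in> set H. real (state_value \<gamma>) \<le> 4 / 3 * real g0 + 10 / 3))"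
proof -
  define good where "good H c \<longleftrightarrow> legal_choice (fst (last H)) (fst c) \<and> legal_choice (fst (last H)) (snd c) \<and>
    (\<forall>\<gamma>'. restricted_cutter_move H (fst c) (snd c) \<gamma>' \<longrightarrow> winning g0 (H @ [\<gamma>']))"
    for H :: "'l state list" and c
  \<comment> \<open>A strategy must choose legally at every history of game states, including those
    that cannot arise in play, so a choice of dummies serves as the default.\<close>
  define \<sigma> :: "'l strategy" where
    "\<sigma> H = (if winning g0 H then SOME c. good H c else (Dummy_v, Dummy_v))" for H
  have good: "good H (\<sigma> H)" if "winning g0 H" for H
  proof -
    have "\<exists>c. good H c" using winning_step[OF that] by (simp add: good_def)
    then have "good H (SOME c. good H c)" by (rule someI_ex)
    then show ?thesis using that by (simp add: \<sigma>_def)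
  qed
  have "legal_choice (fst (last H)) (fst (\<sigma> H)) \<and> legal_choice (fst (last H)) (snd (\<sigma> H))" for H
  proof (cases "winning g0 H")
    case True
    then show ?thesis using good[of H] by (simp add: good_def)
  next
    case False
    then show ?thesis by (simp add: \<sigma>_def legal_choice_def)
  qed
  then have "marker_strategy \<sigma>" unfolding marker_strategy_def by blast
  moreover have "winning g0 H \<and> (\<forall>\<gamma>\<in>set H. real (state_value \<gamma>) \<le> 4 / 3 * real g0 + 10 / 3)"
    if "play \<sigma> g0 H" for H
    using that
  proof induction
    case start
    then show ?case using winning_start[of g0] winning_value[OF winning_start[of g0]] by simp
  next
    case (step H \<gamma>')
    then have "winning g0 (H @ [\<gamma>'])" using good[of H] unfolding good_def by blast
    then show ?case using winning_value[of g0 "H @ [\<gamma>']"] step.IH by simp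
  qed
  ultimately show ?thesis by blast
qed

end
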